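(* There is an absolute constant $c>0$ such that for every finite set $A\subset\mathbb{H}$ of quaternions, \[ |A+A| + |AA| \gg |A|^{4/3+c}. \]
   Context: $\mathbb{H}$ denotes the real quaternions. For finite $A,B\subset\mathbb{H}$: $A+B=\{a+b: a\in A, b\in B\}$ and $AB=\{ab: a\in A, b\in B\}$ (quaternion multiplication, which is not commutative). $X\gg Y$ means $X\ge C\,Y$ for some absolute constant $C>0$. *)

theory Defs
  imports Complex_Main
begin

datatype quat = Quat (Re: real) (Im1: real) (Im2: real) (Im3: real)

definition qadd :: "quat \<Rightarrow> quat \<Rightarrow> quat" where
  "qadd p q = Quat (Re p + Re q) (Im1 p + Im1 q) (Im2 p + Im2 q) (Im3 p + Im3 q)"

definition qmult :: "quat \<Rightarrow> quat \<Rightarrow> quat" where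
  "qmult p q = Quat
     (Re p * Re q - Im1 p * Im1 q - Im2 p * Im2 q - Im3 p * Im3 q)
     (Re p * Im1 q + Im1 p * Re q + Im2 p * Im3 q - Im3 p * Im2 q)
     (Re p * Im2 q - Im1 p * Im3 q + Im2 p * Re q + Im3 p * Im1 q)
     (Re p * Im3 q + Im1 p * Im2 q - Im2 p * Im1 q + Im3 p * Re q)"

definition sumset :: "quat set \<Rightarrow> quat set \<Rightarrow> quat set" where
  "sumset A B = {qadd a b | a b. a \<in> A \<and> b \<in> B}"

definition prodset :: "quat set \<Rightarrow> quat set \<Rightarrow> quat set" where
  "prodset A B = {qmult a b | a b. a \<in> A \<and> b \<in> B}"

end

theory Submission
  imports Defs "HOL-Analysis.Convex"
begin

text \<open>
Solymosi's argument gives exponent 4/3: view the points \<open>(a, a * x)\<close> of \<open>A \<times> A\<close> as lying on a line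
of slope \<open>x\<close>, and add points on nearest neighbouring lines; in \<open>\<real>\<^sup>4\<close> a packing argument replaces the
ordering of the slopes, once \<open>A\<close> is restricted to a narrow cone of directions. The gain comes from adding points
on each line to points on its \<open>m\<close> nearest lines, with \<open>m\<close> a small power of \<open>card A\<close>. If nothing is
gained, then for many slopes \<open>x\<close> the set \<open>F x = {a \<in> A. a * x \<in> A}\<close> occurs in a linear equation
\<open>c * \<mu>1 + d * \<mu>2 = e * \<mu>3\<close> with about \<open>(card (F x))\<^sup>2\<close> solutions from such sets.

Additive Balog--Szemeredi--Gowers then yields \<open>H \<subseteq> F x\<close> with small \<open>H + H\<close>, hence large \<open>H * H\<close>, and since
\<open>H * H\<close> and \<open>H * H * x\<close> both lie in \<open>A * A\<close>, right multiplication by \<open>x\<close> maps a large part of \<open>A * A\<close> into itself.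
Multiplicative Balog--Szemeredi--Gowers turns this into a large \<open>C \<subseteq> A\<close> and a set \<open>W\<close>, of size about
\<open>card (A * A)\<close>, much of which stays in \<open>W\<close> under right multiplication by any
ratio \<open>inverse c * d\<close> from \<open>C\<close>. Repeating the first step inside \<open>C\<close> produces many \<open>p = inverse d * c\<close> for which both \<open>p\<close>
and \<open>(p * \<mu>1 + \<mu>2) * inverse \<mu>3\<close> are ratios from \<open>C\<close>. An elementary nearest-neighbour incidence bound
(after Solymosi's proof for complex numbers, in place of Szemeredi--Trotter) shows both that there are
many such \<open>p\<close> and that there cannot be so many.
\<close>

section \<open>Quaternions as a real normed division algebra\<close>

text \<open>The exponents fix all sizes. With \<open>card A = q ^ 3\<close> and about
  \<open>q ^ 4\<close> sums and products, there are about \<open>q ^ 4\<close> slopes with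
  \<open>r\<close> points each, \<open>r\<close> about \<open>q ^ 2\<close>, and the basic argument
  is tight. The relation found inside \<open>C\<close> yields at least \<open>r powr (3/2)\<close>,
  about \<open>q ^ 3\<close>, values of \<open>p\<close>, while a \<open>W\<close> of size
  \<open>q ^ 4\<close> tolerates only about \<open>q powr (8/3)\<close>. All losses, written as
  powers of one parameter \<open>B\<close>, have to fit into this margin.

  The cone keeps the slope of a sum no farther from either summand's slope than these are from each
  other. This replaces betweenness of real slopes.

  Non-commutativity dictates the sides. Lines are given by \<open>a * x\<close>, so slopes act from
  the right, \<open>H * H * x\<close> regroups as \<open>H * (H * x)\<close>, and only right
  multiplication on \<open>A * A\<close> is controlled. In ratios \<open>inverse c * d\<close> a
  common left factor cancels. The second pass runs inside \<open>C\<close> because only ratios from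
  \<open>C\<close>, not those from \<open>A\<close>, are known to act on \<open>W\<close>.\<close>

instantiation quat :: real_normed_div_algebra
begin

definition "0 = Quat 0 0 0 0"
definition "1 = Quat 1 0 0 0"
definition "p + q = qadd p q" for p q :: quat
definition "p * q = qmult p q" for p q :: quat
definition "- p = Quat (- quat.Re p) (- Im1 p) (- Im2 p) (- Im3 p)" for p :: quat
definition "p - q = p + (- q)" for p q :: quat
definition "r *\<^sub>R p = Quat (r * quat.Re p) (r * Im1 p) (r * Im2 p) (r * Im3 p)" for p :: quat
definition "norm p = sqrt ((quat.Re p)\<^sup>2 + (Im1 p)\<^sup>2 + ((Im2 p)\<^sup>2 + (Im3 p)\<^sup>2))"
definition "inverse p = inverse ((norm p)\<^sup>2) *\<^sub>R Quat (quat.Re p) (- Im1 p) (- Im2 p) (- Im3 p)" for p :: quat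
definition "p div q = p * inverse q" for p q :: quat
definition "sgn p = inverse (norm p) *\<^sub>R p" for p :: quat
definition "dist p q = norm (p - q)" for p q :: quat
definition "(uniformity :: (quat \<times> quat) filter) = (INF e\<in>{0 <..}. principal {(x, y). dist x y < e})"
definition "open (U :: quat set) \<longleftrightarrow> (\<forall>x\<in>U. eventually (\<lambda>(x', y). x' = x \<longrightarrow> y \<in> U) uniformity)"

lemmas quat_class_defs = zero_quat_def one_quat_def plus_quat_def times_quat_def uminus_quat_def
  minus_quat_def scaleR_quat_def qadd_def qmult_def

lemma norm_quat_sq: "(norm p)\<^sup>2 = (quat.Re p)\<^sup>2 + (Im1 p)\<^sup>2 + ((Im2 p)\<^sup>2 + (Im3 p)\<^sup>2)" for p :: quat
  by (simp add: norm_quat_def)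

lemma norm_quat_eq_0: "norm p = 0 \<longleftrightarrow> p = 0" for p :: quat
  by (cases p) (auto simp: norm_quat_def zero_quat_def add_nonneg_eq_0_iff)

instance
proof
  fix r s :: real and x y z :: quat and S :: "quat set"
  show "x + y + z = x + (y + z)" "x + y = y + x" "0 + x = x" "- x + x = 0" "x - y = x + - y"
    "r *\<^sub>R (x + y) = r *\<^sub>R x + r *\<^sub>R y" "(r + s) *\<^sub>R x = r *\<^sub>R x + s *\<^sub>R x"
    "r *\<^sub>R s *\<^sub>R x = (r * s) *\<^sub>R x" "1 *\<^sub>R x = x"
    "x * y * z = x * (y * z)" "1 * x = x" "x * 1 = x" "(x + y) * z = x * z + y * z"
    "x * (y + z) = x * y + x * z" "(0::quat) \<noteq> 1" "r *\<^sub>R x * y = r *\<^sub>R (x * y)"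
    "x * r *\<^sub>R y = r *\<^sub>R (x * y)"
    by (simp_all add: quat_class_defs algebra_simps)
  show "(norm x = 0) = (x = 0)"
    by (rule norm_quat_eq_0)
  show "norm (x + y) \<le> norm x + norm y"
  proof -
    let ?u = "\<lambda>p. sqrt ((quat.Re p)\<^sup>2 + (Im1 p)\<^sup>2)" and ?v = "\<lambda>p. sqrt ((Im2 p)\<^sup>2 + (Im3 p)\<^sup>2)"
    \<comment> \<open>Pairing the four squares lets the planar triangle inequality be applied inside
      each pair and then to the two resulting lengths.\<close>
    have n: "norm p = sqrt ((?u p)\<^sup>2 + (?v p)\<^sup>2)" for p :: quat
      by (simp add: norm_quat_def)
    have "?u (x + y) \<le> ?u x + ?u y" "?v (x + y) \<le> ?v x + ?v y"
      by (simp_all add: quat_class_defs real_sqrt_sum_squares_triangle_ineq)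
    then have "norm (x + y) \<le> sqrt ((?u x + ?u y)\<^sup>2 + (?v x + ?v y)\<^sup>2)"
      unfolding n by (intro real_sqrt_le_mono add_mono power_mono) auto
    also have "\<dots> \<le> norm x + norm y"
      unfolding n by (rule real_sqrt_sum_squares_triangle_ineq)
    finally show ?thesis .
  qed
  show "norm (r *\<^sub>R x) = \<bar>r\<bar> * norm x"
    by (simp add: norm_quat_def quat_class_defs power_mult_distrib distrib_left [symmetric]
        real_sqrt_mult)
  show "norm (x * y) = norm x * norm y"
    unfolding norm_quat_def real_sqrt_mult [symmetric]
    by (rule arg_cong [where f = sqrt])
      (simp add: quat_class_defs power2_eq_square algebra_simps)
  show "x \<noteq> 0 \<Longrightarrow> inverse x * x = 1" "x \<noteq> 0 \<Longrightarrow> x * inverse x = 1"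
  proof -
    assume "x \<noteq> 0"
    then have "(norm x)\<^sup>2 \<noteq> 0"
      by (simp add: norm_quat_eq_0)
    then show "inverse x * x = 1" "x * inverse x = 1"
      unfolding inverse_quat_def
      by (simp_all add: quat_class_defs field_simps)
        (simp_all add: norm_quat_sq flip: power2_eq_square)
  qed
  show "inverse (0::quat) = 0"
    by (simp add: inverse_quat_def quat_class_defs)
  show "x div y = x * inverse y"
    by (rule divide_quat_def)
qed (rule sgn_quat_def dist_quat_def open_quat_def uniformity_quat_def)+

end

section \<open>Set operations, conjugation and a grid of cells\<close>

lemma sumset_conv: "sumset A B = (\<lambda>(a, b). a + b) ` (A \<times> B)"
  by (auto simp: sumset_def plus_quat_def)

lemma prodset_conv: "prodset A B = (\<lambda>(a, b). a * b) ` (A \<times> B)"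
  by (auto simp: prodset_def times_quat_def)

text \<open>An isometric anti-automorphism: it exchanges left and right multiplication, so a bound
  proved on one side transfers to the other.\<close>

definition qcnj :: "quat \<Rightarrow> quat" where
  "qcnj p = Quat (quat.Re p) (- Im1 p) (- Im2 p) (- Im3 p)"

lemma qcnj_add: "qcnj (p + q) = qcnj p + qcnj q"
  and qcnj_mult: "qcnj (p * q) = qcnj q * qcnj p"
  and qcnj_qcnj [simp]: "qcnj (qcnj p) = p"
  and norm_qcnj [simp]: "norm (qcnj p) = norm p"
  by (simp_all add: qcnj_def quat_class_defs norm_quat_def)

lemma qcnj_eq_0_iff [simp]: "qcnj p = 0 \<longleftrightarrow> p = 0"
  by (metis norm_qcnj norm_eq_zero)

lemma inj_qcnj: "inj qcnj"
  by (metis injI qcnj_qcnj)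

text \<open>A grid of side 1/4: in dimension 4 its cells have diameter 1/2, and being half-open they
  give a strict distance bound. Of the 9 indices per coordinate in the unit ball, 4 is reached only
  by the coordinate 1; hence \<open>9 ^ 4 = 6561\<close> cells.\<close>

definition cell :: "quat \<Rightarrow> int \<times> int \<times> int \<times> int" where
  "cell p = (\<lfloor>4 * quat.Re p\<rfloor>, \<lfloor>4 * Im1 p\<rfloor>, \<lfloor>4 * Im2 p\<rfloor>, \<lfloor>4 * Im3 p\<rfloor>)"

definition cells :: "(int \<times> int \<times> int \<times> int) set" where
  "cells = {-4..4} \<times> {-4..4} \<times> {-4..4} \<times> {-4..4}"

lemma finite_cells: "finite cells" and card_cells: "card cells = 6561"
  by (simp_all add: cells_def card_cartesian_product)

lemma cell_in_cells:
  assumes "norm p \<le> 1"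
  shows "cell p \<in> cells"
proof -
  have "\<bar>t\<bar> \<le> 1" if "t\<^sup>2 \<le> (norm p)\<^sup>2" for t
    using that assms by (metis abs_le_square_iff abs_norm_cancel order_trans)
  then have "\<bar>quat.Re p\<bar> \<le> 1" "\<bar>Im1 p\<bar> \<le> 1" "\<bar>Im2 p\<bar> \<le> 1" "\<bar>Im3 p\<bar> \<le> 1"
    by (simp_all add: norm_quat_sq)
  moreover have "\<lfloor>4 * t\<rfloor> \<in> {-4..4}" if "\<bar>t\<bar> \<le> 1" for t :: real
    using that by (auto simp: abs_le_iff le_floor_iff floor_le_iff)
  ultimately show ?thesis
    by (simp add: cell_def cells_def)
qed

lemma norm_diff_less_of_cell_eq:
  assumes "cell p = cell q"
  shows "norm (p - q) < 1 / 2"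
proof -
  have *: "(s - t)\<^sup>2 < (1/4)\<^sup>2" if "\<lfloor>4 * s\<rfloor> = \<lfloor>4 * t\<rfloor>" for s t :: real
  proof -
    have "\<bar>s - t\<bar> < 1/4"
      using that by linarith
    then have "\<bar>s - t\<bar>\<^sup>2 < (1/4)\<^sup>2"
      by (intro power_strict_mono) auto
    then show ?thesis
      by simp
  qed
  have "(norm (p - q))\<^sup>2 < (1/4)\<^sup>2 + (1/4)\<^sup>2 + ((1/4)\<^sup>2 + (1/4)\<^sup>2)"
    using assms unfolding norm_quat_sq
    by (intro add_strict_mono) (auto simp: quat_class_defs cell_def intro!: *[simplified])
  then have "(norm (p - q))\<^sup>2 < (1/2)\<^sup>2"
    by (simp add: power2_eq_square)
  then show ?thesis
    by (rule power_less_imp_less_base) simp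
qed

section \<open>Packing and incidences of similarities\<close>

lemma card_le_fibres:
  assumes "finite T" "finite D" "k ` T \<subseteq> D" "\<And>c. c \<in> D \<Longrightarrow> card {x \<in> T. k x = c} \<le> m"
  shows "card T \<le> card D * m"
proof -
  have "T = (\<Union>c\<in>D. {x \<in> T. k x = c})"
    using assms(3) by auto
  then have "card T = card (\<Union>c\<in>D. {x \<in> T. k x = c})"
    by (rule arg_cong)
  also have "\<dots> \<le> (\<Sum>c\<in>D. card {x \<in> T. k x = c})"
    by (rule card_UN_le) fact
  also have "\<dots> \<le> card D * m"
    using sum_bounded_above[of D "\<lambda>c. card {x \<in> T. k x = c}" m] assms(4) by simp
  finally show ?thesis .
qed

lemma sum_card_fibres:
  assumes "finite J" "finite Z" "f ` J \<subseteq> Z"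
  shows "(\<Sum>z\<in>Z. card {j \<in> J. f j = z}) = card J"
  using sum_fun_comp[OF assms, of "\<lambda>_. 1::nat"] by simp

lemma double_count:
  assumes "finite A" "finite B"
  shows "(\<Sum>a\<in>A. card {b \<in> B. R a b}) = (\<Sum>b\<in>B. card {a \<in> A. R a b})"
  by (rule sum_multicount_gen) (use assms in auto)

text \<open>Cauchy-Schwarz for the fibre sizes of \<open>f\<close>. The pairs are ordered and
  include the diagonal.\<close>

lemma collisions:
  assumes "finite J" "finite Z" "f ` J \<subseteq> Z"
  shows "(real (card J))\<^sup>2 \<le> real (card Z) * real (card {(i, j). i \<in> J \<and> j \<in> J \<and> f i = f j})"
proof -
  let ?c = "\<lambda>z. card {j \<in> J. f j = z}"
  have "{(i, j). i \<in> J \<and> j \<in> J \<and> f i = f j} = (SIGMA i:J. {j \<in> J. f j = f i})"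
    by auto
  then have "card {(i, j). i \<in> J \<and> j \<in> J \<and> f i = f j} = (\<Sum>i\<in>J. ?c (f i))"
    using assms by simp
  also have "\<dots> = (\<Sum>z\<in>Z. ?c z * ?c z)"
    using sum_fun_comp[OF assms, of ?c] by simp
  finally have *: "real (card {(i, j). i \<in> J \<and> j \<in> J \<and> f i = f j}) = (\<Sum>z\<in>Z. (real (?c z))\<^sup>2)"
    by (simp add: power2_eq_square)
  have "(\<Sum>z\<in>Z. real (?c z))\<^sup>2 \<le> (\<Sum>z\<in>Z. (real (?c z))\<^sup>2) * card Z"
    by (rule sum_squared_le_sum_of_squares)
  also have "(\<Sum>z\<in>Z. real (?c z)) = card J"
    using sum_card_fibres[OF assms] by (simp flip: of_nat_sum)
  finally show ?thesis
    by (simp add: * mult.commute)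
qed

text \<open>Split \<open>b - a\<close> into a radial part and a change of direction, the latter
  costing at most \<open>norm a / 2\<close>. Hence a nonzero \<open>a\<close> is strictly closer to
  \<open>b\<close> than 0 is, which drives all the packing below.\<close>

lemma norm_diff_le_of_cell_sgn_eq:
  fixes a b :: quat
  assumes "cell (sgn a) = cell (sgn b)" "norm a \<le> norm b"
  shows "norm (b - a) \<le> norm b - norm a / 2"
proof -
  have s: "norm x *\<^sub>R sgn x = x" for x :: quat
    by (cases "x = 0") (simp_all add: sgn_div_norm)
  have "b - a = (norm b - norm a) *\<^sub>R sgn b + norm a *\<^sub>R (sgn b - sgn a)"
    by (simp add: s algebra_simps)
  also have "norm \<dots> \<le> (norm b - norm a) * norm (sgn b) + norm a * norm (sgn b - sgn a)"
    by (rule norm_triangle_le) (use assms in simp)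
  also have "\<dots> \<le> (norm b - norm a) * 1 + norm a * (1 / 2)"
    using assms norm_diff_less_of_cell_eq[of "sgn b" "sgn a"]
    by (intro add_mono mult_left_mono) (auto simp: norm_sgn)
  finally show ?thesis
    by simp
qed

text \<open>\<open>sgn 0 = 0\<close> is at distance 1 from every unit vector, too far to share a
  cell.\<close>

lemma cell_sgn_eq_0:
  assumes "cell (sgn a) = cell (sgn 0)"
  shows "a = 0"
proof (rule ccontr)
  assume "a \<noteq> 0"
  then show False
    using norm_diff_less_of_cell_eq[OF assms] by (simp add: norm_sgn)
qed

lemma cell_sgn_in_cells: "cell (sgn a) \<in> cells"
  by (rule cell_in_cells) (simp add: norm_sgn)

lemma obtain_max:
  fixes f :: "'a \<Rightarrow> real"
  assumes "finite T" "T \<noteq> {}"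
  obtains x where "x \<in> T" "\<And>z. z \<in> T \<Longrightarrow> f z \<le> f x"
proof -
  have "Max (f ` T) \<in> f ` T"
    using assms by simp
  then show ?thesis
    using that assms by (metis (no_types, lifting) Max_ge finite_imageI imageE imageI)
qed

text \<open>Sort the centres by their direction from \<open>w\<close>. The farthest centre
  \<open>x\<close> of a class is within \<open>\<rho> x\<close> of \<open>w\<close> and strictly
  closer to all others of its class, so its own open ball contains the whole class.\<close>

lemma card_covering_balls:
  fixes S :: "quat set"
  assumes "finite S" "1 \<le> m" and m: "\<And>x. x \<in> S \<Longrightarrow> card {z \<in> S. norm (z - x) < \<rho> x} \<le> m"
  shows "card {x \<in> S. norm (x - w) \<le> \<rho> x} \<le> 6561 * m"
proof -
  let ?T = "{x \<in> S. norm (x - w) \<le> \<rho> x}"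
  have "card ?T \<le> card cells * m"
  proof (rule card_le_fibres[where k = "\<lambda>x. cell (sgn (x - w))"])
    fix c
    let ?C = "{x \<in> ?T. cell (sgn (x - w)) = c}"
    show "card ?C \<le> m"
    proof (cases "?C = {}")
      case True
      then show ?thesis by (simp only: card.empty le0)
    next
      case False
      have fin: "finite ?C"
        using assms by simp
      obtain x where x: "x \<in> ?C" and max: "\<And>z. z \<in> ?C \<Longrightarrow> norm (z - w) \<le> norm (x - w)"
        using obtain_max[OF fin False, of "\<lambda>z. norm (z - w)"] by blast
      show ?thesis
      proof (cases "x = w")
        case True
        \<comment> \<open>Positivity of \<open>\<rho>\<close> is not assumed, so the open ball about
          \<open>w\<close> may be empty; here the bound comes from \<open>1 \<le> m\<close>.\<close>
        then have "?C \<subseteq> {w}"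
          using max by force
        then have "card ?C \<le> 1"
          using card_mono[of "{w}" ?C] by simp
        then show ?thesis
          using assms by simp
      next
        case False
        have "?C \<subseteq> {z \<in> S. norm (z - x) < \<rho> x}"
        proof
          fix z assume z: "z \<in> ?C"
          then have "cell (sgn (z - w)) = cell (sgn (x - w))"
            using x by simp
          then have "norm ((x - w) - (z - w)) \<le> norm (x - w) - norm (z - w) / 2"
            using max[OF z] by (rule norm_diff_le_of_cell_sgn_eq)
          then have "norm (x - z) \<le> norm (x - w) - norm (z - w) / 2"
            by simp
          moreover have "z \<noteq> w"
            using x z False cell_sgn_eq_0[of "x - w"] by auto
          then have "0 < norm (z - w)"
            by simp
          ultimately have "norm (x - z) < norm (x - w)"
            by linarith
          then show "z \<in> {z \<in> S. norm (z - x) < \<rho> x}"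
            using x z by (auto simp: norm_minus_commute)
        qed
        then have "card ?C \<le> card {z \<in> S. norm (z - x) < \<rho> x}"
          using assms by (intro card_mono) auto
        then show ?thesis
          using m[of x] x by simp
      qed
    qed
  qed (use assms in \<open>auto simp: cell_sgn_in_cells finite_cells\<close>)
  then show ?thesis
    by (simp add: card_cells)
qed

text \<open>Two regimes. Centres within \<open>2 * \<rho> x\<close> are sorted by grid cells, scaled
  so that distances in a cell are below \<open>\<rho> x\<close>. Farther ones are sorted by
  direction: seen from the farthest \<open>y\<close> of a class, the saving
  \<open>norm (z - x) / 2 > \<rho> x\<close> reduces \<open>\<rho> y + \<rho> x\<close> to less than
  \<open>\<rho> y\<close>. Arbitrarily many small balls can meet a large one, hence the condition on
  the radii.\<close>

lemma card_larger_meeting_balls: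
  fixes S :: "quat set"
  assumes "finite S" "1 \<le> m" and m: "\<And>x. x \<in> S \<Longrightarrow> card {z \<in> S. norm (z - x) < \<rho> x} \<le> m"
    and "0 < \<rho> x"
  shows "card {z \<in> S. \<rho> x \<le> \<rho> z \<and> norm (z - x) \<le> \<rho> z + \<rho> x} \<le> 13122 * m"
proof -
  let ?T = "{z \<in> S. \<rho> x \<le> \<rho> z \<and> norm (z - x) \<le> \<rho> z + \<rho> x}"
  let ?N = "{z \<in> ?T. norm (z - x) \<le> 2 * \<rho> x}" and ?F = "{z \<in> ?T. norm (z - x) > 2 * \<rho> x}"
  have "card ?N \<le> card cells * m"
  proof (rule card_le_fibres[where k = "\<lambda>z. cell ((z - x) /\<^sub>R (2 * \<rho> x))"])
    show "(\<lambda>z. cell ((z - x) /\<^sub>R (2 * \<rho> x))) ` ?N \<subseteq> cells"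
      using \<open>0 < \<rho> x\<close> by (auto intro!: cell_in_cells simp: divide_simps simp del: scaleR_right_diff_distrib)
    fix c
    let ?C = "{z \<in> ?N. cell ((z - x) /\<^sub>R (2 * \<rho> x)) = c}"
    show "card ?C \<le> m"
    proof (cases "?C = {}")
      case False
      then obtain y where y: "y \<in> ?C"
        by blast
      have "?C \<subseteq> {z \<in> S. norm (z - y) < \<rho> y}"
      proof
        fix z assume z: "z \<in> ?C"
        have "(z - x) /\<^sub>R (2 * \<rho> x) - (y - x) /\<^sub>R (2 * \<rho> x) = (z - y) /\<^sub>R (2 * \<rho> x)"
          by (simp add: algebra_simps)
        moreover have "norm ((z - x) /\<^sub>R (2 * \<rho> x) - (y - x) /\<^sub>R (2 * \<rho> x)) < 1 / 2"
          using y z by (intro norm_diff_less_of_cell_eq) simp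
        ultimately have "norm ((z - y) /\<^sub>R (2 * \<rho> x)) < 1 / 2"
          by simp
        then have "norm (z - y) < \<rho> x"
          using \<open>0 < \<rho> x\<close> by (simp add: divide_simps del: scaleR_right_diff_distrib)
        then show "z \<in> {z \<in> S. norm (z - y) < \<rho> y}"
          using y z by auto
      qed
      then have "card ?C \<le> card {z \<in> S. norm (z - y) < \<rho> y}"
        using assms by (intro card_mono) auto
      then show ?thesis
        using m[of y] y by simp
    qed (simp only: card.empty le0)
  qed (use assms in \<open>auto simp: finite_cells\<close>)
  moreover have "card ?F \<le> card cells * m"
  proof (rule card_le_fibres[where k = "\<lambda>z. cell (sgn (z - x))"])
    fix c
    let ?C = "{z \<in> ?F. cell (sgn (z - x)) = c}"
    show "card ?C \<le> m"
    proof (cases "?C = {}")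
      case False
      have fin: "finite ?C"
        using assms by simp
      obtain y where y: "y \<in> ?C" and max: "\<And>z. z \<in> ?C \<Longrightarrow> norm (z - x) \<le> norm (y - x)"
        using obtain_max[OF fin False, of "\<lambda>z. norm (z - x)"] by blast
      have "?C \<subseteq> {z \<in> S. norm (z - y) < \<rho> y}"
      proof
        fix z assume z: "z \<in> ?C"
        then have "cell (sgn (z - x)) = cell (sgn (y - x))"
          using y by simp
        then have "norm ((y - x) - (z - x)) \<le> norm (y - x) - norm (z - x) / 2"
          using max[OF z] by (rule norm_diff_le_of_cell_sgn_eq)
        then have "norm (y - z) < \<rho> y"
          using y z by auto
        then show "z \<in> {z \<in> S. norm (z - y) < \<rho> y}"
          using z by (auto simp: norm_minus_commute)
      qed
      then have "card ?C \<le> card {z \<in> S. norm (z - y) < \<rho> y}"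
        using assms by (intro card_mono) auto
      then show ?thesis
        using m[of y] y by simp
    qed (simp only: card.empty le0)
  qed (use assms in \<open>auto simp: cell_sgn_in_cells finite_cells\<close>)
  moreover have "card ?T \<le> card ?N + card ?F"
    by (rule order_trans[OF card_mono card_Un_le]) (use assms in auto)
  ultimately show ?thesis
    by (simp add: card_cells)
qed

section \<open>An incidence bound from nearest neighbours\<close>

definition close_pairs :: "real \<Rightarrow> quat set \<Rightarrow> (quat \<times> quat) set" where
  "close_pairs k Z = (SIGMA z:Z. {z' \<in> Z. real (card {u \<in> Z. norm (u - z) \<le> norm (z' - z)}) \<le> k})"

text \<open>Every partner of \<open>z\<close> lies in the ball reaching to its farthest partner, and
  by definition that ball, ties included, has at most \<open>k\<close> points.\<close>

lemma card_close_pairs: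
  assumes "finite Z" "0 \<le> k"
  shows "real (card (close_pairs k Z)) \<le> k * real (card Z)"
proof -
  have "real (card {z' \<in> Z. real (card {u \<in> Z. norm (u - z) \<le> norm (z' - z)}) \<le> k}) \<le> k"
    (is "real (card ?D) \<le> k") if "z \<in> Z" for z
  proof (cases "?D = {}")
    case False
    have "finite ?D"
      using assms by simp
    then obtain y where y: "y \<in> ?D" and max: "\<And>z'. z' \<in> ?D \<Longrightarrow> norm (z' - z) \<le> norm (y - z)"
      using obtain_max[OF _ False, of "\<lambda>z'. norm (z' - z)"] by blast
    then have "?D \<subseteq> {u \<in> Z. norm (u - z) \<le> norm (y - z)}"
      by blast
    then have "card ?D \<le> card {u \<in> Z. norm (u - z) \<le> norm (y - z)}"
      using assms by (intro card_mono) auto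
    then show ?thesis
      using y by simp
  qed (use assms in \<open>simp del: Collect_empty_eq\<close>)
  then have "(\<Sum>z\<in>Z. real (card {z' \<in> Z. real (card {u \<in> Z. norm (u - z) \<le> norm (z' - z)}) \<le> k}))
      \<le> card Z * k"
    by (rule sum_bounded_above)
  then show ?thesis
    using assms by (simp add: close_pairs_def mult.commute)
qed

text \<open>A similarity preserves nearest neighbours, so each open ball here contains no other
  image point. Packing with \<open>m = 1\<close> then puts each \<open>z\<close> into at most 6561
  closed balls, and double counting does the rest.\<close>

lemma sum_card_nearest_balls:
  fixes \<phi> :: "quat \<Rightarrow> quat"
  assumes "finite R" "finite Z" "\<phi> ` R \<subseteq> Z"
    and nb: "\<And>a. a \<in> R \<Longrightarrow> nb a \<in> R \<and> nb a \<noteq> a \<and> (\<forall>b\<in>R. b \<noteq> a \<longrightarrow> norm (nb a - a) \<le> norm (b - a))"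
    and sim: "\<And>a b. a \<in> R \<Longrightarrow> b \<in> R \<Longrightarrow> norm (\<phi> a - \<phi> b) = \<kappa> * norm (a - b)" and "0 < \<kappa>"
  shows "(\<Sum>a\<in>R. card {z \<in> Z. norm (z - \<phi> a) \<le> norm (\<phi> (nb a) - \<phi> a)}) \<le> 6561 * card Z"
proof -
  have inj: "inj_on \<phi> R"
    using sim \<open>0 < \<kappa>\<close> by (intro inj_onI) fastforce
  \<comment> \<open>The packing lemma attaches radii to centres, so the radius at an image point is
    read off through the inverse of \<open>\<phi>\<close>.\<close>
  define \<rho> where "\<rho> q = (let a = the_inv_into R \<phi> q in norm (\<phi> (nb a) - \<phi> a))" for q
  have \<rho>: "\<rho> (\<phi> a) = norm (\<phi> (nb a) - \<phi> a)" if "a \<in> R" for a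
    using that by (simp add: \<rho>_def the_inv_into_f_f[OF inj])
  have one: "card {z \<in> \<phi> ` R. norm (z - x) < \<rho> x} \<le> 1" if "x \<in> \<phi> ` R" for x
  proof -
    obtain a where a: "a \<in> R" "x = \<phi> a"
      using \<open>x \<in> \<phi> ` R\<close> by blast
    have "z = x" if z: "z \<in> \<phi> ` R" "norm (z - x) < \<rho> x" for z
    proof -
      obtain b where b: "b \<in> R" "z = \<phi> b"
        using z by blast
      have "norm (b - a) < norm (nb a - a)"
        using z a b nb[OF a(1)] \<open>0 < \<kappa>\<close> by (simp add: \<rho> sim)
      then show ?thesis
        using nb[OF a(1)] a b by force
    qed
    then have "{z \<in> \<phi> ` R. norm (z - x) < \<rho> x} \<subseteq> {x}"
      by blast
    then show ?thesis
      using card_mono[of "{x}"] by fastforce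
  qed
  have "card {a \<in> R. norm (z - \<phi> a) \<le> norm (\<phi> (nb a) - \<phi> a)} \<le> 6561" for z
  proof -
    have "\<phi> ` {a \<in> R. norm (z - \<phi> a) \<le> norm (\<phi> (nb a) - \<phi> a)} = {x \<in> \<phi> ` R. norm (x - z) \<le> \<rho> x}"
      by (auto simp: \<rho> norm_minus_commute)
    moreover have "card {x \<in> \<phi> ` R. norm (x - z) \<le> \<rho> x} \<le> 6561 * 1"
      using assms one by (intro card_covering_balls) auto
    moreover have "inj_on \<phi> {a \<in> R. norm (z - \<phi> a) \<le> norm (\<phi> (nb a) - \<phi> a)}"
      using inj by (rule inj_on_subset) simp
    ultimately show ?thesis
      using card_image by fastforce
  qed
  then have "(\<Sum>z\<in>Z. card {a \<in> R. norm (z - \<phi> a) \<le> norm (\<phi> (nb a) - \<phi> a)}) \<le> card Z * 6561"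
    using sum_bounded_above[of Z "\<lambda>z. card {a \<in> R. norm (z - \<phi> a) \<le> norm (\<phi> (nb a) - \<phi> a)}" 6561]
    by simp
  then show ?thesis
    using double_count[OF assms(1,2), of "\<lambda>a z. norm (z - \<phi> a) \<le> norm (\<phi> (nb a) - \<phi> a)"] by simp
qed

text \<open>Markov's inequality.\<close>

lemma card_exceeding:
  fixes f :: "'a \<Rightarrow> nat"
  assumes "finite R" "0 < k"
  shows "k * real (card {a \<in> R. \<not> real (f a) \<le> k}) \<le> real (\<Sum>a\<in>R. f a)"
proof -
  have "real (card {a \<in> R. \<not> real (f a) \<le> k}) * k \<le> (\<Sum>a\<in>{a \<in> R. \<not> real (f a) \<le> k}. real (f a))"
    by (rule sum_bounded_below) auto
  also have "\<dots> \<le> (\<Sum>a\<in>R. real (f a))"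
    using assms by (intro sum_mono2) auto
  finally show ?thesis
    by (simp add: mult.commute)
qed

text \<open>Each \<open>i\<close> describes a curve of points
  \<open>(\<phi> i a, \<psi> i a)\<close> in the grid \<open>Z \<times> X\<close>. For most
  \<open>a\<close>, few points of \<open>Z\<close> and of \<open>X\<close> separate the images of
  \<open>a\<close> from those of its nearest neighbour, so this step along the curve is a close pair
  in both coordinates. By \<open>inj\<close> two points determine the curve, hence each combination
  of close pairs is used at most once. The outcome has the Szemeredi-Trotter exponent 2/3.\<close>

theorem similarity_incidence_bound:
  fixes R :: "'i \<Rightarrow> quat set" and \<phi> \<psi> :: "'i \<Rightarrow> quat \<Rightarrow> quat"
  assumes fin: "finite I" "finite Z" "finite X" "\<And>i. i \<in> I \<Longrightarrow> finite (R i)"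
    and Z: "\<And>i a. i \<in> I \<Longrightarrow> a \<in> R i \<Longrightarrow> \<phi> i a \<in> Z" and X: "\<And>i a. i \<in> I \<Longrightarrow> a \<in> R i \<Longrightarrow> \<psi> i a \<in> X"
    and \<phi>: "\<And>i a b. i \<in> I \<Longrightarrow> a \<in> R i \<Longrightarrow> b \<in> R i \<Longrightarrow> norm (\<phi> i a - \<phi> i b) = \<kappa> i * norm (a - b)"
    and \<psi>: "\<And>i a b. i \<in> I \<Longrightarrow> a \<in> R i \<Longrightarrow> b \<in> R i \<Longrightarrow> norm (\<psi> i a - \<psi> i b) = \<kappa>' i * norm (a - b)"
    and pos: "\<And>i. i \<in> I \<Longrightarrow> 0 < \<kappa> i" "\<And>i. i \<in> I \<Longrightarrow> 0 < \<kappa>' i"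
    and inj: "\<And>i j a a' b b'. \<lbrakk>i \<in> I; j \<in> I; a \<in> R i; a' \<in> R i; b \<in> R j; b' \<in> R j; a \<noteq> a'; b \<noteq> b';
        \<phi> i a = \<phi> j b; \<phi> i a' = \<phi> j b'; \<psi> i a = \<psi> j b; \<psi> i a' = \<psi> j b'\<rbrakk> \<Longrightarrow> i = j \<and> a = b"
    and T: "T = (\<Sum>i\<in>I. card (R i))" and big: "4 * card I \<le> T"
  shows "real T ^ 3 \<le> (104976 * card I * card Z * card X)\<^sup>2"
proof (cases "T = 0")
  case False
  then have "I \<noteq> {}"
    using T by auto
  \<comment> \<open>Half the average richness: curves below it carry at most half of
    \<open>T\<close>. The hypothesis \<open>big\<close> gives \<open>r \<ge> 2\<close>, so that the
    remaining curves have nearest neighbours.\<close>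
  define r where "r = real T / (2 * card I)"
  have I: "0 < card I"
    using fin \<open>I \<noteq> {}\<close> by (simp add: card_gt_0_iff)
  have r2: "2 \<le> r"
    using big I by (simp add: r_def field_simps)
  obtain i0 where "i0 \<in> I" "card (R i0) \<noteq> 0"
    using False T by (metis sum.neutral)
  then obtain a0 where "i0 \<in> I" "a0 \<in> R i0"
    by fastforce
  then have card_pos: "0 < card Z" "0 < card X"
    using Z X fin by (auto simp: card_gt_0_iff)
  \<comment> \<open>\<open>26244 = 4 * 6561\<close>: by Markov at most a quarter of a rich
    \<open>R i\<close> fails in \<open>Z\<close> and a quarter in \<open>X\<close>, so half of it
    survives.\<close>
  define kZ where "kZ = 26244 * card Z / r"
  define kX where "kX = 26244 * card X / r"
  have k_pos: "0 < kZ" "0 < kX"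
    using card_pos r2 by (auto simp: kZ_def kX_def)
  define I' where "I' = {i \<in> I. r \<le> card (R i)}"
  have "\<exists>b\<in>R i. b \<noteq> a \<and> (\<forall>c\<in>R i. c \<noteq> a \<longrightarrow> norm (b - a) \<le> norm (c - a))"
    if i: "i \<in> I'" and a: "a \<in> R i" for i a
  proof -
    have "2 \<le> card (R i)"
      using i r2 by (simp add: I'_def)
    then have "R i - {a} \<noteq> {}"
      using a by (metis Diff_eq_empty_iff card_mono card.empty card_insert_disjoint empty_iff finite.emptyI
          finite_insert numeral_2_eq_2 not_less_eq_eq)
    moreover have "finite (R i - {a})"
      using fin i by (simp add: I'_def)
    ultimately obtain b where "b \<in> R i - {a}" "\<And>c. c \<in> R i - {a} \<Longrightarrow> - norm (c - a) \<le> - norm (b - a)"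
      using obtain_max[of "R i - {a}" "\<lambda>c. - norm (c - a)"] by blast
    then show ?thesis
      by (intro bexI[of _ b]) auto
  qed
  then obtain nb where nb: "\<And>i a. i \<in> I' \<Longrightarrow> a \<in> R i \<Longrightarrow>
      nb i a \<in> R i \<and> nb i a \<noteq> a \<and> (\<forall>c\<in>R i. c \<noteq> a \<longrightarrow> norm (nb i a - a) \<le> norm (c - a))"
    by metis
  let ?f = "\<lambda>i a. card {z \<in> Z. norm (z - \<phi> i a) \<le> norm (\<phi> i (nb i a) - \<phi> i a)}"
  let ?g = "\<lambda>i a. card {z \<in> X. norm (z - \<psi> i a) \<le> norm (\<psi> i (nb i a) - \<psi> i a)}"
  define G where "G i = {a \<in> R i. real (?f i a) \<le> kZ \<and> real (?g i a) \<le> kX}" for i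
  have G: "card (R i) \<le> 2 * real (card (G i))" if i: "i \<in> I'" for i
  proof -
    have iI: "i \<in> I" and ri: "r \<le> card (R i)"
      using i by (auto simp: I'_def)
    have "(\<Sum>a\<in>R i. ?f i a) \<le> 6561 * card Z"
      by (rule sum_card_nearest_balls[where \<kappa> = "\<kappa> i"]) (use fin iI Z \<phi> pos nb[OF i] in auto)
    with card_exceeding[of "R i" kZ "?f i"] have "kZ * card {a \<in> R i. \<not> ?f i a \<le> kZ} \<le> 6561 * card Z"
      using fin iI k_pos by (smt (verit) of_nat_le_iff of_nat_mult of_nat_numeral)
    then have 1: "4 * real (card {a \<in> R i. \<not> ?f i a \<le> kZ}) \<le> r"
      using card_pos r2 by (simp add: kZ_def field_simps)
    have "(\<Sum>a\<in>R i. ?g i a) \<le> 6561 * card X"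
      by (rule sum_card_nearest_balls[where \<kappa> = "\<kappa>' i"]) (use fin iI X \<psi> pos nb[OF i] in auto)
    with card_exceeding[of "R i" kX "?g i"] have "kX * card {a \<in> R i. \<not> ?g i a \<le> kX} \<le> 6561 * card X"
      using fin iI k_pos by (smt (verit) of_nat_le_iff of_nat_mult of_nat_numeral)
    then have 2: "4 * real (card {a \<in> R i. \<not> ?g i a \<le> kX}) \<le> r"
      using card_pos r2 by (simp add: kX_def field_simps)
    have "R i = G i \<union> ({a \<in> R i. \<not> ?f i a \<le> kZ} \<union> {a \<in> R i. \<not> ?g i a \<le> kX})"
      by (auto simp: G_def)
    then have "card (R i) \<le> card (G i) + (card {a \<in> R i. \<not> ?f i a \<le> kZ} + card {a \<in> R i. \<not> ?g i a \<le> kX})"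
      by (metis (no_types, lifting) card_Un_le add_left_mono order_trans)
    then show ?thesis
      using 1 2 ri by linarith
  qed
  have I'_I: "I' \<subseteq> I"
    by (auto simp: I'_def)
  have "(\<Sum>i\<in>I - I'. real (card (R i))) \<le> real (card (I - I')) * r"
    by (rule sum_bounded_above) (auto simp: I'_def)
  also have "\<dots> \<le> card I * r"
    using r2 fin by (intro mult_right_mono) (auto intro: card_mono)
  also have "\<dots> = T / 2"
    using I by (simp add: r_def)
  finally have "T / 2 \<le> (\<Sum>i\<in>I'. real (card (R i)))"
    using sum.subset_diff[OF I'_I fin(1), of "\<lambda>i. real (card (R i))"] by (simp add: T)
  also have "\<dots> \<le> (\<Sum>i\<in>I'. 2 * real (card (G i)))"
    by (intro sum_mono G)
  also have "\<dots> = 2 * real (card (SIGMA i:I'. G i))"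
    using fin I'_I finite_subset[OF I'_I] by (subst card_SigmaI) (auto simp: G_def sum_distrib_left)
  finally have T4: "T \<le> 4 * real (card (SIGMA i:I'. G i))"
    by simp
  have "card (SIGMA i:I'. G i) \<le> card (close_pairs kZ Z \<times> close_pairs kX X)"
  proof (rule card_inj_on_le)
    let ?h = "\<lambda>(i, a). ((\<phi> i a, \<phi> i (nb i a)), (\<psi> i a, \<psi> i (nb i a)))"
    show "?h ` (SIGMA i:I'. G i) \<subseteq> close_pairs kZ Z \<times> close_pairs kX X"
      using nb Z X I'_I by (auto simp: close_pairs_def G_def)
    show "inj_on ?h (SIGMA i:I'. G i)"
    proof (rule inj_onI, clarify)
      fix i a j b
      assume "i \<in> I'" "a \<in> G i" "j \<in> I'" "b \<in> G j" and
        "\<phi> i a = \<phi> j b" "\<phi> i (nb i a) = \<phi> j (nb j b)" "\<psi> i a = \<psi> j b" "\<psi> i (nb i a) = \<psi> j (nb j b)"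
      then show "i = j \<and> a = b"
        using subsetD[OF I'_I] nb[of i a] nb[of j b] inj[of i j a "nb i a" b "nb j b"] by (auto simp: G_def)
    qed
  qed (use fin in \<open>auto simp: close_pairs_def\<close>)
  then have "real (card (SIGMA i:I'. G i)) \<le> real (card (close_pairs kZ Z)) * real (card (close_pairs kX X))"
    by (metis card_cartesian_product of_nat_le_iff of_nat_mult)
  also have "\<dots> \<le> (kZ * card Z) * (kX * card X)"
    using k_pos fin by (intro mult_mono card_close_pairs) auto
  finally have "T \<le> 4 * ((kZ * card Z) * (kX * card X))"
    using T4 by linarith
  then have "T * r\<^sup>2 \<le> 4 * (26244 * card Z * card X)\<^sup>2"
    using r2 by (simp add: kZ_def kX_def field_simps power2_eq_square)
  then show ?thesis
    using I by (simp add: r_def field_simps power2_eq_square power3_eq_cube)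
qed simp

section \<open>The Balog--Szemeredi--Gowers argument\<close>

lemma card_Collect_pairs:
  assumes "finite A" "\<And>a. a \<in> A \<Longrightarrow> finite (B a)"
  shows "card {(a, b). a \<in> A \<and> b \<in> B a} = (\<Sum>a\<in>A. card (B a))"
proof -
  have "{(a, b). a \<in> A \<and> b \<in> B a} = Sigma A B"
    by auto
  then show ?thesis
    using assms by simp
qed

text \<open>Dependent random choice: a pair with few common neighbours lies in few neighbourhoods
  \<open>N y\<close>, so some large \<open>M = N y0\<close> has few such pairs. Then
  \<open>X'\<close> consists of the vertices with good partners almost everywhere in
  \<open>M\<close>, and a \<open>y\<close> with enough neighbours in \<open>M\<close> is reached
  from any of them by many paths of length three.\<close>

theorem balog_szemeredi_gowers_paths:
  fixes E :: "('a \<times> 'b) set" and L :: real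
  assumes fin: "finite X" "finite Y" and E: "E \<subseteq> X \<times> Y" and ne: "X \<noteq> {}" "Y \<noteq> {}"
    and "0 < L" and dense: "real (card X) * real (card Y) \<le> L * real (card E)"
  shows "\<exists>X' Y'. X' \<subseteq> X \<and> Y' \<subseteq> Y \<and> card X \<le> 6 * L * card X' \<and> card Y \<le> 4 * L * card Y' \<and>
    (\<forall>x\<in>X'. \<forall>y\<in>Y'. real (card X) * real (card Y) \<le>
       3072 * L ^ 5 * card {(x1, y1). x1 \<in> X \<and> y1 \<in> Y \<and> (x, y1) \<in> E \<and> (x1, y1) \<in> E \<and> (x1, y) \<in> E})"
proof -
  define a b where "a = real (card X)" and "b = real (card Y)"
  have ab: "0 < a" "0 < b"
    using fin ne by (auto simp: a_def b_def card_gt_0_iff)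
  define deg where "deg x = card {y \<in> Y. (x, y) \<in> E}" for x
  define X0 where "X0 = {x \<in> X. b \<le> 2 * L * deg x}"
  define N where "N y = {x \<in> X0. (x, y) \<in> E}" for y
  define codeg where "codeg = (\<lambda>(x, x'). card {y \<in> Y. (x, y) \<in> E \<and> (x', y) \<in> E})"
  \<comment> \<open>The threshold makes \<open>16 * L\<close> times the number of bad pairs, summed
    over all \<open>N y\<close>, at most half of the lower bound \<open>sN2\<close> for the second
    moment.\<close>
  define bad where "bad = {(x, x'). x \<in> X0 \<and> x' \<in> X0 \<and> 128 * L ^ 3 * codeg (x, x') < b}"
  have X0: "X0 \<subseteq> X" "finite X0"
    using fin by (auto simp: X0_def)
  have finN [simp]: "finite (N y)" for y
    using X0 by (simp add: N_def)
  have bad_sub: "bad \<subseteq> X \<times> X"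
    using X0 by (auto simp: bad_def)
  then have fin_bad: "finite bad" "real (card bad) \<le> a\<^sup>2"
    using fin finite_subset[of bad "X \<times> X"] card_mono[of "X \<times> X" bad]
    by (auto simp: a_def power2_eq_square simp flip: of_nat_mult)
  have "card E = (\<Sum>x\<in>X. deg x)"
  proof -
    have "E = {(x, y). x \<in> X \<and> y \<in> {y \<in> Y. (x, y) \<in> E}}"
      using E by auto
    then show ?thesis
      using card_Collect_pairs[of X "\<lambda>x. {y \<in> Y. (x, y) \<in> E}"] fin by (simp add: deg_def)
  qed
  then have "real (card E) = (\<Sum>x\<in>X0. real (deg x)) + (\<Sum>x\<in>X - X0. real (deg x))"
    using sum.subset_diff[OF X0(1) fin(1), of "\<lambda>x. real (deg x)"] by simp
  moreover have "(\<Sum>x\<in>X - X0. real (deg x)) \<le> real (card (X - X0)) * (b / (2 * L))"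
    using \<open>0 < L\<close> by (intro sum_bounded_above) (auto simp: X0_def field_simps)
  moreover have "\<dots> \<le> a * (b / (2 * L))"
    using \<open>0 < L\<close> ab fin by (intro mult_right_mono) (auto simp: a_def intro: card_mono)
  moreover have "a * b / L \<le> card E"
    using dense \<open>0 < L\<close> by (simp add: a_def b_def field_simps)
  ultimately have "a * b / (2 * L) \<le> (\<Sum>x\<in>X0. real (deg x))"
    using \<open>0 < L\<close> by (simp add: field_simps)
  also have "\<dots> = (\<Sum>y\<in>Y. real (card (N y)))"
    using double_count[OF X0(2) fin(2), of "\<lambda>x y. (x, y) \<in> E"]
    by (simp add: deg_def N_def flip: of_nat_sum)
  finally have sN: "a * b / (2 * L) \<le> (\<Sum>y\<in>Y. real (card (N y)))" .
  have "(a * b / (2 * L))\<^sup>2 \<le> (\<Sum>y\<in>Y. real (card (N y)))\<^sup>2"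
    using sN ab \<open>0 < L\<close> by (intro power_mono) auto
  also have "\<dots> \<le> (\<Sum>y\<in>Y. (real (card (N y)))\<^sup>2) * b"
    unfolding b_def by (rule sum_squared_le_sum_of_squares)
  finally have sN2: "a\<^sup>2 * b / (4 * L\<^sup>2) \<le> (\<Sum>y\<in>Y. (real (card (N y)))\<^sup>2)"
    using ab \<open>0 < L\<close> by (simp add: field_simps power2_eq_square)
  define badN where "badN y = card {p \<in> bad. fst p \<in> N y \<and> snd p \<in> N y}" for y
  have "(\<Sum>y\<in>Y. real (badN y)) = (\<Sum>p\<in>bad. real (card {y \<in> Y. fst p \<in> N y \<and> snd p \<in> N y}))"
    using double_count[OF fin(2) fin_bad(1), of "\<lambda>y p. fst p \<in> N y \<and> snd p \<in> N y"]
    by (simp add: badN_def flip: of_nat_sum)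
  also have "\<dots> \<le> (\<Sum>p\<in>bad. real (codeg p))"
    using fin by (intro sum_mono) (auto simp: codeg_def N_def split: prod.split intro!: card_mono)
  also have "\<dots> \<le> real (card bad) * (b / (128 * L ^ 3))"
    using \<open>0 < L\<close> by (intro sum_bounded_above) (auto simp: bad_def field_simps)
  also have "\<dots> \<le> a\<^sup>2 * (b / (128 * L ^ 3))"
    using \<open>0 < L\<close> ab fin_bad by (intro mult_right_mono) auto
  finally have sbad: "16 * L * (\<Sum>y\<in>Y. real (badN y)) \<le> a\<^sup>2 * b / (8 * L\<^sup>2)"
    using \<open>0 < L\<close> by (simp add: field_simps power2_eq_square power3_eq_cube)
  \<comment> \<open>One \<open>y\<close> must have both a large neighbourhood and few bad pairs, so
    a weighted difference of the two is averaged.\<close>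
  have "\<exists>y\<in>Y. a\<^sup>2 / (8 * L\<^sup>2) \<le> (real (card (N y)))\<^sup>2 - 16 * L * badN y"
  proof (rule ccontr)
    assume "\<not> ?thesis"
    then have "(\<Sum>y\<in>Y. (real (card (N y)))\<^sup>2 - 16 * L * badN y) < (\<Sum>y\<in>Y. a\<^sup>2 / (8 * L\<^sup>2))"
      using fin ne by (intro sum_strict_mono) auto
    moreover have "(\<Sum>y\<in>Y. (real (card (N y)))\<^sup>2 - 16 * L * badN y)
        = (\<Sum>y\<in>Y. (real (card (N y)))\<^sup>2) - 16 * L * (\<Sum>y\<in>Y. real (badN y))"
      by (simp add: sum_subtractf sum_distrib_left)
    moreover have "a\<^sup>2 * b / (4 * L\<^sup>2) = a\<^sup>2 * b / (8 * L\<^sup>2) + a\<^sup>2 * b / (8 * L\<^sup>2)"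
      by (simp add: field_simps)
    ultimately show False
      using sN2 sbad by (simp add: b_def mult.commute)
  qed
  then obtain y0 where y0: "a\<^sup>2 / (8 * L\<^sup>2) \<le> (real (card (N y0)))\<^sup>2 - 16 * L * badN y0"
    by blast
  define M where "M = N y0"
  define m where "m = real (card M)"
  have M: "finite M" "M \<subseteq> X0"
    by (auto simp: M_def) (simp add: N_def)
  have "0 < a\<^sup>2 / (8 * L\<^sup>2)" "0 \<le> 16 * L * badN y0"
    using ab \<open>0 < L\<close> by auto
  then have bad_m: "16 * L * badN y0 \<le> m\<^sup>2" and "a\<^sup>2 / (8 * L\<^sup>2) \<le> m\<^sup>2"
    using y0 by (auto simp: m_def M_def)
  then have "a\<^sup>2 \<le> (3 * L * m)\<^sup>2"
    using \<open>0 < L\<close> by (simp add: field_simps power_mult_distrib) (smt (verit) zero_le_power2 mult_nonneg_nonneg)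
  then have a_m: "a \<le> 3 * L * m"
    by (rule power2_le_imp_le) (use \<open>0 < L\<close> in \<open>simp add: m_def\<close>)
  then have m_pos: "0 < m"
    using ab \<open>0 < L\<close> by (smt (verit) mult_nonneg_nonpos m_def of_nat_0_le_iff mult_eq_0_iff)
  define badp where "badp x = card {x' \<in> M. (x, x') \<in> bad}" for x
  \<comment> \<open>Since bad pairs in \<open>M\<close> number at most
    \<open>m ^ 2 / (16 * L)\<close>, Markov leaves at least half of \<open>M\<close>.\<close>
  define X' where "X' = {x \<in> M. 8 * L * badp x \<le> m}"
  have "badN y0 = (\<Sum>x\<in>M. badp x)"
  proof -
    have "{p \<in> bad. fst p \<in> M \<and> snd p \<in> M} = {(x, x'). x \<in> M \<and> x' \<in> {x' \<in> M. (x, x') \<in> bad}}"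
      by auto
    then show ?thesis
      using card_Collect_pairs[of M "\<lambda>x. {x' \<in> M. (x, x') \<in> bad}"] M
      by (simp add: badN_def badp_def flip: M_def)
  qed
  moreover have "m / (8 * L) * real (card {x \<in> M. \<not> real (badp x) \<le> m / (8 * L)}) \<le> real (\<Sum>x\<in>M. badp x)"
    using M m_pos \<open>0 < L\<close> by (intro card_exceeding) auto
  moreover have "{x \<in> M. \<not> real (badp x) \<le> m / (8 * L)} = M - X'"
    using \<open>0 < L\<close> by (auto simp: X'_def field_simps)
  ultimately have "m / (8 * L) * real (card (M - X')) \<le> m\<^sup>2 / (16 * L)"
    using bad_m \<open>0 < L\<close> by (simp add: field_simps)
  then have "2 * real (card (M - X')) \<le> m"
    using m_pos \<open>0 < L\<close> by (simp add: field_simps power2_eq_square)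
  moreover have X'M: "X' \<subseteq> M"
    by (auto simp: X'_def)
  then have "card M = card X' + card (M - X')"
    using M by (metis card_Diff_subset card_mono finite_subset le_add_diff_inverse)
  ultimately have mX': "m \<le> 2 * real (card X')"
    by (simp add: m_def)
  have X'_card: "card X \<le> 6 * L * card X'"
    using order_trans[OF a_m mult_left_mono[OF mX', of "3 * L"]] \<open>0 < L\<close> by (simp add: a_def mult.assoc)
  define dM where "dM y = card {x \<in> M. (x, y) \<in> E}" for y
  \<comment> \<open>The required degree \<open>m / (4 * L)\<close> is twice what the bad partners of
    an \<open>x\<close> in \<open>X'\<close> can remove.\<close>
  define Y' where "Y' = {y \<in> Y. m \<le> 4 * L * dM y}"
  have Y'Y: "Y' \<subseteq> Y"
    by (auto simp: Y'_def)
  have "m * (b / (2 * L)) \<le> (\<Sum>x\<in>M. real (deg x))"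
    unfolding m_def using M(2) \<open>0 < L\<close>
    by (intro sum_bounded_below) (auto simp: X0_def field_simps subset_iff)
  also have "\<dots> = (\<Sum>y\<in>Y. real (dM y))"
    using double_count[OF M(1) fin(2), of "\<lambda>x y. (x, y) \<in> E"]
    by (simp add: deg_def dM_def flip: of_nat_sum)
  also have "\<dots> = (\<Sum>y\<in>Y'. real (dM y)) + (\<Sum>y\<in>Y - Y'. real (dM y))"
    using sum.subset_diff[OF Y'Y fin(2), of "\<lambda>x. real (dM x)"] by simp
  also have "(\<Sum>y\<in>Y'. real (dM y)) \<le> real (card Y') * m"
    by (rule sum_bounded_above) (auto simp: dM_def m_def M intro!: card_mono)
  also have "(\<Sum>y\<in>Y - Y'. real (dM y)) \<le> real (card (Y - Y')) * (m / (4 * L))"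
    using \<open>0 < L\<close> by (intro sum_bounded_above) (auto simp: Y'_def field_simps)
  also have "real (card (Y - Y')) * (m / (4 * L)) \<le> b * (m / (4 * L))"
    using \<open>0 < L\<close> m_pos fin by (intro mult_right_mono) (auto simp: b_def intro: card_mono)
  finally have "b * m \<le> 4 * L * card Y' * m"
    using \<open>0 < L\<close> by (simp add: field_simps)
  then have Y'_card: "card Y \<le> 4 * L * card Y'"
    using m_pos by (simp add: b_def)
  have "a * b \<le> 3072 * L ^ 5 * card {(x1, y1). x1 \<in> X \<and> y1 \<in> Y \<and> (x, y1) \<in> E \<and> (x1, y1) \<in> E \<and> (x1, y) \<in> E}"
    (is "_ \<le> _ * real (card ?P)") if x: "x \<in> X'" and y: "y \<in> Y'" for x y
  proof -
    define W where "W = {x1 \<in> M. (x1, y) \<in> E \<and> (x, x1) \<notin> bad}"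
    have "{x1 \<in> M. (x1, y) \<in> E} \<subseteq> W \<union> {x' \<in> M. (x, x') \<in> bad}"
      by (auto simp: W_def)
    then have "dM y \<le> card (W \<union> {x' \<in> M. (x, x') \<in> bad})"
      unfolding dM_def using M by (intro card_mono) (auto simp: W_def)
    also have "\<dots> \<le> card W + badp x"
      unfolding badp_def by (rule card_Un_le)
    finally have "real (dM y) \<le> real (card W) + real (badp x)"
      by linarith
    moreover have "m / (4 * L) \<le> dM y" "badp x \<le> m / (8 * L)"
      using x y \<open>0 < L\<close> by (auto simp: X'_def Y'_def field_simps)
    moreover have "m / (4 * L) = m / (8 * L) + m / (8 * L)"
      by simp
    ultimately have "m / (8 * L) \<le> card W"
      by linarith
    then have m_W: "m \<le> 8 * L * card W"
      using \<open>0 < L\<close> by (simp add: field_simps)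
    have "?P \<supseteq> (SIGMA x1:W. {y1 \<in> Y. (x, y1) \<in> E \<and> (x1, y1) \<in> E})"
      using M X0 by (auto simp: W_def)
    moreover have "finite ?P"
      by (rule finite_subset[of _ "X \<times> Y"]) (use fin in auto)
    ultimately have "card (SIGMA x1:W. {y1 \<in> Y. (x, y1) \<in> E \<and> (x1, y1) \<in> E}) \<le> card ?P"
      by (intro card_mono)
    moreover have "finite W"
      using M by (simp add: W_def)
    ultimately have "(\<Sum>x1\<in>W. codeg (x, x1)) \<le> card ?P"
      using fin by (simp add: codeg_def)
    then have "(\<Sum>x1\<in>W. real (codeg (x, x1))) \<le> real (card ?P)"
      by (simp flip: of_nat_sum)
    moreover have "real (card W) * (b / (128 * L ^ 3)) \<le> (\<Sum>x1\<in>W. real (codeg (x, x1)))"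
    proof (rule sum_bounded_below)
      fix x1 assume "x1 \<in> W"
      then have "b \<le> 128 * L ^ 3 * codeg (x, x1)"
        using x X'M M by (auto simp: W_def bad_def)
      then show "b / (128 * L ^ 3) \<le> codeg (x, x1)"
        using \<open>0 < L\<close> by (simp add: field_simps)
    qed
    ultimately have "real (card W) * (b / (128 * L ^ 3)) \<le> real (card ?P)"
      by linarith
    then have "card W * b \<le> 128 * L ^ 3 * card ?P"
      using \<open>0 < L\<close> by (simp add: field_simps)
    have "a * b \<le> (3 * L * (8 * L * card W)) * b"
      using ab \<open>0 < L\<close> a_m m_W by (intro mult_right_mono order_trans[OF a_m] mult_left_mono) auto
    also have "\<dots> = 24 * L\<^sup>2 * (card W * b)"
      by (simp add: power2_eq_square)
    also have "\<dots> \<le> 24 * L\<^sup>2 * (128 * L ^ 3 * card ?P)"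
      by (rule mult_left_mono) (use \<open>card W * b \<le> _\<close> in auto)
    also have "\<dots> = 3072 * L ^ 5 * card ?P"
      by (simp add: power2_eq_square power3_eq_cube power_numeral_reduce)
    finally show ?thesis .
  qed
  moreover have "X' \<subseteq> X"
    using X'M M X0 by blast
  ultimately show ?thesis
    using Y'Y X'_card Y'_card unfolding a_def b_def by blast
qed

text \<open>The function \<open>g\<close> recovers \<open>f x y\<close> from the values on a path of length three. This covers
  the additive group, where \<open>g p q s = p - q + s\<close>, as well as the non-commutative
  multiplicative group, where \<open>g p q s = p * inverse q * s\<close>.\<close>

theorem balog_szemeredi_gowers:
  fixes f :: "'a \<Rightarrow> 'b \<Rightarrow> 'c" and L :: real
  assumes fin: "finite X" "finite Y" "finite Z" and ne: "X \<noteq> {}" "Y \<noteq> {}" and "0 < L"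
    and dense: "real (card X) * real (card Y) \<le> L * real (card {(x, y). x \<in> X \<and> y \<in> Y \<and> f x y \<in> Z})"
    and inj: "\<And>x. x \<in> X \<Longrightarrow> inj_on (f x) Y" "\<And>y. y \<in> Y \<Longrightarrow> inj_on (\<lambda>x. f x y) X"
    and g: "\<And>x x1 y y1. \<lbrakk>x \<in> X; x1 \<in> X; y \<in> Y; y1 \<in> Y\<rbrakk> \<Longrightarrow> f x y = g (f x y1) (f x1 y1) (f x1 y)"
  shows "\<exists>X' Y'. X' \<subseteq> X \<and> Y' \<subseteq> Y \<and> card X \<le> 6 * L * card X' \<and> card Y \<le> 4 * L * card Y' \<and>
    real (card ((\<lambda>(x, y). f x y) ` (X' \<times> Y'))) * (card X * card Y) \<le> 3072 * L ^ 5 * card Z ^ 3"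
proof -
  define E where "E = {(x, y). x \<in> X \<and> y \<in> Y \<and> f x y \<in> Z}"
  have E_sub: "E \<subseteq> X \<times> Y"
    by (auto simp: E_def)
  obtain X' Y' where *: "X' \<subseteq> X" "Y' \<subseteq> Y" "card X \<le> 6 * L * card X'" "card Y \<le> 4 * L * card Y'"
    and paths: "\<And>x y. x \<in> X' \<Longrightarrow> y \<in> Y' \<Longrightarrow> real (card X) * real (card Y) \<le>
       3072 * L ^ 5 * card {(x1, y1). x1 \<in> X \<and> y1 \<in> Y \<and> (x, y1) \<in> E \<and> (x1, y1) \<in> E \<and> (x1, y) \<in> E}"
    using balog_szemeredi_gowers_paths[OF fin(1,2) E_sub ne \<open>0 < L\<close> dense[folded E_def]] by blast
  define V where "V = (\<lambda>(x, y). f x y) ` (X' \<times> Y')"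
  have "finite V"
    using * fin finite_subset[of X' X] finite_subset[of Y' Y] by (simp add: V_def)
  \<comment> \<open>The edge values along a path form a triple from which \<open>g\<close> recovers
    \<open>v\<close>. Different \<open>v\<close> thus have disjoint sets of triples, all inside
    \<open>Z \<times> Z \<times> Z\<close>.\<close>
  have "real (card X) * real (card Y) \<le> 3072 * L ^ 5 * card {t \<in> Z \<times> Z \<times> Z. (\<lambda>(p, q, r). g p q r) t = v}"
    (is "_ \<le> _ * real (card ?T)") if v: "v \<in> V" for v
  proof -
    obtain x y where xy: "x \<in> X'" "y \<in> Y'" "v = f x y"
      using v by (auto simp: V_def)
    let ?P = "{(x1, y1). x1 \<in> X \<and> y1 \<in> Y \<and> (x, y1) \<in> E \<and> (x1, y1) \<in> E \<and> (x1, y) \<in> E}"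
    have "card ?P \<le> card ?T"
    proof (rule card_inj_on_le)
      let ?h = "\<lambda>(x1, y1). (f x y1, f x1 y1, f x1 y)"
      have "x \<in> X" "y \<in> Y"
        using xy * by auto
      then show "inj_on ?h ?P"
        using inj_onD[OF inj(1)[OF \<open>x \<in> X\<close>]] inj_onD[OF inj(2)[OF \<open>y \<in> Y\<close>]]
        by (intro inj_onI) (simp split: prod.splits)
      show "?h ` ?P \<subseteq> ?T"
        using xy * g[OF \<open>x \<in> X\<close> _ \<open>y \<in> Y\<close>, symmetric] by (auto simp: E_def)
    qed (use fin in simp)
    then have "3072 * L ^ 5 * real (card ?P) \<le> 3072 * L ^ 5 * real (card ?T)"
      using \<open>0 < L\<close> by (intro mult_left_mono) auto
    then show ?thesis
      using paths[OF xy(1,2)] by linarith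
  qed
  then have "real (card V) * (real (card X) * real (card Y)) \<le>
      (\<Sum>v\<in>V. 3072 * L ^ 5 * real (card {t \<in> Z \<times> Z \<times> Z. (\<lambda>(p, q, r). g p q r) t = v}))"
    by (intro sum_bounded_below)
  also have "\<dots> = 3072 * L ^ 5 * real (\<Sum>v\<in>V. card {t \<in> Z \<times> Z \<times> Z. (\<lambda>(p, q, r). g p q r) t = v})"
    by (simp add: sum_distrib_left)
  also have "(\<Sum>v\<in>V. card {t \<in> Z \<times> Z \<times> Z. (\<lambda>(p, q, r). g p q r) t = v})
      = card (\<Union>v\<in>V. {t \<in> Z \<times> Z \<times> Z. (\<lambda>(p, q, r). g p q r) t = v})"
    using fin \<open>finite V\<close> by (intro card_UN_disjoint[symmetric]) auto
  also have "3072 * L ^ 5 * real \<dots> \<le> 3072 * L ^ 5 * real (card (Z \<times> Z \<times> Z))"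
    using fin \<open>0 < L\<close> by (intro mult_left_mono of_nat_mono card_mono) auto
  also have "card (Z \<times> Z \<times> Z) = card Z ^ 3"
    by (simp add: power3_eq_cube card_cartesian_product)
  finally show ?thesis
    using * unfolding V_def by (intro exI[of _ X'] exI[of _ Y']) simp
qed

section \<open>Multiplicative energy and sumsets\<close>

text \<open>What a narrow cone of directions provides: no summand is longer than the sum.\<close>

definition acute :: "quat set \<Rightarrow> bool" where
  "acute A \<longleftrightarrow> 0 \<notin> A \<and> (\<forall>a\<in>A. \<forall>b\<in>A. norm a \<le> norm (a + b))"

definition fib :: "quat set \<Rightarrow> quat \<Rightarrow> quat set" where
  "fib A x = {a \<in> A. a * x \<in> A}"

lemma fib_subset: "fib A x \<subseteq> A"
  by (auto simp: fib_def)

lemma finite_fib [simp]: "finite A \<Longrightarrow> finite (fib A x)"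
  by (simp add: fib_def)

lemma card_fib_le: "finite A \<Longrightarrow> card (fib A x) \<le> card A"
  by (intro card_mono fib_subset)

lemma acute_subset: "acute A \<Longrightarrow> B \<subseteq> A \<Longrightarrow> acute B"
  by (auto simp: acute_def subset_iff)

lemma acute_qcnj: "acute A \<Longrightarrow> acute (qcnj ` A)"
  by (auto simp: acute_def simp flip: qcnj_add)

text \<open>Pigeonhole over the cells of directions, with \<open>+ 1\<close> for the element 0.
  Directions in one cell differ by less than 1/2, so \<open>norm (a + b)\<close> is at least
  \<open>norm a + norm b / 2\<close>.\<close>

lemma exists_acute_subset:
  assumes "finite A"
  shows "\<exists>B\<subseteq>A. acute B \<and> card A \<le> 6561 * card B + 1"
proof -
  define B where "B c = {a \<in> A - {0}. cell (sgn a) = c}" for c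
  have ac: "acute (B c)" for c
    unfolding acute_def
  proof safe
    fix a b assume ab: "a \<in> B c" "b \<in> B c"
    have s: "norm x *\<^sub>R sgn x = x" for x :: quat
      by (cases "x = 0") (simp_all add: sgn_div_norm)
    have *: "cell (sgn a) = cell (sgn b)"
      using ab by (simp add: B_def)
    have "norm (norm b *\<^sub>R (sgn a - sgn b)) \<le> norm b * (1 / 2)"
      using norm_diff_less_of_cell_eq[OF *] by (simp add: mult_left_mono del: times_divide_eq_right)
    moreover have e: "a + b = (norm a + norm b) *\<^sub>R sgn a - norm b *\<^sub>R (sgn a - sgn b)"
      by (simp add: s algebra_simps)
    moreover have "norm ((norm a + norm b) *\<^sub>R sgn a) = norm a + norm b"
      using ab by (simp add: B_def norm_sgn)
    moreover have "norm ((norm a + norm b) *\<^sub>R sgn a) - norm (norm b *\<^sub>R (sgn a - sgn b)) \<le> norm (a + b)"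
      unfolding e by (rule norm_triangle_ineq2)
    ultimately show "norm a \<le> norm (a + b)"
      using norm_ge_zero[of b] by linarith
  qed (auto simp: B_def)
  have "cells \<noteq> {}"
    using card_cells by force
  then obtain c where c: "c \<in> cells" "\<And>c'. c' \<in> cells \<Longrightarrow> real (card (B c')) \<le> real (card (B c))"
    using obtain_max[OF finite_cells, of "\<lambda>c. real (card (B c))"] by blast
  have "card (A - {0}) \<le> card cells * card (B c)"
  proof (rule card_le_fibres[where k = "\<lambda>a. cell (sgn a)"])
    show "card {a \<in> A - {0}. cell (sgn a) = c'} \<le> card (B c)" if "c' \<in> cells" for c'
      using c(2)[OF that] by (simp only: B_def of_nat_le_iff)
  qed (use assms in \<open>auto simp: finite_cells cell_sgn_in_cells\<close>)
  moreover have "card A \<le> card (A - {0}) + 1"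
    using assms diff_card_le_card_Diff[of "{0}" A] by simp
  ultimately have "card A \<le> 6561 * card (B c) + 1"
    by (simp add: card_cells)
  then show ?thesis
    using ac by (intro exI[of _ "B c"]) (auto simp: B_def)
qed

lemma exists_smallest:
  fixes f :: "'a \<Rightarrow> real"
  assumes "finite T" "m \<le> card T"
  shows "\<exists>U\<subseteq>T. card U = m \<and> (\<forall>u\<in>U. \<forall>v\<in>T - U. f u \<le> f v)"
  using assms(2)
proof (induction m)
  case 0
  then show ?case
    by (intro exI[of _ "{}"]) auto
next
  case (Suc m)
  then obtain U where U: "U \<subseteq> T" "card U = m" "\<forall>u\<in>U. \<forall>v\<in>T - U. f u \<le> f v"
    by auto
  then have "T - U \<noteq> {}"
    using Suc.prems assms(1) by (metis Diff_eq_empty_iff Suc_n_not_le_n subset_antisym)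
  then obtain x where x: "x \<in> T - U" "\<And>z. z \<in> T - U \<Longrightarrow> - f z \<le> - f x"
    using obtain_max[of "T - U" "\<lambda>z. - f z"] assms(1) by blast
  moreover have "finite U"
    using U assms finite_subset by blast
  ultimately show ?case
    using U by (intro exI[of _ "insert x U"]) (auto simp: card_insert_if)
qed

text \<open>\<open>\<rho> x\<close> is the distance to the farthest of \<open>m\<close> nearest
  neighbours. The open ball leaves out ties, so it contains at most \<open>x\<close> and its
  neighbours, \<open>m + 1 \<le> 2 * m\<close> points.\<close>

lemma exists_neighbours:
  fixes S :: "quat set"
  assumes "finite S" "1 \<le> m" "m < card S"
  shows "\<exists>U \<rho>. \<forall>x\<in>S. U x \<subseteq> S - {x} \<and> card (U x) = m \<and> 0 < \<rho> x \<and>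
    (\<forall>y\<in>U x. norm (y - x) \<le> \<rho> x) \<and> card {z \<in> S. norm (z - x) < \<rho> x} \<le> 2 * m"
proof -
  have "\<exists>U \<rho>. U \<subseteq> S - {x} \<and> card U = m \<and> 0 < \<rho> \<and>
    (\<forall>y\<in>U. norm (y - x) \<le> \<rho>) \<and> card {z \<in> S. norm (z - x) < \<rho>} \<le> 2 * m" if x: "x \<in> S" for x
  proof -
    have "m \<le> card (S - {x})"
      using assms x by simp
    then obtain U where U: "U \<subseteq> S - {x}" "card U = m"
      and le: "\<forall>u\<in>U. \<forall>v\<in>S - {x} - U. norm (u - x) \<le> norm (v - x)"
      using exists_smallest[of "S - {x}" m "\<lambda>y. norm (y - x)"] assms by auto
    have "finite U" "U \<noteq> {}"
      using U assms by (auto intro: finite_subset)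
    then obtain y where y: "y \<in> U" "\<And>z. z \<in> U \<Longrightarrow> norm (z - x) \<le> norm (y - x)"
      using obtain_max[of U "\<lambda>y. norm (y - x)"] by blast
    have "{z \<in> S. norm (z - x) < norm (y - x)} \<subseteq> insert x U"
      using le y by force
    then have "card {z \<in> S. norm (z - x) < norm (y - x)} \<le> card (insert x U)"
      using \<open>finite U\<close> by (intro card_mono) auto
    then have "card {z \<in> S. norm (z - x) < norm (y - x)} \<le> 2 * m"
      using U assms \<open>finite U\<close> by (auto simp: card_insert_if split: if_splits)
    then show ?thesis
      using U y by (intro exI[of _ U] exI[of _ "norm (y - x)"]) auto
  qed
  then have "\<forall>x\<in>S. \<exists>p. fst p \<subseteq> S - {x} \<and> card (fst p) = m \<and> 0 < snd p \<and>
    (\<forall>y\<in>fst p. norm (y - x) \<le> snd p) \<and> card {z \<in> S. norm (z - x) < snd p} \<le> 2 * m"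
    by fastforce
  then obtain p where "\<forall>x\<in>S. fst (p x) \<subseteq> S - {x} \<and> card (fst (p x)) = m \<and> 0 < snd (p x) \<and>
    (\<forall>y\<in>fst (p x). norm (y - x) \<le> snd (p x)) \<and> card {z \<in> S. norm (z - x) < snd (p x)} \<le> 2 * m"
    by (rule bchoice[THEN exE])
  then show ?thesis
    by (intro exI[of _ "\<lambda>x. fst (p x)"] exI[of _ "\<lambda>x. snd (p x)"])
qed

text \<open>Eliminating \<open>d\<close> leaves \<open>(c - c') * (x - y) = 0\<close>. Thus addition
  is injective on pairs of points from two different lines.\<close>

lemma pair_determined:
  fixes x y :: quat
  assumes "x \<noteq> y" "c + d = c' + d'" "c * x + d * y = c' * x + d' * y"
  shows "c = c' \<and> d = d'"
proof -
  have d: "d = c' + d' - c"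
    using assms(2) by (simp add: algebra_simps)
  have "(c - c') * (x - y) = 0"
    using assms(3) by (simp add: d algebra_simps)
  then show ?thesis
    using assms(1) d by simp
qed

text \<open>The sum of \<open>(c, c * x)\<close> and \<open>(d, d * y)\<close> has slope
  \<open>inverse (c + d) * (c * x + d * y)\<close>, which differs from \<open>x\<close> by
  \<open>inverse (c + d) * d * (y - x)\<close>; acuteness bounds the factor in front.\<close>

lemma dist_slope_of_sum:
  assumes "acute A" "c \<in> A" "d \<in> A"
  shows "norm (x - inverse (c + d) * (c * x + d * y)) \<le> norm (y - x)"
proof -
  have le: "norm c \<le> norm (c + d)" "norm d \<le> norm (c + d)" and "c \<noteq> 0"
    using assms by (auto simp: acute_def) (metis add.commute)
  then have "c + d \<noteq> 0"
    by auto
  then have "(c + d) * (inverse (c + d) * (c * x + d * y) - x) = d * (y - x)"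
    by (simp add: right_diff_distrib mult.assoc[symmetric]) (simp add: algebra_simps)
  then have "norm (c + d) * norm (x - inverse (c + d) * (c * x + d * y)) = norm d * norm (y - x)"
    by (metis norm_minus_commute norm_mult)
  also have "\<dots> \<le> norm (c + d) * norm (y - x)"
    using le by (intro mult_right_mono) auto
  finally show ?thesis
    using \<open>c + d \<noteq> 0\<close> by simp
qed

section \<open>Solymosi's bound for rich slopes\<close>

lemma finite_sumset [simp]: "finite A \<Longrightarrow> finite B \<Longrightarrow> finite (sumset A B)"
  by (simp add: sumset_conv)

lemma finite_prodset [simp]: "finite A \<Longrightarrow> finite B \<Longrightarrow> finite (prodset A B)"
  by (simp add: prodset_conv)

lemma sumsetI: "a \<in> A \<Longrightarrow> b \<in> B \<Longrightarrow> a + b \<in> sumset A B"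
  by (auto simp: sumset_conv)

lemma prodsetI: "a \<in> A \<Longrightarrow> b \<in> B \<Longrightarrow> a * b \<in> prodset A B"
  by (auto simp: prodset_conv)

lemma card_le_card_sumset:
  assumes "finite A"
  shows "card A \<le> card (sumset A A)"
proof (cases "A = {}")
  case False
  then obtain a where "a \<in> A"
    by blast
  then have "card A = card ((\<lambda>b. b + a) ` A)"
    by (simp add: card_image)
  also have "\<dots> \<le> card (sumset A A)"
    using assms \<open>a \<in> A\<close> by (intro card_mono) (auto intro: sumsetI)
  finally show ?thesis .
qed simp

text \<open>One nearest neighbour per slope suffices here. The slope of a sum lies in the ball of
  radius \<open>\<rho> x\<close> about \<open>x\<close>, so by packing at most
  \<open>6561 * 2\<close> slopes \<open>x\<close> produce a given pair from \<open>A + A\<close>,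
  each of them only once.\<close>

lemma card_rich_slopes:
  assumes "finite A" "acute A" "finite S" and rich: "\<And>x. x \<in> S \<Longrightarrow> r \<le> card (fib A x)"
  shows "card S * r\<^sup>2 \<le> 13122 * (card (sumset A A))\<^sup>2"
proof (cases "card S \<le> 1")
  \<comment> \<open>A single slope has no neighbour, but then
    \<open>r \<le> card A \<le> card (sumset A A)\<close> is enough.\<close>
  case True
  show ?thesis
  proof (cases "S = {}")
    case False
    then obtain x where "x \<in> S"
      by blast
    then have "r \<le> card A"
      using rich[of x] card_mono[OF assms(1) fib_subset[of A x]] by simp
    then have "r\<^sup>2 \<le> (card (sumset A A))\<^sup>2"
      using card_le_card_sumset[OF assms(1)] by (intro power_mono) auto
    moreover have "card S * r\<^sup>2 \<le> 1 * r\<^sup>2"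
      using True by (intro mult_right_mono) auto
    ultimately show ?thesis
      by linarith
  qed simp
next
  case False
  then have "1 < card S"
    by simp
  from exists_neighbours[OF assms(3) order_refl this] obtain U \<rho>
    where "\<forall>x\<in>S. U x \<subseteq> S - {x} \<and> card (U x) = 1 \<and> 0 < \<rho> x \<and>
      (\<forall>y\<in>U x. norm (y - x) \<le> \<rho> x) \<and> card {z \<in> S. norm (z - x) < \<rho> x} \<le> 2 * 1"
    by (elim exE)
  then have U: "\<And>x. x \<in> S \<Longrightarrow> U x \<subseteq> S - {x}" "\<And>x. x \<in> S \<Longrightarrow> card (U x) = 1"
    "\<And>x y. x \<in> S \<Longrightarrow> y \<in> U x \<Longrightarrow> norm (y - x) \<le> \<rho> x"
    "\<And>x. x \<in> S \<Longrightarrow> card {z \<in> S. norm (z - x) < \<rho> x} \<le> 2"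
    by simp_all
  have "\<exists>y. U x = {y}" if "x \<in> S" for x
    using U(2)[OF that] by (simp add: card_1_singleton_iff)
  then obtain nb where nb: "\<And>x. x \<in> S \<Longrightarrow> U x = {nb x}"
    by metis
  define J where "J = (SIGMA x:S. fib A x \<times> fib A (nb x))"
  define \<pi> where "\<pi> = (\<lambda>(x, c, d). (c + d, c * x + d * nb x))"
  have "card J \<le> card (sumset A A \<times> sumset A A) * 13122"
  proof (rule card_le_fibres)
    show "finite J" "finite (sumset A A \<times> sumset A A)"
      using assms by (auto simp: J_def)
    show "\<pi> ` J \<subseteq> sumset A A \<times> sumset A A"
      by (auto simp: J_def \<pi>_def fib_def intro!: sumsetI)
    fix z :: "quat \<times> quat"
    let ?w = "inverse (fst z) * snd z"
    have "card {j \<in> J. \<pi> j = z} \<le> card {x \<in> S. norm (x - ?w) \<le> \<rho> x}"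
    proof (rule card_inj_on_le[where f = fst])
      show "inj_on fst {j \<in> J. \<pi> j = z}"
      proof (rule inj_onI)
        fix i j assume i: "i \<in> {j \<in> J. \<pi> j = z}" and j: "j \<in> {j \<in> J. \<pi> j = z}" and "fst i = fst j"
        then obtain x c d c' d' where [simp]: "i = (x, c, d)" "j = (x, c', d')" and "x \<in> S"
          by (cases i; cases j) (auto simp: J_def)
        have "x \<noteq> nb x"
          using nb[OF \<open>x \<in> S\<close>] U(1)[OF \<open>x \<in> S\<close>] by auto
        moreover have "c + d = c' + d'" "c * x + d * nb x = c' * x + d' * nb x"
          using i j by (auto simp: \<pi>_def)
        ultimately show "i = j"
          using pair_determined[of x "nb x" c d c' d'] by simp
      qed
      show "fst ` {j \<in> J. \<pi> j = z} \<subseteq> {x \<in> S. norm (x - ?w) \<le> \<rho> x}"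
      proof clarsimp
        fix x c d assume *: "(x, c, d) \<in> J" "z = \<pi> (x, c, d)"
        then have "norm (x - ?w) \<le> norm (nb x - x)"
          using dist_slope_of_sum[OF assms(2)] by (auto simp: J_def \<pi>_def fib_def)
        also have "\<dots> \<le> \<rho> x"
          using * nb U(3) by (auto simp: J_def)
        finally show "x \<in> S \<and> norm (x - inverse (fst (\<pi> (x, c, d))) * snd (\<pi> (x, c, d))) \<le> \<rho> x"
          using * by (auto simp: J_def)
      qed
    qed (use assms in simp)
    also have "\<dots> \<le> 6561 * 2"
      using U assms by (intro card_covering_balls) auto
    finally show "card {j \<in> J. \<pi> j = z} \<le> 13122"
      by simp
  qed
  moreover have "card J = (\<Sum>x\<in>S. card (fib A x) * card (fib A (nb x)))"
    using assms by (simp add: J_def card_cartesian_product)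
  moreover have "card S * (r * r) \<le> (\<Sum>x\<in>S. card (fib A x) * card (fib A (nb x)))"
  proof -
    have "r * r \<le> card (fib A x) * card (fib A (nb x))" if "x \<in> S" for x
      using rich[OF that] rich[of "nb x"] nb[OF that] U(1)[OF that] by (intro mult_mono) auto
    then show ?thesis
      using sum_bounded_below[of S "r * r" "\<lambda>x. card (fib A x) * card (fib A (nb x))"] by simp
  qed
  ultimately show ?thesis
    by (simp add: power2_eq_square card_cartesian_product mult.commute)
qed

text \<open>The harmonic number, standing for the logarithm that a dyadic decomposition would
  lose.\<close>

definition hsum :: "nat \<Rightarrow> real" where
  "hsum n = (\<Sum>t=1..n. 1 / real t)"

lemma hsum_nonneg: "0 \<le> hsum n"
  by (simp add: hsum_def sum_nonneg)

text \<open>As \<open>k\<^sup>2\<close> is at most the sum of \<open>2 * t\<close> over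
  \<open>t \<le> k\<close>, the level \<open>t\<close> contributes at most
  \<open>2 * B / t\<close>.\<close>

lemma layer_cake_bound:
  fixes f :: "'a \<Rightarrow> nat" and B :: real
  assumes "finite \<Lambda>" "\<And>x. x \<in> \<Lambda> \<Longrightarrow> f x \<le> n"
    and B: "\<And>t. t \<in> {1..n} \<Longrightarrow> real (card {x \<in> \<Lambda>. t \<le> f x} * t\<^sup>2) \<le> B"
  shows "(\<Sum>x\<in>\<Lambda>. real ((f x)\<^sup>2)) \<le> 2 * B * hsum n"
proof -
  have *: "k\<^sup>2 \<le> (\<Sum>t\<in>{1..k}. 2 * t)" for k :: nat
    by (induction k) (auto simp: power2_eq_square)
  have "(\<Sum>x\<in>\<Lambda>. (f x)\<^sup>2) \<le> (\<Sum>x\<in>\<Lambda>. \<Sum>t\<in>{t \<in> {1..n}. t \<le> f x}. 2 * t)"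
  proof (rule sum_mono)
    fix x assume "x \<in> \<Lambda>"
    then have "{t \<in> {1..n}. t \<le> f x} = {1..f x}"
      using assms(2)[of x] by auto
    then show "(f x)\<^sup>2 \<le> (\<Sum>t\<in>{t \<in> {1..n}. t \<le> f x}. 2 * t)"
      using * by simp
  qed
  also have "\<dots> = (\<Sum>t\<in>{1..n}. \<Sum>x\<in>{x \<in> \<Lambda>. t \<le> f x}. 2 * t)"
    using assms by (intro sum.swap_restrict) auto
  also have "\<dots> = (\<Sum>t\<in>{1..n}. card {x \<in> \<Lambda>. t \<le> f x} * (2 * t))"
    by simp
  finally have "real (\<Sum>x\<in>\<Lambda>. (f x)\<^sup>2) \<le> (\<Sum>t\<in>{1..n}. real (card {x \<in> \<Lambda>. t \<le> f x} * (2 * t)))"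
    by (simp only: of_nat_mono flip: of_nat_sum)
  also have "\<dots> \<le> (\<Sum>t\<in>{1..n}. 2 * B * (1 / real t))"
  proof (rule sum_mono)
    fix t assume t: "t \<in> {1..n}"
    then have "real (card {x \<in> \<Lambda>. t \<le> f x}) * (real t * real t) \<le> B"
      using B[OF t] by (simp add: power2_eq_square)
    then have "real (card {x \<in> \<Lambda>. t \<le> f x}) * real t \<le> B / real t"
      using t by (simp add: field_simps)
    then show "real (card {x \<in> \<Lambda>. t \<le> f x} * (2 * t)) \<le> 2 * B * (1 / real t)"
      by simp
  qed
  also have "\<dots> = 2 * B * hsum n"
    by (simp add: hsum_def sum_distrib_left)
  finally show ?thesis
    by simp
qed

lemma sum_card_fib_sq_le:
  assumes "finite A" "acute A" "finite \<Lambda>"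
  shows "(\<Sum>x\<in>\<Lambda>. real ((card (fib A x))\<^sup>2)) \<le> 26244 * (card (sumset A A))\<^sup>2 * hsum (card A)"
proof -
  have "(\<Sum>x\<in>\<Lambda>. real ((card (fib A x))\<^sup>2)) \<le> 2 * real (13122 * (card (sumset A A))\<^sup>2) * hsum (card A)"
  proof (rule layer_cake_bound)
    fix t
    have "card {x \<in> \<Lambda>. t \<le> card (fib A x)} * t\<^sup>2 \<le> 13122 * (card (sumset A A))\<^sup>2"
      by (rule card_rich_slopes) (use assms in auto)
    then show "real (card {x \<in> \<Lambda>. t \<le> card (fib A x)} * t\<^sup>2) \<le> real (13122 * (card (sumset A A))\<^sup>2)"
      by (rule of_nat_mono)
  qed (use assms card_fib_le in auto)
  then show ?thesis
    by simp
qed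

lemma sumset_qcnj: "sumset (qcnj ` A) (qcnj ` B) = qcnj ` sumset A B"
  unfolding sumset_conv by (auto simp: image_iff qcnj_add) blast+

text \<open>Conjugation reverses products while preserving acuteness and the size of the
  sumset.\<close>

lemma sum_card_left_fib_sq_le:
  assumes "finite A" "acute A" "finite \<Lambda>"
  shows "(\<Sum>x\<in>\<Lambda>. real ((card {a \<in> A. x * a \<in> A})\<^sup>2)) \<le> 26244 * (card (sumset A A))\<^sup>2 * hsum (card A)"
proof -
  have inj: "inj_on qcnj B" for B
    using inj_qcnj inj_on_subset by blast
  have "fib (qcnj ` A) (qcnj x) = qcnj ` {a \<in> A. x * a \<in> A}" for x
    by (auto simp: fib_def image_iff simp flip: qcnj_mult) (metis qcnj_qcnj)
  then have "card (fib (qcnj ` A) (qcnj x)) = card {a \<in> A. x * a \<in> A}" for x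
    by (simp add: card_image inj)
  then have "(\<Sum>x\<in>\<Lambda>. real ((card {a \<in> A. x * a \<in> A})\<^sup>2)) = (\<Sum>x\<in>qcnj ` \<Lambda>. real ((card (fib (qcnj ` A) x))\<^sup>2))"
    by (simp add: sum.reindex inj)
  also have "\<dots> \<le> 26244 * (card (sumset (qcnj ` A) (qcnj ` A)))\<^sup>2 * hsum (card (qcnj ` A))"
    using assms acute_qcnj by (intro sum_card_fib_sq_le) auto
  finally show ?thesis
    by (simp add: sumset_qcnj card_image inj)
qed

section \<open>Multiplicative energy and a popular level\<close>

definition ratios :: "quat set \<Rightarrow> quat set" where
  "ratios A = (\<lambda>(a, b). inverse a * b) ` (A \<times> A)"

lemma finite_ratios [simp]: "finite A \<Longrightarrow> finite (ratios A)"
  by (simp add: ratios_def)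

text \<open>Since \<open>a * b = c * d\<close> amounts to \<open>inverse c * a = d * inverse b\<close>, the energy is a correlation of
  left and right ratios, and the two are separated by Cauchy--Schwarz.\<close>

lemma energy_lower_bound:
  assumes "finite A" "acute A"
  shows "real (card A) ^ 8 \<le> (real (card (prodset A A)))\<^sup>2 * (\<Sum>x\<in>ratios A. real ((card (fib A x))\<^sup>2))
    * (26244 * (card (sumset A A))\<^sup>2 * hsum (card A))"
proof -
  let ?l = "\<lambda>x. real (card (fib A x))" and ?r = "\<lambda>x. real (card {a \<in> A. x * a \<in> A})"
  let ?Q = "{(i, j). i \<in> A \<times> A \<and> j \<in> A \<times> A \<and> (\<lambda>(a, b). a * b) i = (\<lambda>(a, b). a * b) j}"
  let ?D = "SIGMA x:ratios A. fib A x \<times> {a \<in> A. x * a \<in> A}"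
  have A0: "a \<noteq> 0" if "a \<in> A" for a
    using that assms by (auto simp: acute_def)
  have "(real (card (A \<times> A)))\<^sup>2 \<le> real (card (prodset A A)) * real (card ?Q)"
    using assms by (intro collisions) (auto simp: prodset_conv)
  moreover have "card ?Q \<le> card ?D"
  proof (rule card_inj_on_le)
    \<comment> \<open>For \<open>x = inverse c * a\<close> the equation \<open>a * b = c * d\<close>
      says \<open>c * x = a\<close> and \<open>x * b = d\<close>, so \<open>c\<close> and
      \<open>b\<close> lie in the right and left fibres of \<open>x\<close>.\<close>
    let ?h = "\<lambda>((a, b), (c, d)). (inverse c * a, c, b) :: quat \<times> quat \<times> quat"
    have *: "c * (inverse c * a) = a" "inverse c * (c * a) = a" if "c \<in> A" for a c
      using A0[OF that] by (simp_all flip: mult.assoc)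
    show "inj_on ?h ?Q"
      using A0 by (auto simp: inj_on_def)
    show "?h ` ?Q \<subseteq> ?D"
      by (auto simp: ratios_def fib_def mult.assoc *)
    show "finite ?D"
      using assms by auto
  qed
  moreover have "real (card ?D) = (\<Sum>x\<in>ratios A. ?l x * ?r x)"
    using assms by (simp add: card_cartesian_product)
  ultimately have "(real (card (A \<times> A)))\<^sup>2 \<le> real (card (prodset A A)) * (\<Sum>x\<in>ratios A. ?l x * ?r x)"
    by (smt (verit) mult_left_mono of_nat_0_le_iff of_nat_mono)
  then have "((real (card (A \<times> A)))\<^sup>2)\<^sup>2 \<le> (real (card (prodset A A)) * (\<Sum>x\<in>ratios A. ?l x * ?r x))\<^sup>2"
    by (intro power_mono) auto
  also have "\<dots> \<le> (real (card (prodset A A)))\<^sup>2 * ((\<Sum>x\<in>ratios A. (?l x)\<^sup>2) * (\<Sum>x\<in>ratios A. (?r x)\<^sup>2))"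
    unfolding power_mult_distrib by (intro mult_left_mono Cauchy_Schwarz_ineq_sum) auto
  also have "\<dots> \<le> (real (card (prodset A A)))\<^sup>2 * ((\<Sum>x\<in>ratios A. (?l x)\<^sup>2) *
      (26244 * (card (sumset A A))\<^sup>2 * hsum (card A)))"
    using sum_card_left_fib_sq_le[OF assms, of "ratios A"] assms
    by (intro mult_left_mono) (auto intro: sum_nonneg)
  finally show ?thesis
    by (simp add: card_cartesian_product power_mult_distrib mult.assoc flip: power_mult power_add)
qed

text \<open>Lines through the origin share no other point, so distinct slopes use disjoint parts of
  \<open>A \<times> A\<close>.\<close>

lemma sum_card_fib_le:
  assumes "finite A" "0 \<notin> A" "finite S"
  shows "(\<Sum>x\<in>S. card (fib A x)) \<le> (card A)\<^sup>2"
proof -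
  have "(\<Sum>x\<in>S. card (fib A x)) = card (SIGMA x:S. fib A x)"
    using assms by simp
  also have "\<dots> \<le> card (A \<times> A)"
  proof (rule card_inj_on_le)
    show "inj_on (\<lambda>(x, a). (a, a * x)) (SIGMA x:S. fib A x)"
      using assms by (auto simp: inj_on_def fib_def)
  qed (use assms in \<open>auto simp: fib_def\<close>)
  finally show ?thesis
    by (simp add: power2_eq_square card_cartesian_product)
qed

text \<open>\<open>r\<close> maximises \<open>card S * r\<^sup>2\<close> over all levels, so one
  level carries the second moment up to a harmonic number. The other harmonic number comes from the
  left ratios.\<close>

lemma exists_rich_slopes:
  assumes "finite A" "acute A" "A \<noteq> {}"
  shows "\<exists>S r. finite S \<and> 1 \<le> r \<and> r \<le> card A \<and> (\<forall>x\<in>S. r \<le> card (fib A x)) \<and> card S * r \<le> (card A)\<^sup>2 \<and>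
    real (card A) ^ 8 \<le> (real (card (prodset A A)))\<^sup>2 * (2 * real (card S * r\<^sup>2) * hsum (card A))
      * (26244 * (card (sumset A A))\<^sup>2 * hsum (card A))"
proof -
  let ?S = "\<lambda>t. {x \<in> ratios A. t \<le> card (fib A x)}"
  have "1 \<in> {1..card A}"
    using assms by (simp add: Suc_le_eq card_gt_0_iff)
  then obtain r where r: "r \<in> {1..card A}"
    and max: "\<And>t. t \<in> {1..card A} \<Longrightarrow> real (card (?S t) * t\<^sup>2) \<le> real (card (?S r) * r\<^sup>2)"
    using obtain_max[of "{1..card A}" "\<lambda>t. real (card (?S t) * t\<^sup>2)"] by blast
  have "(\<Sum>x\<in>ratios A. real ((card (fib A x))\<^sup>2)) \<le> 2 * real (card (?S r) * r\<^sup>2) * hsum (card A)"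
    using assms card_fib_le by (intro layer_cake_bound max) auto
  then have "(real (card (prodset A A)))\<^sup>2 * (\<Sum>x\<in>ratios A. real ((card (fib A x))\<^sup>2))
      * (26244 * (card (sumset A A))\<^sup>2 * hsum (card A))
    \<le> (real (card (prodset A A)))\<^sup>2 * (2 * real (card (?S r) * r\<^sup>2) * hsum (card A))
      * (26244 * (card (sumset A A))\<^sup>2 * hsum (card A))"
    using hsum_nonneg by (intro mult_right_mono mult_left_mono) auto
  with energy_lower_bound[OF assms(1,2)]
  have 1: "real (card A) ^ 8 \<le> (real (card (prodset A A)))\<^sup>2 * (2 * real (card (?S r) * r\<^sup>2) * hsum (card A))
      * (26244 * (card (sumset A A))\<^sup>2 * hsum (card A))"
    by (rule order_trans)
  have "card (?S r) * r \<le> (\<Sum>x\<in>?S r. card (fib A x))"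
    using sum_bounded_below[of "?S r" r "\<lambda>x. card (fib A x)"] by simp
  also have "\<dots> \<le> (card A)\<^sup>2"
    using assms by (intro sum_card_fib_le) (auto simp: acute_def)
  finally show ?thesis
    using 1 r assms by (intro exI[of _ "?S r"] exI[of _ r]) auto
qed

text \<open>Solymosi's inequality up to a logarithm. Its later use is on sets with small doubling,
  where it forces a nearly maximal product set.\<close>

lemma card_prodset_lower_bound:
  assumes "finite A" "acute A"
  shows "real (card A) ^ 4 \<le> real (card (prodset A A)) * (26244 * (card (sumset A A))\<^sup>2 * hsum (card A))"
proof -
  let ?E = "26244 * (card (sumset A A))\<^sup>2 * hsum (card A)"
  have "(real (card A) ^ 4)\<^sup>2 \<le> (real (card (prodset A A)))\<^sup>2 * (\<Sum>x\<in>ratios A. real ((card (fib A x))\<^sup>2)) * ?E"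
    using energy_lower_bound[OF assms] by (simp flip: power_mult)
  also have "\<dots> \<le> (real (card (prodset A A)))\<^sup>2 * ?E * ?E"
    using sum_card_fib_sq_le[OF assms, of "ratios A"] assms hsum_nonneg[of "card A"]
    by (intro mult_right_mono mult_left_mono) auto
  also have "\<dots> = (real (card (prodset A A)) * ?E)\<^sup>2"
    by (simp add: power2_eq_square)
  finally show ?thesis
    by (rule power2_le_imp_le) (simp add: hsum_nonneg)
qed

section \<open>Linear relations with many solutions\<close>

text \<open>Balog-Szemeredi-Gowers makes \<open>V = X' * \<mu>1 + Y' * \<mu>2\<close> small.
  Coincidences in \<open>V\<close> then give a popular difference
  \<open>t = c * \<mu>1 - d * \<mu>2\<close>. If \<open>c'\<close> belongs to such a pair
  \<open>(c', d')\<close>, then \<open>(c + c') * \<mu>1 = (c * \<mu>1 + d' * \<mu>2) + t\<close>,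
  so the doubling of \<open>H\<close> is bounded by \<open>card V\<close>, with no Pluennecke-type
  inequality.\<close>

lemma small_doubling_subset:
  fixes X Y Z :: "quat set" and L :: real
  assumes fin: "finite X" "finite Y" "finite Z" and card: "card X = r" "card Y = r" "card Z \<le> r"
    and "1 \<le> r" "0 < L" and \<mu>: "\<mu>1 \<noteq> 0" "\<mu>2 \<noteq> 0"
    and dense: "(real r)\<^sup>2 \<le> L * card {(c, d). c \<in> X \<and> d \<in> Y \<and> (\<exists>e\<in>Z. c * \<mu>1 + d * \<mu>2 = e * \<mu>3)}"
  shows "\<exists>H\<subseteq>X. r \<le> 73728 * L ^ 7 * card H \<and> card (sumset H H) \<le> 3072 * L ^ 5 * r"
proof -
  let ?f = "\<lambda>c d. c * \<mu>1 + d * \<mu>2" and ?Z = "(\<lambda>e. e * \<mu>3) ` Z"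
  have ne: "X \<noteq> {}" "Y \<noteq> {}"
    using card \<open>1 \<le> r\<close> by auto
  have "{(c, d). c \<in> X \<and> d \<in> Y \<and> (\<exists>e\<in>Z. c * \<mu>1 + d * \<mu>2 = e * \<mu>3)} = {(c, d). c \<in> X \<and> d \<in> Y \<and> ?f c d \<in> ?Z}"
    by auto
  then have dense': "real (card X) * real (card Y) \<le> L * card {(c, d). c \<in> X \<and> d \<in> Y \<and> ?f c d \<in> ?Z}"
    using dense card by (simp add: power2_eq_square)
  have "\<exists>X' Y'. X' \<subseteq> X \<and> Y' \<subseteq> Y \<and> card X \<le> 6 * L * card X' \<and> card Y \<le> 4 * L * card Y' \<and>
    real (card ((\<lambda>(x, y). ?f x y) ` (X' \<times> Y'))) * (card X * card Y) \<le> 3072 * L ^ 5 * card ?Z ^ 3"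
    using fin ne \<mu> \<open>0 < L\<close> dense'
    by (intro balog_szemeredi_gowers[where g = "\<lambda>p q s. p - q + s"]) (auto simp: inj_on_def)
  then obtain X' Y' where XY: "X' \<subseteq> X" "Y' \<subseteq> Y" "r \<le> 6 * L * card X'" "r \<le> 4 * L * card Y'"
    and V: "real (card ((\<lambda>(x, y). ?f x y) ` (X' \<times> Y'))) * (card X * card Y) \<le> 3072 * L ^ 5 * card ?Z ^ 3"
    using card by auto
  define V where "V = (\<lambda>(x, y). ?f x y) ` (X' \<times> Y')"
  have fin': "finite X'" "finite Y'" "finite V"
    using XY fin finite_subset unfolding V_def by (auto intro: finite_subset)
  have pos: "0 < card X'" "0 < card Y'"
    using XY(3,4) \<open>1 \<le> r\<close> by (auto intro: Nat.gr0I)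
  have "card ?Z \<le> r"
    using card_image_le[OF fin(3), of "\<lambda>e. e * \<mu>3"] card by simp
  then have "3072 * L ^ 5 * card ?Z ^ 3 \<le> 3072 * L ^ 5 * r ^ 3"
    using \<open>0 < L\<close> by (intro mult_left_mono) (auto intro: power_mono)
  then have "card V * (real r * real r) \<le> (3072 * L ^ 5 * r) * (real r * real r)"
    using V card by (simp add: V_def power3_eq_cube mult.assoc)
  then have V_le: "card V \<le> 3072 * L ^ 5 * r"
    using \<open>1 \<le> r\<close> by (simp only: mult_le_cancel_right) auto
  define H where "H t = {c \<in> X'. \<exists>d\<in>Y'. c * \<mu>1 - d * \<mu>2 = t}" for t
  let ?t = "\<lambda>(c, d). c * \<mu>1 - d * \<mu>2"
  have "X' \<times> Y' \<noteq> {}"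
    using pos by auto
  then obtain p where p: "p \<in> X' \<times> Y'"
    and max: "\<And>p'. p' \<in> X' \<times> Y' \<Longrightarrow> real (card (H (?t p'))) \<le> real (card (H (?t p)))"
    using obtain_max[of "X' \<times> Y'" "\<lambda>p. real (card (H (?t p)))"] fin' by blast
  let ?Q = "{(i, j). i \<in> X' \<times> Y' \<and> j \<in> X' \<times> Y' \<and> (\<lambda>(x, y). ?f x y) i = (\<lambda>(x, y). ?f x y) j}"
  have "card ?Q \<le> card (SIGMA p':X' \<times> Y'. H (?t p'))"
  proof (rule card_inj_on_le)
    \<comment> \<open>Exchanging terms turns equal sums into equal differences
      \<open>c * \<mu>1 - d' * \<mu>2 = c' * \<mu>1 - d * \<mu>2\<close>, so \<open>c\<close> lies
      in \<open>H\<close> for the difference of \<open>(c', d)\<close>.\<close>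
    let ?h = "\<lambda>((c, d), (c', d')). ((c', d), c) :: (quat \<times> quat) \<times> quat"
    show "inj_on ?h ?Q"
      using \<mu> by (auto simp: inj_on_def)
    have *: "c * \<mu>1 - d' * \<mu>2 = c' * \<mu>1 - d * \<mu>2" if "c * \<mu>1 + d * \<mu>2 = c' * \<mu>1 + d' * \<mu>2" for c c' d d'
      using that by (simp add: algebra_simps)
    show "?h ` ?Q \<subseteq> (SIGMA p':X' \<times> Y'. H (?t p'))"
      by (auto simp: H_def dest: *)
    show "finite (SIGMA p':X' \<times> Y'. H (?t p'))"
      using fin' by (auto simp: H_def)
  qed
  also have "\<dots> = (\<Sum>p'\<in>X' \<times> Y'. card (H (?t p')))"
    using fin' by (subst card_SigmaI) (auto simp: H_def)
  also have "\<dots> \<le> card (X' \<times> Y') * card (H (?t p))"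
    using sum_bounded_above[of "X' \<times> Y'" "\<lambda>p'. card (H (?t p'))" "card (H (?t p))"] max by simp
  finally have "real (card ?Q) \<le> real (card (X' \<times> Y') * card (H (?t p)))"
    by (rule of_nat_mono)
  then have "real (card V) * real (card ?Q) \<le> real (card V) * real (card (X' \<times> Y') * card (H (?t p)))"
    by (rule mult_left_mono) simp
  moreover have "(real (card (X' \<times> Y')))\<^sup>2 \<le> real (card V) * real (card ?Q)"
    using fin' by (intro collisions) (auto simp: V_def)
  ultimately have "real (card (X' \<times> Y')) * real (card (X' \<times> Y')) \<le> real (card V) * card (H (?t p)) * real (card (X' \<times> Y'))"
    by (simp add: power2_eq_square mult_ac)
  then have "real (card X') * card Y' \<le> card V * card (H (?t p))"
    using pos by (simp add: card_cartesian_product)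
  also have "\<dots> \<le> (3072 * L ^ 5 * r) * card (H (?t p))"
    using V_le by (simp add: mult_right_mono)
  finally have *: "real (card X') * card Y' \<le> (3072 * L ^ 5 * r) * card (H (?t p))" .
  have "real r * real r \<le> (6 * L * card X') * (4 * L * card Y')"
    using XY(3,4) by (intro mult_mono) auto
  also have "\<dots> = 24 * L\<^sup>2 * (real (card X') * card Y')"
    by (simp add: power2_eq_square)
  also have "\<dots> \<le> 24 * L\<^sup>2 * ((3072 * L ^ 5 * r) * card (H (?t p)))"
    using * by (rule mult_left_mono) simp
  also have "\<dots> = (73728 * L ^ 7 * card (H (?t p))) * real r"
    by (simp add: power_numeral_reduce)
  finally have "r \<le> 73728 * L ^ 7 * card (H (?t p))"
    using \<open>1 \<le> r\<close> by simp
  moreover have "card (sumset (H (?t p)) (H (?t p))) \<le> 3072 * L ^ 5 * r"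
  proof -
    let ?H = "H (?t p)"
    have "(\<lambda>s. s * \<mu>1) ` sumset ?H ?H \<subseteq> (\<lambda>v. v + ?t p) ` V"
    proof clarify
      fix s assume "s \<in> sumset ?H ?H"
      then obtain c c' d' where "s = c + c'" "c \<in> X'" "d' \<in> Y'" "c' * \<mu>1 - d' * \<mu>2 = ?t p"
        by (auto simp: sumset_conv H_def)
      then have "s * \<mu>1 = ?f c d' + ?t p" and "?f c d' \<in> V"
        by (auto simp: V_def algebra_simps)
      then show "s * \<mu>1 \<in> (\<lambda>v. v + ?t p) ` V"
        by blast
    qed
    moreover have "inj_on (\<lambda>s. s * \<mu>1) (sumset ?H ?H)"
      using \<mu> by (simp add: inj_on_def)
    ultimately have "card (sumset ?H ?H) \<le> card ((\<lambda>v. v + ?t p) ` V)"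
      using fin' by (metis card_image card_mono finite_imageI)
    also have "\<dots> \<le> card V"
      using fin'(3) by (rule card_image_le)
    finally show ?thesis
      using V_le by linarith
  qed
  ultimately show ?thesis
    using XY by (intro exI[of _ "H (?t p)"]) (auto simp: H_def)
qed

text \<open>The ratios occurring in many solutions of a linear equation are themselves numerous: otherwise
  the maps \<open>d \<mapsto> d * p\<close> and \<open>d \<mapsto> h * \<mu>1 + d * \<mu>2\<close> violate the incidence bound.\<close>

lemma card_ratios_of_solutions:
  fixes X Y Z :: "quat set" and L :: real
  assumes fin: "finite X" "finite Y" "finite Z" and card: "card X = r" "card Y = r" "card Z \<le> r"
    and "1 \<le> r" "1 \<le> L" and \<mu>: "\<mu>1 \<noteq> 0" "\<mu>2 \<noteq> 0" and nz: "0 \<notin> X" "0 \<notin> Y"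
    and G: "G = {(c, d). c \<in> X \<and> d \<in> Y \<and> (\<exists>e\<in>Z. c * \<mu>1 + d * \<mu>2 = e * \<mu>3)}"
    and dense: "(real r)\<^sup>2 \<le> L * card G"
    and P: "P = (\<lambda>(c, d). inverse d * c) ` G"
  shows "real r ^ 3 \<le> (104976 * L ^ 3 * card P)\<^sup>2"
proof -
  let ?Z = "(\<lambda>e. e * \<mu>3) ` Z"
  \<comment> \<open>The index is \<open>(p, h)\<close> and the parameter is \<open>d\<close>: two
    elements of \<open>G\<close> with the same second entry give one incidence, so \<open>T\<close>
    is at least \<open>(card G) ^ 2 / r\<close>.\<close>
  define R where "R = (\<lambda>(p, h). {d \<in> Y. (d * p, d) \<in> G \<and> (h, d) \<in> G})"
  define T where "T = (\<Sum>i\<in>P \<times> X. card (R i))"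
  have G_sub: "G \<subseteq> X \<times> Y"
    by (auto simp: G)
  have finG: "finite G" "finite P"
    using finite_subset[OF G_sub] fin by (auto simp: P)
  have P0: "p \<noteq> 0" if "p \<in> P" for p
    using that nz by (auto simp: P G)
  have finR: "finite (R i)" for i
    using fin by (auto simp: R_def split: prod.split)
  let ?Q = "{(i, j). i \<in> G \<and> j \<in> G \<and> snd i = snd j}"
  have "(real (card G))\<^sup>2 \<le> real (card Y) * real (card ?Q)"
    using G_sub finG fin by (intro collisions) auto
  also have "card ?Q \<le> card (SIGMA i:P \<times> X. R i)"
  proof (rule card_inj_on_le)
    let ?h = "\<lambda>((c, d), (c', d')). ((inverse d * c, c'), d)"
    show "inj_on ?h ?Q"
      using nz G_sub by (auto simp: inj_on_def)
    have "d * (inverse d * c) = c" if "d \<in> Y" for c d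
      using nz that by (metis mult.assoc mult_1 right_inverse)
    then show "?h ` ?Q \<subseteq> (SIGMA i:P \<times> X. R i)"
      using G_sub by (auto simp: R_def P)
    show "finite (SIGMA i:P \<times> X. R i)"
      using finG fin finR by auto
  qed
  also have "card (SIGMA i:P \<times> X. R i) = T"
    using finG fin finR by (simp add: T_def)
  finally have GT: "(real (card G))\<^sup>2 \<le> r * real T"
    using card by (simp add: mult_left_mono)
  have "((real r)\<^sup>2)\<^sup>2 \<le> (L * card G)\<^sup>2"
    using dense by (intro power_mono) auto
  also have "\<dots> \<le> L\<^sup>2 * (r * real T)"
    unfolding power_mult_distrib using GT by (rule mult_left_mono) simp
  finally have "real r ^ 3 * r \<le> (L\<^sup>2 * real T) * r"
    by (simp add: power_numeral_reduce mult_ac)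
  then have rT: "real r ^ 3 \<le> L\<^sup>2 * real T"
    using \<open>1 \<le> r\<close> by simp
  show ?thesis
  proof (cases "4 * card (P \<times> X) \<le> T")
    case True
    have "real T ^ 3 \<le> (104976 * card (P \<times> X) * card ?Z * card X)\<^sup>2"
    proof (rule similarity_incidence_bound[where R = R and T = T and \<kappa> = "\<lambda>_. norm \<mu>2" and \<kappa>' = "\<lambda>(p, h). norm p"
          and \<phi> = "\<lambda>(p, h) d. h * \<mu>1 + d * \<mu>2" and \<psi> = "\<lambda>(p, h) d. d * p"])
      show "i = j \<and> a = b"
        if i: "i \<in> P \<times> X" and j: "j \<in> P \<times> X" and eqs: "a \<noteq> a'"
          "(\<lambda>(p, h) d. h * \<mu>1 + d * \<mu>2) i a = (\<lambda>(p, h) d. h * \<mu>1 + d * \<mu>2) j b"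
          "(\<lambda>(p, h) d. h * \<mu>1 + d * \<mu>2) i a' = (\<lambda>(p, h) d. h * \<mu>1 + d * \<mu>2) j b'"
          "(\<lambda>(p, h) d. d * p) i a = (\<lambda>(p, h) d. d * p) j b"
          "(\<lambda>(p, h) d. d * p) i a' = (\<lambda>(p, h) d. d * p) j b'" for i j a a' b b'
      proof -
        obtain p h q k where ij: "i = (p, h)" "j = (q, k)" "p \<in> P" "q \<in> P"
          using i j by blast
        have e: "h * \<mu>1 + a * \<mu>2 = k * \<mu>1 + b * \<mu>2" "h * \<mu>1 + a' * \<mu>2 = k * \<mu>1 + b' * \<mu>2"
          "a * p = b * q" "a' * p = b' * q"
          using eqs ij by auto
        have "(a - a') * \<mu>2 = (b - b') * \<mu>2"
          using arg_cong2[OF e(1,2), of "(-)"] by (simp add: algebra_simps)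
        then have "a - a' = b - b'"
          using \<mu> by simp
        moreover have "(a - a') * p = (b - b') * q"
          using e by (simp add: algebra_simps)
        ultimately have "p = q"
          using eqs(1) by (metis mult_left_cancel right_minus_eq)
        then have "a = b"
          using e P0 ij by simp
        then show ?thesis
          using e \<mu> ij \<open>p = q\<close> by simp
      qed
      show "norm ((\<lambda>(p, h) d. h * \<mu>1 + d * \<mu>2) i a - (\<lambda>(p, h) d. h * \<mu>1 + d * \<mu>2) i b) = norm \<mu>2 * norm (a - b)"
        for i a b
        by (auto simp: mult.commute simp flip: left_diff_distrib norm_mult split: prod.split) (simp add: norm_mult)
      show "norm ((\<lambda>(p, h) d. d * p) i a - (\<lambda>(p, h) d. d * p) i b) = (case i of (p, h) \<Rightarrow> norm p) * norm (a - b)"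
        for i :: "quat \<times> quat" and a b
      proof (cases i)
        case (Pair p h)
        have "a * p - b * p = (a - b) * p"
          by (simp add: algebra_simps)
        then show ?thesis
          using Pair by (simp add: norm_mult)
      qed
    qed (use fin finG finR \<mu> P0 G_sub True in \<open>auto simp: R_def T_def G\<close>)
    moreover have "104976 * card (P \<times> X) * card ?Z * card X \<le> 104976 * (card P * r) * r * r"
      using card_image_le[OF fin(3), of "\<lambda>e. e * \<mu>3"] card
      by (intro mult_mono) (auto simp: card_cartesian_product)
    then have "(104976 * card (P \<times> X) * card ?Z * card X)\<^sup>2 \<le> (104976 * (card P * r) * r * r)\<^sup>2"
      by (intro power_mono) auto
    then have "real ((104976 * card (P \<times> X) * card ?Z * card X)\<^sup>2) \<le> real ((104976 * (card P * r) * r * r)\<^sup>2)"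
      by (rule of_nat_mono)
    moreover have "real ((104976 * (card P * r) * r * r)\<^sup>2) = (104976 * (real (card P) * r) * r * r)\<^sup>2"
      by simp
    ultimately have T3: "real T ^ 3 \<le> (104976 * (real (card P) * r) * r * r)\<^sup>2"
      by linarith
    have "(real r ^ 3) ^ 3 \<le> (L\<^sup>2 * T) ^ 3"
      using rT by (intro power_mono) auto
    also have "\<dots> \<le> (L\<^sup>2) ^ 3 * (104976 * (real (card P) * r) * r * r)\<^sup>2"
      unfolding power_mult_distrib[of _ _ 3] using T3 by (intro mult_left_mono) auto
    finally have "real r ^ 3 * real r ^ 6 \<le> (104976 * L ^ 3 * card P)\<^sup>2 * real r ^ 6"
      by (simp add: power_mult_distrib mult_ac flip: power_mult power_add)
    then show ?thesis
      using \<open>1 \<le> r\<close> by (simp only: mult_le_cancel_right) auto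
  next
    case False
    \<comment> \<open>With so few incidences, \<open>rT\<close> by itself yields a bound with the
      larger power \<open>r ^ 4\<close>.\<close>
    then have "real T \<le> 4 * card P * r"
      using card by (simp add: card_cartesian_product flip: of_nat_mult)
    then have "L\<^sup>2 * real T \<le> L\<^sup>2 * (4 * card P * r)"
      by (rule mult_left_mono) simp
    with rT have "(real r)\<^sup>2 * r \<le> (4 * L\<^sup>2 * card P) * r"
      by (simp add: power_numeral_reduce mult_ac)
    then have "(real r)\<^sup>2 \<le> 4 * L\<^sup>2 * card P"
      using \<open>1 \<le> r\<close> by simp
    also have "\<dots> \<le> 104976 * L ^ 3 * card P"
      using \<open>1 \<le> L\<close> by (intro mult_right_mono mult_mono power_increasing) auto
    finally have "((real r)\<^sup>2)\<^sup>2 \<le> (104976 * L ^ 3 * card P)\<^sup>2"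
      by (rule power_mono) simp
    moreover have "real r ^ 3 \<le> ((real r)\<^sup>2)\<^sup>2"
      using \<open>1 \<le> r\<close> power_increasing[of 3 4 "real r"] by (simp flip: power_mult)
    ultimately show ?thesis
      by linarith
  qed
qed

section \<open>Approximate multiplicative structure\<close>

text \<open>A near-group cannot contain much of a set together with an affine image of it; this is the
  multiplicative counterpart of sum-product estimates such as lower bounds for \<open>A * (A + 1)\<close>.\<close>

lemma card_affine_multipliers:
  fixes W P :: "quat set"
  assumes fin: "finite W" "finite P" and nz: "0 \<notin> W" "0 \<notin> P" and \<mu>: "\<mu>1 \<noteq> 0" "\<mu>2 \<noteq> 0" "\<mu>3 \<noteq> 0"
    and D1: "\<And>p. p \<in> P \<Longrightarrow> D \<le> card {b \<in> W. b * p \<in> W}"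
    and D2: "\<And>p. p \<in> P \<Longrightarrow> D \<le> card {b \<in> W. b * ((p * \<mu>1 + \<mu>2) * inverse \<mu>3) \<in> W}"
  shows "real (card P) ^ 3 * real D ^ 6 \<le> (104976 * real (card W) ^ 4)\<^sup>2"
proof (cases "W = {}")
  case True
  then show ?thesis
    using D1 by (cases "P = {}") auto
next
  case False
  then have W: "1 \<le> card W"
    using fin by (simp add: Suc_le_eq card_gt_0_iff)
  \<comment> \<open>The curves are indexed by pairs from \<open>W\<close> and parametrised by
    \<open>p\<close>; each \<open>p\<close> is incident to at least \<open>D * D\<close> of
    them.\<close>
  define R where "R = (\<lambda>(b, c). {p \<in> P. b * p \<in> W \<and> c * ((p * \<mu>1 + \<mu>2) * inverse \<mu>3) \<in> W})"
  define T where "T = (\<Sum>i\<in>W \<times> W. card (R i))"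
  have "T = (\<Sum>i\<in>W \<times> W. card {p \<in> P. fst i * p \<in> W \<and> snd i * ((p * \<mu>1 + \<mu>2) * inverse \<mu>3) \<in> W})"
    by (simp add: T_def R_def case_prod_unfold)
  also have "\<dots> = (\<Sum>p\<in>P. card {i \<in> W \<times> W. fst i * p \<in> W \<and> snd i * ((p * \<mu>1 + \<mu>2) * inverse \<mu>3) \<in> W})"
    using fin by (intro double_count) auto
  also have "\<dots> = (\<Sum>p\<in>P. card ({b \<in> W. b * p \<in> W} \<times> {b \<in> W. b * ((p * \<mu>1 + \<mu>2) * inverse \<mu>3) \<in> W}))"
    by (intro sum.cong arg_cong[where f = card]) auto
  also have "\<dots> \<ge> card P * (D * D)"
    using sum_bounded_below[of P "D * D"
        "\<lambda>p. card ({b \<in> W. b * p \<in> W} \<times> {b \<in> W. b * ((p * \<mu>1 + \<mu>2) * inverse \<mu>3) \<in> W})"] D1 D2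
    by (simp add: card_cartesian_product mult_mono)
  finally have PT: "card P * (D * D) \<le> T" .
  have "(real (card P) * (real D * real D)) ^ 3 \<le> (104976 * real (card W) ^ 4)\<^sup>2"
  proof (cases "4 * card (W \<times> W) \<le> T")
    case True
    have "real T ^ 3 \<le> (104976 * card (W \<times> W) * card W * card W)\<^sup>2"
    proof (rule similarity_incidence_bound[where R = R and T = T and \<kappa> = "\<lambda>(b, c). norm b"
          and \<kappa>' = "\<lambda>(b, c). norm c * norm \<mu>1 * norm (inverse \<mu>3)"
          and \<phi> = "\<lambda>(b, c) p. b * p" and \<psi> = "\<lambda>(b, c) p. c * ((p * \<mu>1 + \<mu>2) * inverse \<mu>3)"])
      show "i = j \<and> p = q"
        if i: "i \<in> W \<times> W" and j: "j \<in> W \<times> W" and eqs: "p \<noteq> p'"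
          "(\<lambda>(b, c) p. b * p) i p = (\<lambda>(b, c) p. b * p) j q"
          "(\<lambda>(b, c) p. b * p) i p' = (\<lambda>(b, c) p. b * p) j q'"
          "(\<lambda>(b, c) p. c * ((p * \<mu>1 + \<mu>2) * inverse \<mu>3)) i p = (\<lambda>(b, c) p. c * ((p * \<mu>1 + \<mu>2) * inverse \<mu>3)) j q"
          "(\<lambda>(b, c) p. c * ((p * \<mu>1 + \<mu>2) * inverse \<mu>3)) i p' = (\<lambda>(b, c) p. c * ((p * \<mu>1 + \<mu>2) * inverse \<mu>3)) j q'"
        for i j p p' q q'
      proof -
        obtain b c b' c' where ij: "i = (b, c)" "j = (b', c')" "b \<in> W" "b' \<in> W" "c \<in> W" "c' \<in> W"
          using i j by blast
        then have nz': "b \<noteq> 0" "b' \<noteq> 0" "c \<noteq> 0" "c' \<noteq> 0"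
          using nz by auto
        have e: "b * p = b' * q" "b * p' = b' * q'"
          "c * (p * \<mu>1 + \<mu>2) = c' * (q * \<mu>1 + \<mu>2)" "c * (p' * \<mu>1 + \<mu>2) = c' * (q' * \<mu>1 + \<mu>2)"
          using eqs ij \<mu> by (auto simp flip: mult.assoc)
        \<comment> \<open>Two common points force the same multiplier \<open>u = v\<close> on both
          coordinates; then the translation gives \<open>u * \<mu>2 = \<mu>2\<close>. It is
          \<open>\<mu>2 \<noteq> 0\<close> that destroys the multiplicative symmetry.\<close>
        define u v where "u = inverse b' * b" and "v = inverse c' * c"
        have q: "q = u * p" "q' = u * p'"
          using e(1,2) nz' by (simp_all add: u_def mult.assoc) (simp_all flip: mult.assoc)
        have v: "u * p * \<mu>1 + \<mu>2 = v * (p * \<mu>1 + \<mu>2)" "u * p' * \<mu>1 + \<mu>2 = v * (p' * \<mu>1 + \<mu>2)"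
          using e(3,4) nz' by (simp_all add: q v_def mult.assoc) (simp_all flip: mult.assoc)
        have "u * (p - p') * \<mu>1 = (u * p * \<mu>1 + \<mu>2) - (u * p' * \<mu>1 + \<mu>2)"
          by (simp add: algebra_simps)
        also have "\<dots> = v * (p - p') * \<mu>1"
          unfolding v by (simp add: algebra_simps)
        finally have "u = v"
          using eqs(1) \<mu> by simp
        with v(1) have "u * \<mu>2 = 1 * \<mu>2"
          by (simp add: algebra_simps)
        then have "u = 1"
          using \<mu>(2) by (metis mult_right_cancel)
        then have "b' * u = b'" "c' * v = c'"
          using \<open>u = v\<close> by auto
        then have "b = b'" "c = c'"
          unfolding u_def v_def using nz' by (simp_all flip: mult.assoc)
        then show ?thesis
          using e nz' ij by simp
      qed
      show "norm ((\<lambda>(b, c) p. b * p) i p - (\<lambda>(b, c) p. b * p) i q) = (\<lambda>(b, c). norm b) i * norm (p - q)" for i :: "quat \<times> quat" and p q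
      proof (cases i)
        case (Pair b c)
        have "b * p - b * q = b * (p - q)"
          by (simp add: algebra_simps)
        then show ?thesis
          using Pair by (simp add: norm_mult)
      qed
      show "norm ((\<lambda>(b, c) p. c * ((p * \<mu>1 + \<mu>2) * inverse \<mu>3)) i p - (\<lambda>(b, c) p. c * ((p * \<mu>1 + \<mu>2) * inverse \<mu>3)) i q)
          = (\<lambda>(b, c). norm c * norm \<mu>1 * norm (inverse \<mu>3)) i * norm (p - q)" for i p q
      proof (cases i)
        case (Pair b c)
        have "c * ((p * \<mu>1 + \<mu>2) * inverse \<mu>3) - c * ((q * \<mu>1 + \<mu>2) * inverse \<mu>3) = c * (p - q) * \<mu>1 * inverse \<mu>3"
          by (simp add: algebra_simps)
        then show ?thesis
          using Pair by (simp add: norm_mult)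
      qed
      show "0 < (\<lambda>(b, c). norm c * norm \<mu>1 * norm (inverse \<mu>3)) i" if "i \<in> W \<times> W" for i
        using that nz \<mu> by (auto intro!: mult_pos_pos)
    qed (use fin nz \<mu> True in \<open>auto simp: R_def T_def\<close>)
    also have "\<dots> = (104976 * real (card W) ^ 4)\<^sup>2"
      by (simp add: card_cartesian_product power_numeral_reduce mult_ac)
    finally have "real T ^ 3 \<le> (104976 * real (card W) ^ 4)\<^sup>2" .
    moreover have "(real (card P) * (real D * real D)) ^ 3 \<le> real T ^ 3"
      using PT by (intro power_mono) (auto simp flip: of_nat_mult)
    ultimately show ?thesis
      by linarith
  next
    case False
    then have "card P * (D * D) \<le> 4 * (card W)\<^sup>2"
      using PT by (simp add: card_cartesian_product power2_eq_square)
    then have "real (card P) * (real D * real D) \<le> 4 * (real (card W))\<^sup>2"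
      by (simp flip: of_nat_mult of_nat_power)
    then have "(real (card P) * (real D * real D)) ^ 3 \<le> (4 * (real (card W))\<^sup>2) ^ 3"
      by (intro power_mono) auto
    also have "\<dots> = 64 * real (card W) ^ 6"
      by (simp add: power_mult_distrib flip: power_mult)
    also have "\<dots> \<le> 104976\<^sup>2 * real (card W) ^ 8"
      using W by (intro mult_mono power_increasing) auto
    also have "\<dots> = (104976 * real (card W) ^ 4)\<^sup>2"
      by (simp add: power_mult_distrib flip: power_mult)
    finally show ?thesis .
  qed
  then show ?thesis
    by (simp add: power_mult_distrib power_numeral_reduce mult_ac)
qed

text \<open>All ratios from a translate of \<open>S'\<close> are of the form \<open>inverse s * t\<close> with \<open>s, t \<in> S'\<close>, and such a
  ratio maps the part \<open>X' * s\<close> of \<open>W = X' * S'\<close> to \<open>X' * t\<close>.\<close>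

lemma exists_popular_ratios:
  fixes A S :: "quat set" and L :: real
  assumes fin: "finite A" "finite S" and ne: "A \<noteq> {}" "S \<noteq> {}" and nz: "0 \<notin> A" "0 \<notin> S" and "0 < L"
    and pop: "\<And>x. x \<in> S \<Longrightarrow> card (prodset A A) \<le> L * card {b \<in> prodset A A. b * x \<in> prodset A A}"
    and rich: "\<And>x. x \<in> S \<Longrightarrow> r \<le> card (fib A x)"
  shows "\<exists>B W. B \<subseteq> A \<and> finite W \<and> 0 \<notin> W \<and> card S * r \<le> 4 * L * (card A * card B) \<and>
    real (card W) * card S \<le> 3072 * L ^ 5 * (card (prodset A A))\<^sup>2 \<and>
    (\<forall>p\<in>ratios B. card (prodset A A) \<le> 6 * L * card {b \<in> W. b * p \<in> W})"
proof -
  define X where "X = prodset A A"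
  have X: "finite X" "X \<noteq> {}" "0 \<notin> X"
    using fin ne nz by (auto simp: X_def prodset_conv)
  have XS: "0 < card X" "0 < card S"
    using X fin ne by (auto simp: card_gt_0_iff)
  let ?G = "{(x, s). x \<in> X \<and> s \<in> S \<and> x * s \<in> X}"
  have "card {(s, x). s \<in> S \<and> x \<in> {x \<in> X. x * s \<in> X}} = (\<Sum>s\<in>S. card {x \<in> X. x * s \<in> X})"
    using fin X by (intro card_Collect_pairs) auto
  moreover have "card ?G = card {(s, x). s \<in> S \<and> x \<in> {x \<in> X. x * s \<in> X}}"
    by (rule bij_betw_same_card[of "\<lambda>(a, b). (b, a)"]) (auto simp: bij_betw_def inj_on_def image_iff)
  moreover have "card S * (card X / L) \<le> (\<Sum>s\<in>S. real (card {x \<in> X. x * s \<in> X}))"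
    using pop \<open>0 < L\<close> by (intro sum_bounded_below) (auto simp: X_def field_simps)
  ultimately have "card S * (card X / L) \<le> real (card ?G)"
    by (simp flip: of_nat_sum)
  then have dense: "real (card X) * real (card S) \<le> L * card ?G"
    using \<open>0 < L\<close> by (simp add: field_simps)
  have "\<exists>X' S'. X' \<subseteq> X \<and> S' \<subseteq> S \<and> card X \<le> 6 * L * card X' \<and> card S \<le> 4 * L * card S' \<and>
      real (card ((\<lambda>(x, s). x * s) ` (X' \<times> S'))) * (card X * card S) \<le> 3072 * L ^ 5 * card X ^ 3"
  proof (rule balog_szemeredi_gowers[where g = "\<lambda>p q s. p * inverse q * s"])
    fix x x1 s s1 assume "x \<in> X" "x1 \<in> X" "s \<in> S" "s1 \<in> S"
    then have "x1 \<noteq> 0" "s1 \<noteq> 0"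
      using X nz by auto
    have "x * s1 * inverse (x1 * s1) * (x1 * s) = x * (s1 * inverse s1) * (inverse x1 * x1) * s"
      unfolding nonzero_inverse_mult_distrib[OF \<open>x1 \<noteq> 0\<close> \<open>s1 \<noteq> 0\<close>] by (simp only: mult.assoc)
    then show "x * s = x * s1 * inverse (x1 * s1) * (x1 * s)"
      using \<open>x1 \<noteq> 0\<close> \<open>s1 \<noteq> 0\<close> by simp
  qed (use fin ne nz X \<open>0 < L\<close> dense in \<open>auto simp: inj_on_def\<close>)
  then obtain X' S' where *: "X' \<subseteq> X" "S' \<subseteq> S" "card X \<le> 6 * L * card X'" "card S \<le> 4 * L * card S'"
    and W_le: "real (card ((\<lambda>(x, s). x * s) ` (X' \<times> S'))) * (card X * card S) \<le> 3072 * L ^ 5 * card X ^ 3"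
    by blast
  define W where "W = (\<lambda>(x, s). x * s) ` (X' \<times> S')"
  have fin': "finite X'" "finite S'"
    using * X fin by (auto intro: finite_subset)
  then have finW: "finite W"
    by (simp add: W_def)
  have "0 \<notin> W"
    using * X nz by (auto simp: W_def)
  have "(real (card W) * card S) * card X \<le> (3072 * L ^ 5 * (card X)\<^sup>2) * card X"
    using W_le by (simp add: W_def power_numeral_reduce mult_ac)
  then have W_le': "real (card W) * card S \<le> 3072 * L ^ 5 * (card X)\<^sup>2"
    using XS by simp
  \<comment> \<open>The richness of the slopes gives at least \<open>card S' * r\<close> pairs
    \<open>(a, s)\<close> with \<open>a * s \<in> A\<close>; averaging over \<open>a\<close> finds a
    large \<open>B a\<close>.\<close>
  define B where "B a = {b \<in> A. inverse a * b \<in> S'}" for a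
  have "\<exists>a\<in>A. real (card S' * r) \<le> real (card A * card (B a))"
  proof -
    obtain a where a: "a \<in> A" and max: "\<And>b. b \<in> A \<Longrightarrow> real (card (B b)) \<le> real (card (B a))"
      using obtain_max[OF fin(1) ne(1), of "\<lambda>a. real (card (B a))"] by blast
    have "card S' * r \<le> (\<Sum>s\<in>S'. card (fib A s))"
      using sum_bounded_below[of S' r "\<lambda>s. card (fib A s)"] rich * by auto
    also have "\<dots> = (\<Sum>a\<in>A. card {s \<in> S'. a * s \<in> A})"
      unfolding fib_def using fin fin' by (intro double_count) auto
    also have "\<dots> \<le> (\<Sum>a\<in>A. card (B a))"
    proof (rule sum_mono, rule card_inj_on_le)
      fix a assume "a \<in> A"
      then have "a \<noteq> 0"
        using nz by auto
      then show "inj_on ((*) a) {s \<in> S'. a * s \<in> A}"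
        by (simp add: inj_on_def)
      show "(*) a ` {s \<in> S'. a * s \<in> A} \<subseteq> B a"
        using \<open>a \<noteq> 0\<close> by (auto simp: B_def simp flip: mult.assoc)
    qed (use fin in \<open>simp add: B_def\<close>)
    also have "\<dots> \<le> card A * card (B a)"
      using sum_bounded_above[of A "\<lambda>a. card (B a)" "card (B a)"] max by simp
    finally show ?thesis
      using a by (intro bexI[of _ a] of_nat_mono)
  qed
  then obtain a where a: "a \<in> A" "real (card S' * r) \<le> real (card A * card (B a))"
    by blast
  have "real (card S) * r \<le> (4 * L * card S') * r"
    using *(4) by (rule mult_right_mono) simp
  also have "\<dots> \<le> 4 * L * (card A * card (B a))"
    using a(2) \<open>0 < L\<close> by (simp add: mult.assoc)
  finally have "card S * r \<le> 4 * L * (card A * card (B a))"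
    by simp
  moreover have "card X \<le> 6 * L * card {b \<in> W. b * p \<in> W}" if "p \<in> ratios (B a)" for p
  proof -
    obtain c d where cd: "p = inverse c * d" "c \<in> B a" "d \<in> B a"
      using \<open>p \<in> ratios (B a)\<close> by (auto simp: ratios_def)
    define s t where "s = inverse a * c" and "t = inverse a * d"
    have st: "s \<in> S'" "t \<in> S'"
      using cd by (auto simp: B_def s_def t_def)
    have "a \<noteq> 0" "c \<noteq> 0"
      using a cd nz by (auto simp: B_def)
    then have "s \<noteq> 0" and sp: "s * p = t"
      by (auto simp: s_def t_def cd mult.assoc) (simp flip: mult.assoc)
    have "card X' \<le> card {b \<in> W. b * p \<in> W}"
    proof (rule card_inj_on_le)
      show "inj_on (\<lambda>x. x * s) X'"
        using \<open>s \<noteq> 0\<close> by (simp add: inj_on_def)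
      show "(\<lambda>x. x * s) ` X' \<subseteq> {b \<in> W. b * p \<in> W}"
        using st by (auto simp: W_def mult.assoc sp)
    qed (use finW in simp)
    then have "6 * L * card X' \<le> 6 * L * card {b \<in> W. b * p \<in> W}"
      using \<open>0 < L\<close> by simp
    then show ?thesis
      using *(3) by linarith
  qed
  ultimately show ?thesis
    using W_le' finW \<open>0 \<notin> W\<close> unfolding X_def
    by (intro exI[of _ "B a"] exI[of _ W]) (auto simp: B_def)
qed

section \<open>Clusters of slopes\<close>

text \<open>Eliminating one of the four slopes from a coincidence of two sums of points on lines leaves
  a linear relation between points on the other three.\<close>

lemma coincidence_gives_relation:
  fixes x y x' y' :: quat
  assumes "x \<noteq> y" "x' \<noteq> y'" "{x, y} \<noteq> {x', y'}"
  shows "\<exists>z\<in>{x', y'}. \<exists>\<mu>1 \<mu>2 \<mu>3. \<mu>1 \<noteq> 0 \<and> \<mu>2 \<noteq> 0 \<and> \<mu>3 \<noteq> 0 \<and>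
    (\<forall>c d c' d'. c + d = c' + d' \<and> c * x + d * y = c' * x' + d' * y' \<longrightarrow>
      c * \<mu>1 + d * \<mu>2 = (if z = x' then c' else d') * \<mu>3)"
proof (cases "y' \<in> {x, y}")
  case False
  \<comment> \<open>The eliminated slope must avoid \<open>x\<close> and \<open>y\<close> to keep
    \<open>\<mu>1\<close> and \<open>\<mu>2\<close> nonzero. As the two pairs of slopes differ,
    \<open>y'\<close> or else \<open>x'\<close> qualifies.\<close>
  have "c * (x - y') + d * (y - y') = c' * (x' - y')"
    if "c + d = c' + d'" "c * x + d * y = c' * x' + d' * y'" for c d c' d'
  proof -
    have "c * (x - y') + d * (y - y') = c * x + d * y - (c + d) * y'"
      by (simp add: algebra_simps)
    also have "\<dots> = c' * (x' - y')"
      unfolding that by (simp add: algebra_simps)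
    finally show ?thesis .
  qed
  then show ?thesis
    using False assms
    by (intro bexI[of _ x'] exI[of _ "x - y'"] exI[of _ "y - y'"] exI[of _ "x' - y'"]) auto
next
  case True
  then have "x' \<notin> {x, y}"
    using assms by auto
  have "c * (x - x') + d * (y - x') = d' * (y' - x')"
    if "c + d = c' + d'" "c * x + d * y = c' * x' + d' * y'" for c d c' d'
  proof -
    have "c * (x - x') + d * (y - x') = c * x + d * y - (c + d) * x'"
      by (simp add: algebra_simps)
    also have "\<dots> = d' * (y' - x')"
      unfolding that by (simp add: algebra_simps)
    finally show ?thesis .
  qed
  then show ?thesis
    using \<open>x' \<notin> {x, y}\<close> assms
    by (intro bexI[of _ y'] exI[of _ "x - x'"] exI[of _ "y - x'"] exI[of _ "y' - x'"]) auto
qed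

definition relation_pairs ::
  "(quat \<Rightarrow> quat set) \<Rightarrow> quat \<Rightarrow> quat \<Rightarrow> quat \<Rightarrow> quat \<Rightarrow> quat \<Rightarrow> quat \<Rightarrow> (quat \<times> quat) set" where
  "relation_pairs F x y z \<mu>1 \<mu>2 \<mu>3 =
    {(c, d). c \<in> F x \<and> d \<in> F y \<and> (\<exists>e\<in>F z. c * \<mu>1 + d * \<mu>2 = e * \<mu>3)}"

text \<open>Each slope \<open>x\<close> is paired with its \<open>m\<close> nearest neighbours \<open>y\<close>. If the sums of points on the
  lines \<open>x\<close> and \<open>y\<close> were essentially distinct, there would be about \<open>card S * m * r\<^sup>2\<close> of them, too
  many for \<open>A + A\<close>. The slope of each such sum lies in the ball about \<open>x\<close> containing the
  neighbours, so only boundedly many (in terms of \<open>m\<close>) pairs of lines can interact with a given one,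
  and some two of them must coincide often.\<close>

theorem clustered_slopes:
  assumes A: "finite A" "acute A" and S: "finite S" "1 \<le> m" "m < card S"
    and F: "\<And>x. x \<in> S \<Longrightarrow> F x \<subseteq> fib A x" "\<And>x. x \<in> S \<Longrightarrow> card (F x) = r"
    and "1 \<le> r" and few: "4 * (card (sumset A A))\<^sup>2 \<le> card S * m * r\<^sup>2"
  shows "card S \<le> 52488 * m\<^sup>2 * card {x \<in> S. \<exists>y\<in>S. \<exists>z\<in>S. \<exists>\<mu>1 \<mu>2 \<mu>3. \<mu>1 \<noteq> 0 \<and> \<mu>2 \<noteq> 0 \<and> \<mu>3 \<noteq> 0 \<and>
    r\<^sup>2 \<le> 52488 * m\<^sup>2 * card (relation_pairs F x y z \<mu>1 \<mu>2 \<mu>3)}"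
proof -
  from exists_neighbours[OF S] obtain U \<rho>
    where "\<forall>x\<in>S. U x \<subseteq> S - {x} \<and> card (U x) = m \<and> 0 < \<rho> x \<and>
      (\<forall>y\<in>U x. norm (y - x) \<le> \<rho> x) \<and> card {z \<in> S. norm (z - x) < \<rho> x} \<le> 2 * m"
    by (elim exE)
  then have U: "\<And>x. x \<in> S \<Longrightarrow> U x \<subseteq> S - {x}" "\<And>x. x \<in> S \<Longrightarrow> card (U x) = m"
    "\<And>x. x \<in> S \<Longrightarrow> 0 < \<rho> x" "\<And>x y. x \<in> S \<Longrightarrow> y \<in> U x \<Longrightarrow> norm (y - x) \<le> \<rho> x"
    "\<And>x. x \<in> S \<Longrightarrow> card {z \<in> S. norm (z - x) < \<rho> x} \<le> 2 * m"
    by simp_all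
  have finU: "finite (U x)" if "x \<in> S" for x
    using U(1)[OF that] S finite_subset by blast
  have finF: "finite (F x)" if "x \<in> S" for x
    using F(1)[OF that] A finite_subset[OF _ finite_fib] by blast
  have FA: "a \<in> A" "a * x \<in> A" if "x \<in> S" "a \<in> F x" for a x
    using F(1)[OF that(1)] that(2) by (auto simp: fib_def)
  define J where "J = (SIGMA x:S. SIGMA y:U x. F x \<times> F y)"
  have JD: "x \<in> S" "y \<in> U x" "y \<in> S" "x \<noteq> y" "c \<in> F x" "d \<in> F y" if "(x, y, c, d) \<in> J" for x y c d
    using that U(1) by (auto simp: J_def)
  have JA: "c \<in> A" "d \<in> A" "c * x \<in> A" "d * y \<in> A" if "(x, y, c, d) \<in> J" for x y c d
    using FA[OF JD(1,5)[OF that]] FA[OF JD(3,6)[OF that]] by auto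
  have finJ: "finite J"
    unfolding J_def using S finU finF U(1) by (intro finite_SigmaI) auto
  have "card J = (\<Sum>x\<in>S. card (SIGMA y:U x. F x \<times> F y))"
    unfolding J_def using S finU finF U(1) by (intro card_SigmaI ballI finite_SigmaI) auto
  also have "\<dots> = (\<Sum>x\<in>S. m * r\<^sup>2)"
  proof (rule sum.cong)
    fix x assume x: "x \<in> S"
    have "card (SIGMA y:U x. F x \<times> F y) = (\<Sum>y\<in>U x. card (F x \<times> F y))"
      using x U(1)[OF x] finU finF by (intro card_SigmaI ballI finite_SigmaI) auto
    also have "\<dots> = (\<Sum>y\<in>U x. r * r)"
      using x U(1)[OF x] F(2) by (intro sum.cong) (auto simp: card_cartesian_product)
    finally show "card (SIGMA y:U x. F x \<times> F y) = m * r\<^sup>2"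
      using U(2)[OF x] by (simp add: power2_eq_square)
  qed simp
  finally have cardJ: "card J = card S * m * r\<^sup>2"
    by simp
  have "0 < card S"
    using S by linarith
  then have J_pos: "0 < card J"
    using cardJ S \<open>1 \<le> r\<close> by simp
  define \<pi> :: "quat \<times> quat \<times> quat \<times> quat \<Rightarrow> quat \<times> quat"
    where "\<pi> = (\<lambda>(x, y, c, d). (c + d, c * x + d * y))"
  define Q where "Q = {(i, j). i \<in> J \<and> j \<in> J \<and> \<pi> i = \<pi> j}"
  have finQ: "finite Q"
    by (rule finite_subset[of _ "J \<times> J"]) (use finJ in \<open>auto simp: Q_def\<close>)
  have "\<pi> ` J \<subseteq> sumset A A \<times> sumset A A"
    using JA by (auto simp: \<pi>_def intro!: sumsetI)
  then have "(real (card J))\<^sup>2 \<le> real (card (sumset A A \<times> sumset A A)) * real (card Q)"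
    unfolding Q_def using A finJ by (intro collisions) auto
  also have "\<dots> \<le> (real (card J) / 4) * real (card Q)"
  proof (rule mult_right_mono)
    have "4 * card (sumset A A \<times> sumset A A) \<le> card J"
      using few cardJ by (simp add: card_cartesian_product power2_eq_square)
    then show "real (card (sumset A A \<times> sumset A A)) \<le> real (card J) / 4"
      by linarith
  qed simp
  finally have "real (card J) * real (card J) \<le> real (card J) * (real (card Q) / 4)"
    by (simp add: power2_eq_square)
  \<comment> \<open>The factor 4 leaves room for the at most \<open>2 * card J\<close> trivial
    coincidences and for halving the rest by symmetry.\<close>
  then have Q4: "4 * card J \<le> card Q"
    using J_pos by simp
  define slopes :: "quat \<times> quat \<times> quat \<times> quat \<Rightarrow> quat set" where "slopes = (\<lambda>(x, y, c, d). {x, y})"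
  \<comment> \<open>With equal slope sets, \<open>j\<close> must be \<open>i\<close> itself or
    \<open>i\<close> with its two lines exchanged.\<close>
  define Q0 where "Q0 = {(i, j) \<in> Q. slopes i = slopes j}"
  have "Q0 \<subseteq> (\<lambda>i. (i, i)) ` J \<union> (\<lambda>(x, y, c, d). ((x, y, c, d), (y, x, d, c))) ` J"
  proof
    fix ij assume ij: "ij \<in> Q0"
    obtain x y c d x' y' c' d' where e: "ij = ((x, y, c, d), (x', y', c', d'))"
      by (metis prod.exhaust)
    have J: "(x, y, c, d) \<in> J" "(x', y', c', d') \<in> J" and "{x, y} = {x', y'}"
      and s: "c + d = c' + d'" "c * x + d * y = c' * x' + d' * y'"
      using ij by (auto simp: e Q0_def Q_def slopes_def \<pi>_def)
    then consider "x' = x" "y' = y" | "x' = y" "y' = x"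
      by (auto simp: doubleton_eq_iff)
    then show "ij \<in> (\<lambda>i. (i, i)) ` J \<union> (\<lambda>(x, y, c, d). ((x, y, c, d), (y, x, d, c))) ` J"
    proof cases
      case 1
      then have "c = c' \<and> d = d'"
        using pair_determined[of x y c d c' d'] JD(4)[OF J(1)] s by simp
      then show ?thesis
        using 1 J by (auto simp: e)
    next
      case 2
      then have "c = d' \<and> d = c'"
        using pair_determined[of x y c d d' c'] JD(4)[OF J(1)] s by (simp add: add.commute)
      then show ?thesis
        using 2 J by (force simp: e)
    qed
  qed
  then have "card Q0 \<le> card ((\<lambda>i. (i, i)) ` J \<union> (\<lambda>(x, y, c, d). ((x, y, c, d), (y, x, d, c))) ` J)"
    using finJ by (intro card_mono) auto
  also have "\<dots> \<le> card J + card J"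
    using finJ by (intro order_trans[OF card_Un_le] add_mono card_image_le)
  finally have Q0: "card Q0 \<le> 2 * card J"
    by simp
  \<comment> \<open>Putting the smaller radius first makes the packing of larger meeting balls
    applicable; swapping shows that at least half of the nontrivial coincidences remain.\<close>
  define Q2 where "Q2 = {(i, j) \<in> Q. slopes i \<noteq> slopes j \<and> \<rho> (fst i) \<le> \<rho> (fst j)}"
  have Q2_sub: "Q2 \<subseteq> Q" and Q0_sub: "Q0 \<subseteq> Q"
    by (auto simp: Q2_def Q0_def)
  have "Q \<subseteq> Q0 \<union> (Q2 \<union> prod.swap ` Q2)"
  proof
    fix ij assume ij: "ij \<in> Q"
    obtain i j where e: "ij = (i, j)"
      by (rule prod.exhaust)
    have "(j, i) \<in> Q"
      using ij by (auto simp: e Q_def)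
    then consider "(i, j) \<in> Q0" | "(i, j) \<in> Q2" | "(j, i) \<in> Q2"
      using ij e linear[of "\<rho> (fst i)" "\<rho> (fst j)"] by (simp add: Q0_def Q2_def) metis
    then show "ij \<in> Q0 \<union> (Q2 \<union> prod.swap ` Q2)"
      by cases (auto simp: e intro: image_eqI[of _ _ "(j, i)"])
  qed
  then have "card Q \<le> card (Q0 \<union> (Q2 \<union> prod.swap ` Q2))"
    using finQ finite_subset[OF Q2_sub] finite_subset[OF Q0_sub] by (intro card_mono) auto
  also have "\<dots> \<le> card Q0 + (card Q2 + card Q2)"
    using finQ finite_subset[OF Q2_sub]
    by (intro order_trans[OF card_Un_le] add_mono order_refl) (auto intro: card_image_le)
  finally have Q2: "card J \<le> card Q2"
    using Q4 Q0 by linarith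
  \<comment> \<open>For fixed \<open>x\<close> there are \<open>m\<close> choices of
    \<open>y\<close>, at most \<open>13122 * (2 * m)\<close> of \<open>x'\<close> by packing, and
    \<open>m\<close> of \<open>y'\<close>, hence the bound \<open>26244 * m ^ 3\<close>
    below.\<close>
  define T where "T x = {(y, x', y'). y \<in> U x \<and> x' \<in> {z \<in> S. \<rho> x \<le> \<rho> z \<and> norm (z - x) \<le> \<rho> z + \<rho> x} \<and>
    y' \<in> U x' \<and> {x, y} \<noteq> {x', y'}}" for x
  define ov where "ov x = (\<lambda>(y, x', y'). {(c, d). c \<in> F x \<and> d \<in> F y \<and>
    (\<exists>c'\<in>F x'. \<exists>d'\<in>F y'. c + d = c' + d' \<and> c * x + d * y = c' * x' + d' * y')})" for x
  have T: "finite (T x) \<and> card (T x) \<le> 26244 * m ^ 3" if x: "x \<in> S" for x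
  proof -
    let ?N = "{z \<in> S. \<rho> x \<le> \<rho> z \<and> norm (z - x) \<le> \<rho> z + \<rho> x}"
    let ?B = "U x \<times> (SIGMA x':?N. U x')"
    have "card ?N \<le> 13122 * (2 * m)"
      using S U x by (intro card_larger_meeting_balls) auto
    then have "m * (card ?N * m) \<le> m * (13122 * (2 * m) * m)"
      by (intro mult_left_mono mult_right_mono) auto
    also have "\<dots> = 26244 * m ^ 3"
      by (simp add: power3_eq_cube)
    finally have N: "m * (card ?N * m) \<le> 26244 * m ^ 3" .
    have sub: "T x \<subseteq> ?B"
      by (auto simp: T_def)
    have finB: "finite ?B"
      using x S finU by (intro finite_cartesian_product finite_SigmaI) auto
    have "card (SIGMA x':?N. U x') = (\<Sum>x'\<in>?N. card (U x'))"
      using S finU by (intro card_SigmaI) auto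
    then have "card ?B = m * (card ?N * m)"
      using x U(2) by (simp add: card_cartesian_product)
    then have "card (T x) \<le> 26244 * m ^ 3"
      using card_mono[OF finB sub] N by linarith
    then show ?thesis
      using finite_subset[OF sub finB] by blast
  qed
  have ovF: "ov x t \<subseteq> F x \<times> F (fst t)" for x t
    by (auto simp: ov_def split: prod.splits)
  have ov_fin: "finite (ov x t) \<and> card (ov x t) \<le> r\<^sup>2" if x: "x \<in> S" and t: "t \<in> T x" for x t
  proof -
    have "fst t \<in> S"
      using t U(1)[OF x] by (auto simp: T_def)
    then have "finite (F x \<times> F (fst t))" "card (F x \<times> F (fst t)) = r\<^sup>2"
      using x finF F(2) by (auto simp: card_cartesian_product power2_eq_square)
    then show ?thesis
      using card_mono[OF _ ovF] finite_subset[OF ovF] by metis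
  qed
  have "card Q2 \<le> card (SIGMA x:S. SIGMA t:T x. ov x t)"
  proof (rule card_inj_on_le)
    \<comment> \<open>The points \<open>c'\<close> and \<open>d'\<close> can be forgotten: the
      slopes and the sum determine them.\<close>
    let ?h = "\<lambda>((x, y, c, d), (x', y', c', d')). (x, (y, x', y'), (c, d)) ::
      quat \<times> (quat \<times> quat \<times> quat) \<times> (quat \<times> quat)"
    show "inj_on ?h Q2"
    proof (rule inj_onI)
      fix p p' assume p: "p \<in> Q2" "p' \<in> Q2" and h: "?h p = ?h p'"
      obtain x y c d x' y' c1 d1 where e: "p = ((x, y, c, d), (x', y', c1, d1))"
        by (metis prod.exhaust)
      obtain c2 d2 where e': "p' = ((x, y, c, d), (x', y', c2, d2))"
        using h by (auto simp: e split: prod.splits)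
      from p have "((x, y, c, d), (x', y', c1, d1)) \<in> Q2" "((x, y, c, d), (x', y', c2, d2)) \<in> Q2"
        by (simp_all only: e e')
      then have "(x', y', c1, d1) \<in> J" "c1 + d1 = c2 + d2" "c1 * x' + d1 * y' = c2 * x' + d2 * y'"
        by (auto simp: Q2_def Q_def \<pi>_def)
      then have "c1 = c2 \<and> d1 = d2"
        using pair_determined[of x' y' c1 d1 c2 d2] JD(4) by blast
      then show "p = p'"
        by (simp add: e e')
    qed
    show "?h ` Q2 \<subseteq> (SIGMA x:S. SIGMA t:T x. ov x t)"
    proof (rule image_subsetI)
      fix p assume p: "p \<in> Q2"
      obtain x y c d x' y' c' d' where e: "p = ((x, y, c, d), (x', y', c', d'))"
        by (metis prod.exhaust)
      from p have J: "(x, y, c, d) \<in> J" "(x', y', c', d') \<in> J"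
        and s: "c + d = c' + d'" "c * x + d * y = c' * x' + d' * y'"
        and "{x, y} \<noteq> {x', y'}" "\<rho> x \<le> \<rho> x'"
        by (auto simp: e Q2_def Q_def \<pi>_def slopes_def)
      have "norm (x - inverse (c + d) * (c * x + d * y)) \<le> \<rho> x"
        using dist_slope_of_sum[OF A(2) JA(1,2)[OF J(1)], of x y] U(4)[OF JD(1,2)[OF J(1)]] by linarith
      moreover have "norm (x' - inverse (c + d) * (c * x + d * y)) \<le> \<rho> x'"
        unfolding s
        using dist_slope_of_sum[OF A(2) JA(1,2)[OF J(2)], of x' y'] U(4)[OF JD(1,2)[OF J(2)]] by linarith
      ultimately have "norm (x' - x) \<le> \<rho> x' + \<rho> x"
        using norm_triangle_ineq4[of "x' - inverse (c + d) * (c * x + d * y)" "x - inverse (c + d) * (c * x + d * y)"]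
        by simp
      then show "?h p \<in> (SIGMA x:S. SIGMA t:T x. ov x t)"
        using JD[OF J(1)] JD[OF J(2)] s \<open>{x, y} \<noteq> {x', y'}\<close> \<open>\<rho> x \<le> \<rho> x'\<close> by (auto simp: e T_def ov_def)
    qed
    show "finite (SIGMA x:S. SIGMA t:T x. ov x t)"
      using S T ov_fin by (intro finite_SigmaI) auto
  qed
  also have "\<dots> = (\<Sum>x\<in>S. \<Sum>t\<in>T x. card (ov x t))"
  proof -
    have "card (SIGMA t:T x. ov x t) = (\<Sum>t\<in>T x. card (ov x t))" if "x \<in> S" for x
      using that T ov_fin by (intro card_SigmaI) auto
    moreover have "card (SIGMA x:S. SIGMA t:T x. ov x t) = (\<Sum>x\<in>S. card (SIGMA t:T x. ov x t))"
      using S T ov_fin by (intro card_SigmaI ballI finite_SigmaI) auto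
    ultimately show ?thesis
      by simp
  qed
  finally have total: "card S * m * r\<^sup>2 \<le> (\<Sum>x\<in>S. \<Sum>t\<in>T x. card (ov x t))"
    using Q2 cardJ by linarith
  \<comment> \<open>The threshold is \<open>26244 * m ^ 3\<close> divided by \<open>m / 2\<close>: a
    slope outside \<open>S1\<close> contributes at most half of the average
    \<open>m * r\<^sup>2\<close>, so \<open>S1\<close> supplies the other half.\<close>
  define S1 where "S1 = {x \<in> S. \<exists>t\<in>T x. r\<^sup>2 \<le> 52488 * m\<^sup>2 * card (ov x t)}"
  have S1: "S1 \<subseteq> S" "finite S1"
    using S by (auto simp: S1_def)
  have large: "(\<Sum>t\<in>T x. card (ov x t)) \<le> 26244 * m ^ 3 * r\<^sup>2" if x: "x \<in> S" for x
  proof -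
    have "(\<Sum>t\<in>T x. card (ov x t)) \<le> card (T x) * r\<^sup>2"
      using sum_bounded_above[of "T x" "\<lambda>t. card (ov x t)" "r\<^sup>2"] ov_fin[OF x] by simp
    also have "\<dots> \<le> 26244 * m ^ 3 * r\<^sup>2"
      using T[OF x] by (intro mult_right_mono) auto
    finally show ?thesis .
  qed
  have small: "2 * (\<Sum>t\<in>T x. card (ov x t)) \<le> m * r\<^sup>2" if x: "x \<in> S - S1" for x
  proof -
    have "52488 * m\<^sup>2 * card (ov x t) \<le> r\<^sup>2" if "t \<in> T x" for t
      using x that by (auto simp: S1_def not_le intro: less_imp_le)
    then have "(\<Sum>t\<in>T x. 52488 * m\<^sup>2 * card (ov x t)) \<le> card (T x) * r\<^sup>2"
      using sum_bounded_above[of "T x" "\<lambda>t. 52488 * m\<^sup>2 * card (ov x t)" "r\<^sup>2"] by simp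
    also have "\<dots> \<le> 26244 * m ^ 3 * r\<^sup>2"
      using T[of x] x by (intro mult_right_mono) auto
    also have "\<dots> = (26244 * m\<^sup>2) * (m * r\<^sup>2)"
      by (simp add: power2_eq_square power3_eq_cube)
    also have "(\<Sum>t\<in>T x. 52488 * m\<^sup>2 * card (ov x t)) = (26244 * m\<^sup>2) * (2 * (\<Sum>t\<in>T x. card (ov x t)))"
      unfolding sum_distrib_left by (intro sum.cong) auto
    finally show ?thesis
      using S(2) by (subst (asm) mult_le_cancel1) auto
  qed
  have "2 * (card S * m * r\<^sup>2) \<le> 2 * (\<Sum>x\<in>S. \<Sum>t\<in>T x. card (ov x t))"
    using total by simp
  also have "\<dots> = 2 * (\<Sum>x\<in>S1. \<Sum>t\<in>T x. card (ov x t)) + (\<Sum>x\<in>S - S1. 2 * (\<Sum>t\<in>T x. card (ov x t)))"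
    using sum.subset_diff[OF S1(1) S(1), of "\<lambda>x. \<Sum>t\<in>T x. card (ov x t)"] by (simp add: sum_distrib_left)
  also have "\<dots> \<le> 2 * (card S1 * (26244 * m ^ 3 * r\<^sup>2)) + card (S - S1) * (m * r\<^sup>2)"
    using sum_bounded_above[of S1 "\<lambda>x. \<Sum>t\<in>T x. card (ov x t)" "26244 * m ^ 3 * r\<^sup>2"]
      sum_bounded_above[of "S - S1" "\<lambda>x. 2 * (\<Sum>t\<in>T x. card (ov x t))" "m * r\<^sup>2"] large small S1
    by (intro add_mono mult_left_mono) auto
  also have "\<dots> \<le> 2 * (card S1 * (26244 * m ^ 3 * r\<^sup>2)) + card S * (m * r\<^sup>2)"
    using S by (intro add_mono mult_right_mono card_mono) auto
  finally have "card S * (m * r\<^sup>2) \<le> (52488 * m\<^sup>2 * card S1) * (m * r\<^sup>2)"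
    by (simp add: power2_eq_square power3_eq_cube mult_ac)
  then have "card S \<le> 52488 * m\<^sup>2 * card S1"
    using S \<open>1 \<le> r\<close> by (simp only: mult_le_cancel2) auto
  also have "\<dots> \<le> 52488 * m\<^sup>2 * card {x \<in> S. \<exists>y\<in>S. \<exists>z\<in>S. \<exists>\<mu>1 \<mu>2 \<mu>3. \<mu>1 \<noteq> 0 \<and> \<mu>2 \<noteq> 0 \<and> \<mu>3 \<noteq> 0 \<and>
    r\<^sup>2 \<le> 52488 * m\<^sup>2 * card (relation_pairs F x y z \<mu>1 \<mu>2 \<mu>3)}"
  proof (intro mult_left_mono card_mono subsetI CollectI conjI)
    fix x assume "x \<in> S1"
    then obtain t where x: "x \<in> S" and t: "t \<in> T x" and big: "r\<^sup>2 \<le> 52488 * m\<^sup>2 * card (ov x t)"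
      by (auto simp: S1_def)
    then show "x \<in> S"
      by simp
    obtain y x' y' where e: "t = (y, x', y')"
      by (metis prod.exhaust)
    have y: "y \<in> U x" "x' \<in> S" "y' \<in> U x'" "{x, y} \<noteq> {x', y'}"
      using t by (auto simp: T_def e)
    then have mem: "y \<in> S" "y' \<in> S" and ne: "x \<noteq> y" "x' \<noteq> y'"
      using U(1)[OF x] U(1)[OF y(2)] by auto
    obtain z \<mu>1 \<mu>2 \<mu>3 where z: "z \<in> {x', y'}" and \<mu>: "\<mu>1 \<noteq> 0" "\<mu>2 \<noteq> 0" "\<mu>3 \<noteq> 0"
      and rel: "\<And>c d c' d'. c + d = c' + d' \<Longrightarrow> c * x + d * y = c' * x' + d' * y' \<Longrightarrow>
        c * \<mu>1 + d * \<mu>2 = (if z = x' then c' else d') * \<mu>3"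
      using coincidence_gives_relation[OF ne y(4)] by blast
    have zS: "z \<in> S"
      using z y mem by auto
    have "ov x t \<subseteq> relation_pairs F x y z \<mu>1 \<mu>2 \<mu>3"
    proof clarify
      fix c d assume "(c, d) \<in> ov x t"
      then obtain c' d' where cd: "c \<in> F x" "d \<in> F y" "c' \<in> F x'" "d' \<in> F y'"
        "c + d = c' + d'" "c * x + d * y = c' * x' + d' * y'"
        by (auto simp: ov_def e)
      have "(if z = x' then c' else d') \<in> F z"
        using z cd by auto
      with rel[OF cd(5,6)] show "(c, d) \<in> relation_pairs F x y z \<mu>1 \<mu>2 \<mu>3"
        using cd unfolding relation_pairs_def by blast
    qed
    moreover have "finite (relation_pairs F x y z \<mu>1 \<mu>2 \<mu>3)"
      by (rule finite_subset[of _ "F x \<times> F y"]) (use x mem finF in \<open>auto simp: relation_pairs_def\<close>)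
    ultimately have "card (ov x t) \<le> card (relation_pairs F x y z \<mu>1 \<mu>2 \<mu>3)"
      by (intro card_mono)
    then have "r\<^sup>2 \<le> 52488 * m\<^sup>2 * card (relation_pairs F x y z \<mu>1 \<mu>2 \<mu>3)"
      using big by (meson mult_le_mono2 order_trans)
    then show "\<exists>y\<in>S. \<exists>z\<in>S. \<exists>\<mu>1 \<mu>2 \<mu>3. \<mu>1 \<noteq> 0 \<and> \<mu>2 \<noteq> 0 \<and> \<mu>3 \<noteq> 0 \<and>
        r\<^sup>2 \<le> 52488 * m\<^sup>2 * card (relation_pairs F x y z \<mu>1 \<mu>2 \<mu>3)"
      using \<mu> zS mem by blast
  qed (use S in auto)
  finally show ?thesis .
qed

section \<open>Bookkeeping of powers\<close>

text \<open>An estimate \<open>x \<le> B ^ k * y\<close> serves as an inequality up to an acceptable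
  loss, with the exponent tracked explicitly. The later assumption \<open>100000 \<le> B\<close>
  lets a factor of \<open>B\<close> absorb numerical constants.\<close>

lemma power_loss_trans:
  fixes B :: real
  assumes "x \<le> B ^ k * y" "y \<le> B ^ l * z" "0 \<le> B"
  shows "x \<le> B ^ (k + l) * z"
proof -
  have "B ^ k * y \<le> B ^ k * (B ^ l * z)"
    using assms by (intro mult_left_mono) auto
  then show ?thesis
    using assms by (simp add: power_add mult.assoc)
qed

lemma power_loss_mult:
  fixes B :: real
  assumes "x \<le> B ^ k * y" "x' \<le> B ^ l * y'" "0 \<le> x" "0 \<le> x'"
  shows "x * x' \<le> B ^ (k + l) * (y * y')"
proof -
  have "x * x' \<le> (B ^ k * y) * (B ^ l * y')"
    using assms by (intro mult_mono) auto
  then show ?thesis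
    by (simp add: power_add mult_ac)
qed

lemma power_loss_power:
  fixes B :: real
  assumes "x \<le> B ^ k * y" "0 \<le> x"
  shows "x ^ m \<le> B ^ (k * m) * y ^ m"
  using power_mono[OF assms, of m] by (simp add: power_mult_distrib power_mult)

lemma power_loss_cancel:
  fixes B :: real
  assumes "x * z \<le> B ^ k * (y * z)" "0 < z"
  shows "x \<le> B ^ k * y"
  using assms by (simp add: mult.assoc[symmetric])

lemma power_loss_mono:
  fixes B :: real
  assumes "x \<le> B ^ k * y" "k \<le> l" "1 \<le> B" "0 \<le> y"
  shows "x \<le> B ^ l * y"
  using assms by (meson mult_right_mono order_trans power_increasing)

section \<open>The two passes with explicit losses\<close>

lemma hsum_mono: "m \<le> n \<Longrightarrow> hsum m \<le> hsum n"
  unfolding hsum_def by (rule sum_mono2) auto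

text \<open>The parameter \<open>i\<close> measures how far \<open>card A\<close> may fall short of
  \<open>q ^ 3\<close>, so that the same statement serves the original set with \<open>i = 0\<close>
  and the subset \<open>C\<close> later. The hypothesis \<open>large\<close> ensures more than
  \<open>m\<close> slopes, as clustering requires.\<close>

lemma exists_rich_relations:
  fixes B q :: real
  assumes A: "finite A" "acute A" "A \<noteq> {}" and B: "100000 \<le> B" and "0 < q"
    and n: "card A \<le> q ^ 3" "q ^ 3 \<le> B ^ i * card A"
    and sum: "card (sumset A A) \<le> B * q ^ 4" and prod: "card (prodset A A) \<le> B * q ^ 4"
    and h: "hsum (card A) \<le> B" and large: "B ^ (16 * i + 17) < q\<^sup>2"
  shows "\<exists>S S1 F r. finite S \<and> S1 \<subseteq> S \<and> S1 \<noteq> {} \<and> 1 \<le> r \<and> (\<forall>x\<in>S. F x \<subseteq> fib A x \<and> card (F x) = r) \<and>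
    card S * r \<le> (card A)\<^sup>2 \<and> q ^ 8 \<le> B ^ (8 * i + 7) * (card S * (real r)\<^sup>2) \<and>
    card S \<le> B ^ (16 * i + 21) * card S1 \<and>
    (\<forall>x\<in>S1. \<exists>y\<in>S. \<exists>z\<in>S. \<exists>\<mu>1 \<mu>2 \<mu>3. \<mu>1 \<noteq> 0 \<and> \<mu>2 \<noteq> 0 \<and> \<mu>3 \<noteq> 0 \<and>
      (real r)\<^sup>2 \<le> B ^ (16 * i + 21) * card (relation_pairs F x y z \<mu>1 \<mu>2 \<mu>3))"
proof -
  let ?N = "real (card (prodset A A))" and ?s = "real (card (sumset A A))" and ?h = "hsum (card A)"
  have B1: "1 \<le> B" "0 < B"
    using B by auto
  obtain S r where S: "finite S" "1 \<le> r" "r \<le> card A" "\<And>x. x \<in> S \<Longrightarrow> r \<le> card (fib A x)"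
    and Sr: "card S * r \<le> (card A)\<^sup>2"
    and n8: "real (card A) ^ 8 \<le> ?N\<^sup>2 * (2 * real (card S * r\<^sup>2) * ?h) * (26244 * (card (sumset A A))\<^sup>2 * ?h)"
    using exists_rich_slopes[OF A] by blast
  define J where "J = card S * (real r)\<^sup>2"
  have J0: "0 \<le> J"
    by (simp add: J_def)
  have "real (card A) ^ 8 \<le> ?N\<^sup>2 * (2 * J * ?h) * (26244 * ?s\<^sup>2 * ?h)"
    using n8 by (simp add: J_def)
  also have "\<dots> \<le> (B * q ^ 4)\<^sup>2 * (2 * J * B) * (26244 * (B * q ^ 4)\<^sup>2 * B)"
    using sum prod h hsum_nonneg[of "card A"] J0 B1 by (intro mult_mono power_mono mult_nonneg_nonneg) auto
  also have "\<dots> = 52488 * (B ^ 6 * (q ^ 16 * J))"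
    by (simp add: power_mult_distrib mult_ac flip: power_mult power_add power_Suc)
  also have "\<dots> \<le> B * (B ^ 6 * (q ^ 16 * J))"
    using B \<open>0 < q\<close> J0 by (intro mult_right_mono) auto
  also have "\<dots> = B ^ 7 * (q ^ 16 * J)"
    by (simp add: mult.assoc flip: power_Suc)
  finally have "real (card A) ^ 8 \<le> B ^ 7 * (q ^ 16 * J)" .
  moreover have "(q ^ 3) ^ 8 \<le> B ^ (i * 8) * real (card A) ^ 8"
    using n \<open>0 < q\<close> by (intro power_loss_power) auto
  ultimately have "(q ^ 3) ^ 8 \<le> B ^ (i * 8 + 7) * (q ^ 16 * J)"
    using B1 by (auto intro: power_loss_trans)
  then have "q ^ 8 * q ^ 16 \<le> B ^ (i * 8 + 7) * (J * q ^ 16)"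
    by (simp add: mult.commute flip: power_mult power_add)
  then have "q ^ 8 \<le> B ^ (i * 8 + 7) * J"
    by (rule power_loss_cancel) (use \<open>0 < q\<close> in simp)
  then have q8: "q ^ 8 \<le> B ^ (8 * i + 7) * J"
    by (simp add: mult.commute)
  \<comment> \<open>Just large enough for \<open>few\<close>: \<open>4 * (B * q ^ 4)\<^sup>2\<close>
    is at most \<open>4 * B ^ (8 * i + 9) * J\<close>. Rounding up costs one more factor of
    \<open>B\<close>.\<close>
  define m where "m = nat \<lceil>4 * B ^ (8 * i + 9)\<rceil>"
  have Bpos: "0 < B ^ k" "1 \<le> B ^ k" for k
    using B1 by auto
  have m_ge: "4 * B ^ (8 * i + 9) \<le> m"
    unfolding m_def by linarith
  then have m1: "1 \<le> m"
    using Bpos(2)[of "8 * i + 9"] by linarith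
  have "real m \<le> 4 * B ^ (8 * i + 9) + 1"
    using Bpos(1)[of "8 * i + 9"] unfolding m_def by linarith
  also have "\<dots> \<le> 5 * B ^ (8 * i + 9)"
    using Bpos(2)[of "8 * i + 9"] by linarith
  also have "\<dots> \<le> B * B ^ (8 * i + 9)"
    using B Bpos(1)[of "8 * i + 9"] by (intro mult_right_mono) auto
  finally have m_le: "m \<le> B ^ (8 * i + 10)"
    by (simp add: add.commute flip: power_Suc)
  have "q ^ 2 * q ^ 6 \<le> B ^ (8 * i + 7) * J"
    using q8 by (simp flip: power_add)
  also have "\<dots> \<le> B ^ (8 * i + 7) * (card S * q ^ 6)"
  proof -
    have "(real r)\<^sup>2 \<le> (q ^ 3)\<^sup>2"
      using S(3) n(1) by (intro power_mono) auto
    then have "J \<le> card S * q ^ 6"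
      by (simp add: J_def mult_left_mono flip: power_mult)
    then show ?thesis
      using Bpos(1)[of "8 * i + 7"] by simp
  qed
  finally have "q\<^sup>2 \<le> B ^ (8 * i + 7) * card S"
    by (rule power_loss_cancel) (use \<open>0 < q\<close> in simp)
  then have "B ^ (8 * i + 7) * B ^ (8 * i + 10) < B ^ (8 * i + 7) * card S"
    using large by (simp flip: power_add)
  then have "B ^ (8 * i + 10) < card S"
    using Bpos(1)[of "8 * i + 7"] by (simp only: mult_less_cancel_left_pos)
  then have m_S: "m < card S"
    using m_le by linarith
  have "4 * ?s\<^sup>2 \<le> 4 * (B * q ^ 4)\<^sup>2"
    using sum by (intro mult_left_mono power_mono) auto
  also have "\<dots> = 4 * B\<^sup>2 * q ^ 8"
    by (simp add: power_mult_distrib flip: power_mult)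
  also have "\<dots> \<le> 4 * B\<^sup>2 * (B ^ (8 * i + 7) * J)"
    using q8 by (intro mult_left_mono) auto
  also have "\<dots> = 4 * B ^ (8 * i + 9) * J"
    by (simp add: add.commute flip: power_add mult.assoc)
  also have "\<dots> \<le> m * J"
    using m_ge J0 by (rule mult_right_mono)
  finally have "real (4 * (card (sumset A A))\<^sup>2) \<le> real (card S * m * r\<^sup>2)"
    by (simp add: J_def mult_ac)
  then have few: "4 * (card (sumset A A))\<^sup>2 \<le> card S * m * r\<^sup>2"
    by (simp only: of_nat_le_iff)
  have "\<exists>F. \<forall>x\<in>S. F x \<subseteq> fib A x \<and> card (F x) = r"
    using S(4) by (intro bchoice ballI) (metis obtain_subset_with_card_n)
  then obtain F where F: "\<forall>x\<in>S. F x \<subseteq> fib A x \<and> card (F x) = r"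
    by blast
  define S1 where "S1 = {x \<in> S. \<exists>y\<in>S. \<exists>z\<in>S. \<exists>\<mu>1 \<mu>2 \<mu>3. \<mu>1 \<noteq> 0 \<and> \<mu>2 \<noteq> 0 \<and> \<mu>3 \<noteq> 0 \<and>
    r\<^sup>2 \<le> 52488 * m\<^sup>2 * card (relation_pairs F x y z \<mu>1 \<mu>2 \<mu>3)}"
  have "card S \<le> 52488 * m\<^sup>2 * card S1"
    unfolding S1_def using F by (intro clustered_slopes[OF A(1,2) S(1) m1 m_S _ _ S(2) few]) auto
  have m2: "real (52488 * m\<^sup>2 * k) \<le> B ^ (16 * i + 21) * k" for k :: nat
  proof -
    have "52488 * (real m)\<^sup>2 \<le> B * (B ^ (8 * i + 10))\<^sup>2"
      using B m_le by (intro mult_mono power_mono) auto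
    also have "\<dots> = B ^ (16 * i + 21)"
      by (simp add: algebra_simps flip: power_mult power_Suc)
    finally show ?thesis
      by (simp add: mult_right_mono)
  qed
  have S1': "card S \<le> B ^ (16 * i + 21) * card S1"
    using m2[of "card S1"] \<open>card S \<le> 52488 * m\<^sup>2 * card S1\<close> by (meson of_nat_mono order_trans)
  have "S1 \<noteq> {}"
    using \<open>card S \<le> 52488 * m\<^sup>2 * card S1\<close> m_S by auto
  moreover have "\<exists>y\<in>S. \<exists>z\<in>S. \<exists>\<mu>1 \<mu>2 \<mu>3. \<mu>1 \<noteq> 0 \<and> \<mu>2 \<noteq> 0 \<and> \<mu>3 \<noteq> 0 \<and>
      (real r)\<^sup>2 \<le> B ^ (16 * i + 21) * card (relation_pairs F x y z \<mu>1 \<mu>2 \<mu>3)" if x: "x \<in> S1" for x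
  proof -
    obtain y z \<mu>1 \<mu>2 \<mu>3 where "y \<in> S" "z \<in> S" "\<mu>1 \<noteq> 0" "\<mu>2 \<noteq> 0" "\<mu>3 \<noteq> 0"
      and *: "r\<^sup>2 \<le> 52488 * m\<^sup>2 * card (relation_pairs F x y z \<mu>1 \<mu>2 \<mu>3)"
      using x unfolding S1_def by blast
    moreover have "(real r)\<^sup>2 \<le> B ^ (16 * i + 21) * card (relation_pairs F x y z \<mu>1 \<mu>2 \<mu>3)"
      using order_trans[OF of_nat_mono[OF *] m2[of "card (relation_pairs F x y z \<mu>1 \<mu>2 \<mu>3)"]] by simp
    ultimately show ?thesis
      by blast
  qed
  moreover have "S1 \<subseteq> S"
    by (auto simp: S1_def)
  ultimately show ?thesis
    using S(1,2) F Sr q8 S1' unfolding J_def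
    by (intro exI[of _ S] exI[of _ S1] exI[of _ F] exI[of _ r]) blast
qed

text \<open>The first pass. Counting points bounds \<open>r\<close> below by about
  \<open>q\<^sup>2\<close>, and fitting \<open>H * H\<close> into \<open>A * A\<close> bounds it
  above by the same. Hence overlaps of size \<open>r\<^sup>2\<close> are a large part of
  \<open>A * A\<close>.\<close>

lemma exists_popular_subset:
  fixes B q :: real
  assumes A: "finite A" "acute A" "A \<noteq> {}" and B: "100000 \<le> B" and "0 < q" and n: "card A = q ^ 3"
    and sum: "card (sumset A A) \<le> B * q ^ 4" and prod: "card (prodset A A) \<le> B * q ^ 4"
    and h: "hsum (card A) \<le> B" and large: "B ^ 17 < q\<^sup>2"
  shows "\<exists>C W. C \<subseteq> A \<and> finite W \<and> 0 \<notin> W \<and> q ^ 3 \<le> B ^ 1254 * card C \<and> card W \<le> B ^ 4943 * q ^ 4 \<and>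
    (\<forall>p\<in>ratios C. q ^ 4 \<le> B ^ 1642 * card {b \<in> W. b * p \<in> W})"
proof -
  let ?N = "real (card (prodset A A))"
  have B1: "1 \<le> B" "0 \<le> B"
    using B by auto
  obtain S S1 F r where S: "finite S" "S1 \<subseteq> S" "S1 \<noteq> {}" "1 \<le> r"
    and F: "\<forall>x\<in>S. F x \<subseteq> fib A x \<and> card (F x) = r"
    and Sr: "card S * r \<le> (card A)\<^sup>2" and q8: "q ^ 8 \<le> B ^ 7 * (card S * (real r)\<^sup>2)"
    and SS1: "card S \<le> B ^ 21 * card S1"
    and rel: "\<forall>x\<in>S1. \<exists>y\<in>S. \<exists>z\<in>S. \<exists>\<mu>1 \<mu>2 \<mu>3. \<mu>1 \<noteq> 0 \<and> \<mu>2 \<noteq> 0 \<and> \<mu>3 \<noteq> 0 \<and>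
      (real r)\<^sup>2 \<le> B ^ 21 * card (relation_pairs F x y z \<mu>1 \<mu>2 \<mu>3)"
    using exists_rich_relations[OF A B \<open>0 < q\<close>, of 0] n sum prod h large by auto
  have "real (card S * r) \<le> (q ^ 3)\<^sup>2"
    using of_nat_mono[OF Sr, where 'a = real] n by simp
  then have Sr6: "card S * real r \<le> q ^ 6"
    by (simp flip: power_mult)
  have q26: "q\<^sup>2 * q ^ 6 = q ^ 8"
    by (simp flip: power_add)
  have r_low: "q\<^sup>2 \<le> B ^ 7 * r"
  proof (rule power_loss_cancel)
    have "q\<^sup>2 * q ^ 6 \<le> B ^ 7 * ((card S * real r) * r)"
      using q8 unfolding q26 by (simp add: power2_eq_square mult.assoc)
    also have "\<dots> \<le> B ^ 7 * (q ^ 6 * r)"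
      using Sr6 B1 by (intro mult_left_mono mult_right_mono) auto
    finally show "q\<^sup>2 * q ^ 6 \<le> B ^ 7 * (r * q ^ 6)"
      by (simp add: mult_ac)
  qed (use \<open>0 < q\<close> in simp)
  have pop: "r\<^sup>2 \<le> B ^ 806 * card {b \<in> prodset A A. b * x \<in> prodset A A}" if x: "x \<in> S1" for x
  proof -
    obtain y z \<mu>1 \<mu>2 \<mu>3 where yz: "y \<in> S" "z \<in> S" and \<mu>: "\<mu>1 \<noteq> 0" "\<mu>2 \<noteq> 0"
      and d: "(real r)\<^sup>2 \<le> B ^ 21 * card (relation_pairs F x y z \<mu>1 \<mu>2 \<mu>3)"
      using rel x by blast
    have xS: "x \<in> S"
      using x S by auto
    have finF: "finite (F x)" if "x \<in> S" for x
      using F that A finite_subset[OF _ finite_fib] by blast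
    have "\<exists>H\<subseteq>F x. r \<le> 73728 * (B ^ 21) ^ 7 * card H \<and> card (sumset H H) \<le> 3072 * (B ^ 21) ^ 5 * r"
      using S F xS yz \<mu> finF d[unfolded relation_pairs_def] B1
      by (intro small_doubling_subset[where Y = "F y" and Z = "F z"]) auto
    then obtain H where H: "H \<subseteq> F x" and rH: "r \<le> 73728 * (B ^ 21) ^ 7 * card H"
      and HH: "card (sumset H H) \<le> 3072 * (B ^ 21) ^ 5 * r"
      by blast
    have HA: "H \<subseteq> fib A x" "H \<subseteq> A"
      using H F xS fib_subset by blast+
    have finH: "finite H" and acH: "acute H"
      using HA A finite_subset acute_subset by blast+
    have "73728 * B ^ 147 * card H \<le> B * B ^ 147 * card H"
      using B B1 by (intro mult_right_mono) auto
    then have rH': "real r \<le> B ^ 148 * card H"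
      using rH by (simp flip: power_mult power_Suc)
    have "3072 * B ^ 105 * r \<le> B * B ^ 105 * r"
      using B B1 by (intro mult_right_mono) auto
    then have HH': "real (card (sumset H H)) \<le> B ^ 106 * r"
      using HH by (simp flip: power_mult power_Suc)
    have hH: "hsum (card H) \<le> B"
      using h hsum_mono[OF card_mono[OF A(1) HA(2)]] by linarith
    \<comment> \<open>Solymosi's inequality for \<open>H\<close>: since \<open>H + H\<close> has
      size about \<open>r\<close>, there are about \<open>r\<^sup>2\<close> products.\<close>
    have "real (card H) ^ 4 \<le> real (card (prodset H H)) * (26244 * (card (sumset H H))\<^sup>2 * hsum (card H))"
      using card_prodset_lower_bound[OF finH acH] by simp
    also have "\<dots> \<le> real (card (prodset H H)) * (B * (B ^ 106 * r)\<^sup>2 * B)"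
      using HH' hH B B1 hsum_nonneg[of "card H"]
      unfolding of_nat_mult of_nat_power of_nat_numeral
      by (intro mult_left_mono mult_mono power_mono) auto
    also have "\<dots> = B ^ 214 * (card (prodset H H) * (real r)\<^sup>2)"
      by (simp add: power_mult_distrib mult_ac flip: power_mult power_Suc)
    finally have H4: "real (card H) ^ 4 \<le> B ^ 214 * (card (prodset H H) * (real r)\<^sup>2)" .
    have "real r ^ 4 \<le> B ^ (148 * 4) * real (card H) ^ 4"
      by (rule power_loss_power[OF rH']) simp
    then have "real r ^ 4 \<le> B ^ (148 * 4 + 214) * (card (prodset H H) * (real r)\<^sup>2)"
      by (rule power_loss_trans[OF _ H4 B1(2)])
    then have "(real r)\<^sup>2 * (real r)\<^sup>2 \<le> B ^ 806 * (card (prodset H H) * (real r)\<^sup>2)"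
      by (simp flip: power_add)
    then have r2: "(real r)\<^sup>2 \<le> B ^ 806 * card (prodset H H)"
      by (rule power_loss_cancel) (use S in simp)
    have "prodset H H \<subseteq> {b \<in> prodset A A. b * x \<in> prodset A A}"
    proof
      fix b assume "b \<in> prodset H H"
      then obtain c d where cd: "b = c * d" "c \<in> H" "d \<in> H"
        by (auto simp: prodset_conv)
      then have "c \<in> A" "d \<in> A" "d * x \<in> A"
        using HA by (auto simp: fib_def)
      then have "c * d \<in> prodset A A" "c * (d * x) \<in> prodset A A"
        by (auto intro: prodsetI)
      then show "b \<in> {b \<in> prodset A A. b * x \<in> prodset A A}"
        by (simp add: cd mult.assoc)
    qed
    then have "card (prodset H H) \<le> card {b \<in> prodset A A. b * x \<in> prodset A A}"
      using A by (intro card_mono) auto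
    then have "B ^ 806 * card (prodset H H) \<le> B ^ 806 * card {b \<in> prodset A A. b * x \<in> prodset A A}"
      using B1 by (intro mult_left_mono) auto
    then show ?thesis
      using r2 by simp
  qed
  have N0: "?N \<le> B ^ 1 * q ^ 4"
    using prod by simp
  have q4: "q ^ 4 \<le> B ^ 14 * (real r)\<^sup>2"
    using power_loss_power[OF r_low, of 2] by (simp flip: power_mult)
  have N_r: "?N \<le> B ^ 15 * (real r)\<^sup>2"
    using power_loss_trans[OF N0 q4 B1(2)] by simp
  have S1_0: "0 \<notin> S1"
  proof
    assume "0 \<in> S1"
    then have "fib A 0 \<noteq> {}"
      using F S by force
    then show False
      using A(2) by (auto simp: fib_def acute_def)
  qed
  have pop': "card (prodset A A) \<le> B ^ 821 * card {b \<in> prodset A A. b * x \<in> prodset A A}" if "x \<in> S1" for x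
    using power_loss_trans[OF N_r _ B1(2), of 806] pop[OF that] by simp
  have rich: "r \<le> card (fib A x)" if "x \<in> S1" for x
    using F S(2) that card_mono[OF finite_fib[OF A(1)], of "F x" x] by auto
  have finS1: "finite S1"
    using S finite_subset by blast
  obtain C W where C: "C \<subseteq> A" and W: "finite W" "0 \<notin> W"
    and S1C: "card S1 * r \<le> 4 * B ^ 821 * (card A * card C)"
    and WS1: "real (card W) * card S1 \<le> 3072 * (B ^ 821) ^ 5 * (card (prodset A A))\<^sup>2"
    and act: "\<forall>p\<in>ratios C. card (prodset A A) \<le> 6 * B ^ 821 * card {b \<in> W. b * p \<in> W}"
    using exists_popular_ratios[OF A(1) finS1 A(3) S(3) _ S1_0 _ pop' rich] A(2) B1
    by (auto simp: acute_def)
  obtain x where "x \<in> S1"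
    using S by blast
  have "card {b \<in> prodset A A. b * x \<in> prodset A A} \<le> card (prodset A A)"
    using A by (intro card_mono) auto
  then have "B ^ 806 * card {b \<in> prodset A A. b * x \<in> prodset A A} \<le> B ^ 806 * ?N"
    using B1 by (intro mult_left_mono) auto
  then have r_N: "(real r)\<^sup>2 \<le> B ^ 806 * ?N"
    using pop[OF \<open>x \<in> S1\<close>] by simp
  have r_q: "(real r)\<^sup>2 \<le> B ^ 807 * q ^ 4"
    using power_loss_trans[OF r_N N0 B1(2)] by simp
  have "(real r)\<^sup>2 \<le> B ^ 808 * q ^ 4"
    using power_loss_mono[OF r_q, of 808] B1 by simp
  also have "\<dots> = (B ^ 404 * q\<^sup>2)\<^sup>2"
    by (simp add: power_mult_distrib flip: power_mult)
  finally have r_q2: "real r \<le> B ^ 404 * q\<^sup>2"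
    by (rule power2_le_imp_le) (use B1 in simp)
  have "q ^ 3 \<le> B ^ 1254 * card C"
  proof -
    have "q\<^sup>2 * q ^ 6 \<le> B ^ 7 * ((card S * real r) * r)"
      using q8 unfolding q26 by (simp add: power2_eq_square mult.assoc)
    also have "\<dots> \<le> B ^ 7 * ((card S * real r) * (B ^ 404 * q\<^sup>2))"
      using r_q2 B1 by (intro mult_left_mono) auto
    also have "\<dots> = B ^ 411 * ((card S * real r) * q\<^sup>2)"
      by (simp add: mult_ac flip: power_add)
    finally have "q ^ 6 * q\<^sup>2 \<le> B ^ 411 * ((card S * real r) * q\<^sup>2)"
      by (simp add: mult.commute)
    then have "q ^ 6 \<le> B ^ 411 * (card S * real r)"
      by (rule power_loss_cancel) (use \<open>0 < q\<close> in simp)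
    moreover have "card S * real r \<le> B ^ 21 * (card S1 * real r)"
      using mult_right_mono[OF SS1, of "real r"] by (simp add: mult.assoc)
    ultimately have "q ^ 6 \<le> B ^ (411 + 21) * (card S1 * real r)"
      using B1(2) by (rule power_loss_trans)
    moreover have "card S1 * real r \<le> B ^ 822 * (card C * q ^ 3)"
    proof -
      have "4 * B ^ 821 * (card A * card C) \<le> B * B ^ 821 * (card A * card C)"
        using B B1 by (intro mult_right_mono) auto
      then show ?thesis
        using S1C n by (simp add: mult_ac flip: power_Suc)
    qed
    ultimately have "q ^ 6 \<le> B ^ ((411 + 21) + 822) * (card C * q ^ 3)"
      using B1(2) by (rule power_loss_trans)
    then have "q ^ 3 * q ^ 3 \<le> B ^ 1254 * (card C * q ^ 3)"
      by (simp flip: power_add)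
    then show ?thesis
      by (rule power_loss_cancel) (use \<open>0 < q\<close> in simp)
  qed
  moreover have "card W \<le> B ^ 4943 * q ^ 4"
  proof -
    have "q ^ 4 * q ^ 4 \<le> B ^ 7 * (card S * (real r)\<^sup>2)"
      using q8 by (simp flip: power_add)
    moreover have "card S * (real r)\<^sup>2 \<le> B ^ (21 + 807) * (card S1 * q ^ 4)"
      using SS1 r_q by (rule power_loss_mult) auto
    ultimately have "q ^ 4 * q ^ 4 \<le> B ^ (7 + (21 + 807)) * (card S1 * q ^ 4)"
      using B1(2) by (rule power_loss_trans)
    then have "q ^ 4 \<le> B ^ (7 + (21 + 807)) * card S1"
      by (rule power_loss_cancel) (use \<open>0 < q\<close> in simp)
    then have S1_q: "q ^ 4 \<le> B ^ 835 * card S1"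
      by simp
    have "real (card W) * q ^ 4 \<le> real (card W) * (B ^ 835 * card S1)"
      using S1_q by (rule mult_left_mono) simp
    then have "real (card W) * q ^ 4 \<le> B ^ 835 * (real (card W) * card S1)"
      by (simp add: mult_ac)
    moreover have "real (card W) * card S1 \<le> B ^ 4106 * (?N)\<^sup>2"
    proof -
      have "3072 * B ^ 4105 * (?N)\<^sup>2 \<le> B * B ^ 4105 * (?N)\<^sup>2"
        using B B1 by (intro mult_right_mono) auto
      then show ?thesis
        using WS1 by (simp flip: power_mult power_Suc)
    qed
    ultimately have "real (card W) * q ^ 4 \<le> B ^ (835 + 4106) * (?N)\<^sup>2"
      using B1(2) by (rule power_loss_trans)
    moreover have "(?N)\<^sup>2 \<le> B ^ (1 * 2) * (q ^ 4)\<^sup>2"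
      using N0 by (rule power_loss_power) simp
    ultimately have "real (card W) * q ^ 4 \<le> B ^ (835 + 4106 + 1 * 2) * (q ^ 4)\<^sup>2"
      using B1(2) by (rule power_loss_trans)
    then have "real (card W) * q ^ 4 \<le> B ^ 4943 * (q ^ 4 * q ^ 4)"
      by (simp add: power2_eq_square)
    then show ?thesis
      by (rule power_loss_cancel) (use \<open>0 < q\<close> in simp)
  qed
  moreover have "q ^ 4 \<le> B ^ 1642 * card {b \<in> W. b * p \<in> W}" if "p \<in> ratios C" for p
  proof -
    have "6 * B ^ 821 * card {b \<in> W. b * p \<in> W} \<le> B * B ^ 821 * card {b \<in> W. b * p \<in> W}"
      using B B1 by (intro mult_right_mono) auto
    then have N_act: "?N \<le> B ^ 822 * card {b \<in> W. b * p \<in> W}"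
      using act that by (force simp flip: power_Suc)
    have "q ^ 4 \<le> B ^ (14 + 806) * ?N"
      using q4 r_N B1(2) by (rule power_loss_trans)
    then have "q ^ 4 \<le> B ^ (14 + 806 + 822) * card {b \<in> W. b * p \<in> W}"
      using N_act B1(2) by (rule power_loss_trans)
    then show ?thesis
      by simp
  qed
  ultimately show ?thesis
    using C W by blast
qed

text \<open>The bound is applied with \<open>B\<close> a multiple of a tiny power of \<open>q\<close>, so only the boundedness of the
  exponents of \<open>B\<close> matters, not their size.\<close>

theorem sum_product_power_loss:
  fixes B q :: real
  assumes A: "finite A" "acute A" "A \<noteq> {}" and B: "100000 \<le> B" and q: "card A = q ^ 3" "0 < q"
    and sum: "card (sumset A A) \<le> B * q ^ 4" and prod: "card (prodset A A) \<le> B * q ^ 4"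
    and h: "hsum (card A) \<le> B"
  shows "q\<^sup>2 \<le> B ^ 550693"
proof (rule ccontr)
  assume "\<not> ?thesis"
  then have large: "B ^ 550693 < q\<^sup>2"
    by simp
  have B1: "1 \<le> B" "0 \<le> B"
    using B by auto
  \<comment> \<open>The final exponent exceeds all intermediate ones, so every largeness condition
    of the two passes is at hand.\<close>
  have large': "B ^ k < q\<^sup>2" if "k \<le> 550693" for k
    using power_increasing[OF that B1(1)] large by linarith
  obtain C W where C: "C \<subseteq> A" and W: "finite W" "0 \<notin> W" and qC: "q ^ 3 \<le> B ^ 1254 * card C"
    and W_le: "card W \<le> B ^ 4943 * q ^ 4"
    and act: "\<And>p. p \<in> ratios C \<Longrightarrow> q ^ 4 \<le> B ^ 1642 * card {b \<in> W. b * p \<in> W}"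
    using exists_popular_subset[OF A B q(2,1) sum prod h large'] by force
  have finC: "finite C" and acC: "acute C"
    using C A finite_subset acute_subset by blast+
  have "C \<noteq> {}"
    using qC q(2) by auto
  have cardC: "card C \<le> card A"
    using C A by (intro card_mono)
  have "card (sumset C C) \<le> card (sumset A A)"
    using C A by (intro card_mono) (auto simp: sumset_conv)
  then have sumC: "card (sumset C C) \<le> B * q ^ 4"
    using sum by linarith
  have "card (prodset C C) \<le> card (prodset A A)"
    using C A by (intro card_mono) (auto simp: prodset_conv)
  then have prodC: "card (prodset C C) \<le> B * q ^ 4"
    using prod by linarith
  have hC: "hsum (card C) \<le> B"
    using h hsum_mono[OF cardC] by linarith
  have nC: "card C \<le> q ^ 3"
    using cardC q by linarith
  \<comment> \<open>The second pass, now with \<open>i = 1254\<close>: the exponents are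
    \<open>8 * i + 7 = 10039\<close> and \<open>16 * i + 21 = 20085\<close>.\<close>
  obtain S S1 F r where S: "finite S" "S1 \<subseteq> S" "S1 \<noteq> {}" "1 \<le> r"
    and F: "\<forall>x\<in>S. F x \<subseteq> fib C x \<and> card (F x) = r"
    and Sr: "card S * r \<le> (card C)\<^sup>2" and q8: "q ^ 8 \<le> B ^ 10039 * (card S * (real r)\<^sup>2)"
    and rel: "\<forall>x\<in>S1. \<exists>y\<in>S. \<exists>z\<in>S. \<exists>\<mu>1 \<mu>2 \<mu>3. \<mu>1 \<noteq> 0 \<and> \<mu>2 \<noteq> 0 \<and> \<mu>3 \<noteq> 0 \<and>
      (real r)\<^sup>2 \<le> B ^ 20085 * card (relation_pairs F x y z \<mu>1 \<mu>2 \<mu>3)"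
    using exists_rich_relations[OF finC acC \<open>C \<noteq> {}\<close> B q(2) nC qC sumC prodC hC] large'[of 20081] by auto
  have "real (card S * r) \<le> (real (card C))\<^sup>2"
    using of_nat_mono[OF Sr, where 'a = real] by simp
  also have "\<dots> \<le> (q ^ 3)\<^sup>2"
    using nC by (intro power_mono) auto
  finally have Sr6: "card S * real r \<le> q ^ 6"
    by (simp flip: power_mult)
  have q26: "q\<^sup>2 * q ^ 6 = q ^ 8"
    by (simp flip: power_add)
  have r_low: "q\<^sup>2 \<le> B ^ 10039 * r"
  proof (rule power_loss_cancel)
    have "q\<^sup>2 * q ^ 6 \<le> B ^ 10039 * ((card S * real r) * r)"
      using q8 unfolding q26 by (simp add: power2_eq_square mult.assoc)
    also have "\<dots> \<le> B ^ 10039 * (q ^ 6 * r)"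
      using Sr6 B1 by (intro mult_left_mono mult_right_mono) auto
    finally show "q\<^sup>2 * q ^ 6 \<le> B ^ 10039 * (r * q ^ 6)"
      by (simp add: mult_ac)
  qed (use \<open>0 < q\<close> in simp)
  obtain x y z \<mu>1 \<mu>2 \<mu>3 where xyz: "x \<in> S" "y \<in> S" "z \<in> S" and \<mu>: "\<mu>1 \<noteq> 0" "\<mu>2 \<noteq> 0" "\<mu>3 \<noteq> 0"
    and dense: "(real r)\<^sup>2 \<le> B ^ 20085 * card (relation_pairs F x y z \<mu>1 \<mu>2 \<mu>3)"
    using S rel by blast
  define G where "G = relation_pairs F x y z \<mu>1 \<mu>2 \<mu>3"
  define P where "P = (\<lambda>(c, d). inverse d * c) ` G"
  have FC: "F x \<subseteq> C" if "x \<in> S" for x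
    using F that fib_subset by blast
  then have finF: "finite (F x)" if "x \<in> S" for x
    using finC that finite_subset by blast
  have C0: "0 \<notin> C"
    using acC by (simp add: acute_def)
  have F0: "0 \<notin> F x" if "x \<in> S" for x
    using FC[OF that] C0 by blast
  have finP: "finite P"
    unfolding P_def G_def relation_pairs_def
    by (rule finite_imageI, rule finite_subset[of _ "F x \<times> F y"]) (use finF xyz in auto)
  have "real r ^ 3 \<le> (104976 * (B ^ 20085) ^ 3 * card P)\<^sup>2"
    using finF F xyz S(4) B1 \<mu> F0 dense P_def
    by (intro card_ratios_of_solutions[where X = "F x" and Y = "F y" and Z = "F z" and G = G])
      (auto simp: G_def relation_pairs_def)
  also have "\<dots> \<le> (B ^ 60257 * card P)\<^sup>2"
  proof -
    have "104976 * B ^ 60255 * card P \<le> B\<^sup>2 * B ^ 60255 * card P"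
      using power_mono[OF B, of 2] B1 by (intro mult_right_mono) auto
    then show ?thesis
      using B1 by (intro power_mono) (auto simp flip: power_mult power_add)
  qed
  also have "\<dots> = B ^ 120514 * (real (card P))\<^sup>2"
    by (simp add: power_mult_distrib flip: power_mult)
  finally have rP: "real r ^ 3 \<le> B ^ 120514 * (real (card P))\<^sup>2" .
  have P_sub: "p \<in> ratios C" "(p * \<mu>1 + \<mu>2) * inverse \<mu>3 \<in> ratios C" if p: "p \<in> P" for p
  proof -
    obtain c d e where e: "p = inverse d * c" "c \<in> C" "d \<in> C" "e \<in> C" "c * \<mu>1 + d * \<mu>2 = e * \<mu>3"
      using p FC xyz by (auto simp: P_def G_def relation_pairs_def) blast
    then show "p \<in> ratios C"
      by (auto simp: ratios_def)
    have "d \<noteq> 0"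
      using e C0 by auto
    \<comment> \<open>The relation is homogeneous on the left: factoring out
      \<open>inverse d\<close> turns it into an affine condition on the ratio \<open>p\<close>
      alone.\<close>
    then have "(p * \<mu>1 + \<mu>2) = inverse d * (c * \<mu>1 + d * \<mu>2)"
      by (simp add: e(1) distrib_left mult.assoc[symmetric])
    then have "(p * \<mu>1 + \<mu>2) * inverse \<mu>3 = inverse d * e"
      using \<mu> by (simp add: e(5) mult.assoc)
    then show "(p * \<mu>1 + \<mu>2) * inverse \<mu>3 \<in> ratios C"
      using e by (auto simp: ratios_def)
  qed
  have "0 \<notin> ratios C"
    using C0 by (auto simp: ratios_def)
  then have P0: "0 \<notin> P"
    using P_sub by auto
  \<comment> \<open>Rounding up is harmless, since \<open>D\<close> is compared with a
    cardinality.\<close>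
  define D where "D = nat \<lceil>q ^ 4 / B ^ 1642\<rceil>"
  have Bp: "0 < B ^ k" for k
    using B by simp
  have D_le: "D \<le> card {b \<in> W. b * p \<in> W}" if "p \<in> ratios C" for p
    using act[OF that] Bp[of 1642] by (simp add: D_def nat_le_iff ceiling_le_iff divide_simps mult.commute)
  have D_ge: "q ^ 4 \<le> B ^ 1642 * D"
  proof -
    have "q ^ 4 / B ^ 1642 \<le> D"
      unfolding D_def by linarith
    then show ?thesis
      using Bp[of 1642] by (simp add: divide_simps mult.commute)
  qed
  have "real (card P) ^ 3 * real D ^ 6 \<le> (104976 * real (card W) ^ 4)\<^sup>2"
    using D_le P_sub W finP P0 \<mu> by (intro card_affine_multipliers[of W P \<mu>1 \<mu>2 \<mu>3]) auto
  also have "\<dots> \<le> (B\<^sup>2 * real (card W) ^ 4)\<^sup>2"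
    using power_mono[OF B, of 2] B1 by (intro power_mono mult_right_mono) auto
  also have "\<dots> = B ^ 4 * real (card W) ^ 8"
    by (simp add: power_mult_distrib flip: power_mult)
  finally have "real (card P) ^ 3 * real D ^ 6 \<le> B ^ 4 * real (card W) ^ 8" .
  moreover have "real (card W) ^ 8 \<le> B ^ (4943 * 8) * (q ^ 4) ^ 8"
    by (rule power_loss_power[OF W_le]) simp
  ultimately have PD: "real (card P) ^ 3 * real D ^ 6 \<le> B ^ (4 + 4943 * 8) * (q ^ 4) ^ 8"
    using B1(2) by (rule power_loss_trans)
  have "real (card P) ^ 3 * (q ^ 4) ^ 6 \<le> real (card P) ^ 3 * (B ^ (1642 * 6) * real D ^ 6)"
    using power_loss_power[OF D_ge, of 6] q(2) by (intro mult_left_mono) auto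
  then have "real (card P) ^ 3 * (q ^ 4) ^ 6 \<le> B ^ (1642 * 6) * (real (card P) ^ 3 * real D ^ 6)"
    by (simp add: mult_ac)
  then have "real (card P) ^ 3 * (q ^ 4) ^ 6 \<le> B ^ (1642 * 6 + (4 + 4943 * 8)) * (q ^ 4) ^ 8"
    using PD B1(2) by (rule power_loss_trans)
  then have "real (card P) ^ 3 * q ^ 24 \<le> B ^ 49400 * (q ^ 8 * q ^ 24)"
    by (simp flip: power_mult power_add)
  then have P3: "real (card P) ^ 3 \<le> B ^ 49400 * q ^ 8"
    by (rule power_loss_cancel) (use q in simp)
  have "(q\<^sup>2) ^ 3 \<le> B ^ (10039 * 3) * real r ^ 3"
    using r_low by (rule power_loss_power) simp
  then have "(q\<^sup>2) ^ 3 \<le> B ^ (10039 * 3 + 120514) * (real (card P))\<^sup>2"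
    using rP B1(2) by (rule power_loss_trans)
  \<comment> \<open>Both estimates are brought to the sixth power of \<open>card P\<close>: the
    lower one becomes \<open>q ^ 18\<close>, the upper one \<open>q ^ 16\<close>.\<close>
  then have "((q\<^sup>2) ^ 3) ^ 3 \<le> B ^ ((10039 * 3 + 120514) * 3) * ((real (card P))\<^sup>2) ^ 3"
    by (rule power_loss_power) simp
  then have "q ^ 18 \<le> B ^ 451893 * (real (card P) ^ 3)\<^sup>2"
    by (simp flip: power_mult)
  moreover have "(real (card P) ^ 3)\<^sup>2 \<le> B ^ (49400 * 2) * (q ^ 8)\<^sup>2"
    using P3 by (rule power_loss_power) simp
  ultimately have "q ^ 18 \<le> B ^ (451893 + 49400 * 2) * (q ^ 8)\<^sup>2"
    using B1(2) by (rule power_loss_trans)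
  then have "q\<^sup>2 * q ^ 16 \<le> B ^ 550693 * (1 * q ^ 16)"
    by (simp flip: power_mult power_add)
  then have "q\<^sup>2 \<le> B ^ 550693 * 1"
    by (rule power_loss_cancel) (use q in simp)
  then show False
    using large by simp
qed

section \<open>From the power loss to an exponent\<close>

lemma hsum_le_ln:
  assumes "1 \<le> n"
  shows "hsum n \<le> 1 + ln (real n)"
  using assms
proof (induction n rule: nat_induct_at_least)
  case base
  then show ?case
    by (simp add: hsum_def)
next
  case (Suc n)
  have "ln (real n / real (Suc n)) \<le> real n / real (Suc n) - 1"
    using Suc by (intro ln_le_minus_one) simp
  also have "\<dots> = - (1 / real (Suc n))"
    by (simp add: field_simps)
  finally have "1 / real (Suc n) \<le> ln (real (Suc n)) - ln (real n)"
    using Suc by (simp add: ln_div)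
  moreover have "hsum (Suc n) = hsum n + 1 / real (Suc n)"
    by (simp add: hsum_def)
  ultimately show ?case
    using Suc.IH by linarith
qed

theorem theorem1p1:
  shows "\<exists>c::real. c > 0 \<and> (\<exists>C::real. C > 0 \<and>
           (\<forall>A :: quat set. finite A \<longrightarrow>
              real (card (sumset A A)) + real (card (prodset A A))
                \<ge> C * real (card A) powr (4/3 + c)))"
proof -
  have "\<exists>k. 1 \<le> k \<and> (\<forall>A B q. finite A \<longrightarrow> acute A \<longrightarrow> A \<noteq> {} \<longrightarrow> 100000 \<le> B \<longrightarrow> real (card A) = q ^ 3 \<longrightarrow>
      0 < q \<longrightarrow> real (card (sumset A A)) \<le> B * q ^ 4 \<longrightarrow> real (card (prodset A A)) \<le> B * q ^ 4 \<longrightarrow>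
      hsum (card A) \<le> B \<longrightarrow> q\<^sup>2 \<le> B ^ k)"
    using sum_product_power_loss by (intro exI[of _ 550693]) auto
  then obtain k :: nat where k: "1 \<le> k" and
    loss: "\<And>A B q. \<lbrakk>finite A; acute A; A \<noteq> {}; 100000 \<le> B; real (card A) = q ^ 3; 0 < q;
      real (card (sumset A A)) \<le> B * q ^ 4; real (card (prodset A A)) \<le> B * q ^ 4; hsum (card A) \<le> B\<rbrakk>
      \<Longrightarrow> q\<^sup>2 \<le> B ^ k"
    by metis
  \<comment> \<open>Large enough for the condition on \<open>B\<close> and for
    \<open>1 + 3 * ln q \<le> E * q powr (1 / k)\<close>, which controls
    \<open>hsum\<close>.\<close>
  define E where "E = 100001 + 3 * real k"
  \<comment> \<open>With \<open>n = q ^ 3\<close> this makes \<open>n powr e\<close> equal to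
    \<open>q ^ 4 * q powr (1 / k)\<close>.\<close>
  define e where "e = 4 / 3 + 1 / (3 * real k)"
  define C where "C = inverse (E ^ (4 * k + 1) * 6562 powr e)"
  have E: "100000 \<le> E" "1 + 3 * real k \<le> E" "0 < E" "1 \<le> E"
    by (auto simp: E_def)
  have e: "0 < e"
    using k by (simp add: e_def add_pos_nonneg)
  have E1: "1 \<le> E ^ (4 * k + 1)"
    using E by (intro one_le_power)
  have pos: "0 < E ^ (4 * k + 1) * 6562 powr e"
    using E by simp
  have "1 * 1 \<le> E ^ (4 * k + 1) * 6562 powr e"
    using E1 e by (intro mult_mono ge_one_powr_ge_zero) auto
  then have C: "0 < C" "C \<le> 1"
    unfolding C_def using pos le_imp_inverse_le[of 1 "E ^ (4 * k + 1) * 6562 powr e"]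
    by (simp_all only: inverse_positive_iff_positive mult_1 inverse_1 zero_less_one)
  have acute_case: "real (card A) powr e \<le> E ^ (4 * k + 1) * (real (card (sumset A A)) + real (card (prodset A A)))"
    if A: "finite A" "acute A" "A \<noteq> {}" for A
  proof -
    define n where "n = card A"
    have n1: "1 \<le> n"
      using A by (simp add: n_def Suc_le_eq card_gt_0_iff)
    define q where "q = real n powr (1 / 3)"
    have q1: "1 \<le> q"
      using n1 by (simp add: q_def ge_one_powr_ge_zero)
    have q3: "q ^ 3 = n"
      using n1 by (simp add: q_def powr_power)
    have ne: "real n powr e = q ^ 4 * q powr (1 / k)"
    proof -
      have "q ^ 4 * q powr (1 / k) = q powr (4 + 1 / k)"
        using q1 by (simp add: powr_add)
      also have "\<dots> = real n powr (1 / 3 * (4 + 1 / k))"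
        by (simp add: q_def powr_powr)
      also have "1 / 3 * (4 + 1 / k) = e"
        by (simp add: e_def distrib_left)
      finally show ?thesis ..
    qed
    \<comment> \<open>Then \<open>B ^ k\<close> is only \<open>E ^ k * q\<close>, so
      \<open>q\<^sup>2 \<le> B ^ k\<close> bounds \<open>q\<close> by the constant
      \<open>E ^ k\<close>; and \<open>B * q ^ 4\<close> is exactly \<open>E * n powr e\<close>, the
      size to be beaten.\<close>
    define B where "B = E * q powr (1 / k)"
    have qk: "1 \<le> q powr (1 / k)"
      using q1 by (simp add: ge_one_powr_ge_zero)
    have EB: "E \<le> B"
      using E qk by (simp add: B_def)
    have "1 / k * ln q \<le> q powr (1 / k)"
      using ln_le_minus_one[of "q powr (1 / k)"] q1 by (simp add: ln_powr)
    then have "3 * ln q \<le> 3 * k * q powr (1 / k)"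
      using k by (simp add: field_simps)
    moreover have "ln (real n) = 3 * ln q"
      using q1 by (simp flip: q3 add: ln_realpow)
    ultimately have "hsum n \<le> 1 + 3 * k * q powr (1 / k)"
      using hsum_le_ln[OF n1] by linarith
    also have "\<dots> \<le> (1 + 3 * k) * q powr (1 / k)"
      using qk by (simp add: distrib_right)
    also have "\<dots> \<le> B"
      unfolding B_def using E qk by (intro mult_right_mono) auto
    finally have h: "hsum n \<le> B" .
    let ?s = "real (card (sumset A A))" and ?p = "real (card (prodset A A))"
    show ?thesis
    proof (cases "?s \<le> B * q ^ 4 \<and> ?p \<le> B * q ^ 4")
      case True
      then have "q\<^sup>2 \<le> B ^ k"
        using loss[of A B q] A E EB q3 q1 h by (simp add: n_def)
      also have "\<dots> = E ^ k * q"
        using q1 k by (simp add: B_def power_mult_distrib powr_power)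
      finally have q_le: "q \<le> E ^ k"
        using q1 by (simp add: power2_eq_square)
      have "q powr (1 / k) \<le> (E ^ k) powr (1 / k)"
        using q_le q1 by (intro powr_mono2) auto
      also have "\<dots> = E"
        using E k by (simp add: powr_powr flip: powr_realpow)
      finally have "real n powr e \<le> (E ^ k) ^ 4 * E"
        unfolding ne using q_le q1 by (intro mult_mono power_mono) auto
      also have "\<dots> = E ^ (4 * k + 1)"
        by (simp add: power_add mult.commute flip: power_mult)
      also have "\<dots> \<le> E ^ (4 * k + 1) * (?s + ?p)"
      proof -
        have "1 \<le> ?s"
          using card_le_card_sumset[OF A(1)] n1 by (simp add: n_def)
        then show ?thesis
          using E1 by (simp add: mult_le_cancel_left1)
      qed
      finally show ?thesis
        by (simp add: n_def)
    next
      case False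
      then have "B * q ^ 4 \<le> ?s + ?p"
        by linarith
      moreover have "1 * (q ^ 4 * q powr (1 / k)) \<le> E * (q ^ 4 * q powr (1 / k))"
        using E q1 by (intro mult_right_mono) auto
      ultimately have "real n powr e \<le> ?s + ?p"
        by (simp add: B_def ne mult_ac)
      also have "1 * (?s + ?p) \<le> E ^ (4 * k + 1) * (?s + ?p)"
        using E1 by (intro mult_right_mono) auto
      finally show ?thesis
        by (simp add: n_def)
    qed
  qed
  have "C * real (card A) powr e \<le> real (card (sumset A A)) + real (card (prodset A A))"
    if A: "finite A" for A
  proof -
    let ?s = "\<lambda>A. real (card (sumset A A)) + real (card (prodset A A))"
    obtain A' where A': "A' \<subseteq> A" "acute A'" and n: "card A \<le> 6561 * card A' + 1"
      using exists_acute_subset[OF A] by blast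
    have finA': "finite A'"
      using A' A finite_subset by blast
    show ?thesis
    proof (cases "A' = {}")
      case True
      then have "card A \<le> 1"
        using n by simp
      \<comment> \<open>\<open>0 powr e = 0\<close> and \<open>1 powr e = 1\<close>, so the exponent
        disappears.\<close>
      then have "real (card A) powr e = real (card A)"
        by (cases "card A") auto
      moreover have "C * real (card A) \<le> 1 * real (card A)"
        using C by (intro mult_right_mono) auto
      moreover have "real (card A) \<le> real (card (sumset A A))"
        using card_le_card_sumset[OF A] by simp
      ultimately show ?thesis
        by simp
    next
      case False
      then have "1 \<le> card A'"
        using finA' by (simp add: Suc_le_eq card_gt_0_iff)
      \<comment> \<open>The extra 1 for the element 0 is absorbed because \<open>A'\<close> is
        nonempty.\<close>
      then have "real (card A) \<le> 6562 * real (card A')"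
        using n by linarith
      then have "real (card A) powr e \<le> (6562 * real (card A')) powr e"
        using e by (intro powr_mono2) auto
      also have "\<dots> = 6562 powr e * real (card A') powr e"
        by (simp add: powr_mult)
      also have "\<dots> \<le> 6562 powr e * (E ^ (4 * k + 1) * ?s A')"
        using acute_case[OF finA' A'(2) False] by (intro mult_left_mono) auto
      finally have "C * real (card A) powr e \<le> ?s A'"
        using pos by (simp add: C_def field_simps)
      also have "\<dots> \<le> ?s A"
        using A A' by (intro add_mono of_nat_mono card_mono) (auto simp: sumset_conv prodset_conv)
      finally show ?thesis .
    qed
  qed
  then show ?thesis
    using C k unfolding e_def by (intro exI[of _ "1 / (3 * real k)"] conjI exI[of _ C]) auto
qed

end
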